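(* Let $0<q\le p$ satisfy $p^2+q^2<1$, and suppose there exists $\tilde\delta\in(0,1)$ such that $\mathcal S_{p,q}(\delta)<0$ for all $0<\delta<\tilde\delta$. Let $f_0$ be a function on $\mathbb R$ with $f_0\ge 0$, $\int_{\mathbb R} f_0(v)\,dv=1$, $\int_{\mathbb R} v\,f_0(v)\,dv=0$, $\int_{\mathbb R} v^2 f_0(v)\,dv=1$, and $\int_{\mathbb R}|v|^{2+\tilde\delta}f_0(v)\,dv<+\infty$. Suppose in addition that $f_0\in H^\eta(\mathbb R)$ for some $\eta>0$ and $\sqrt{f_0}\in\dot H^\nu(\mathbb R)$ for some $\nu>0$. Let $f(t)=f(\cdot,t)$ be the solution of $$\partial_t\hat f(\xi,t)=\hat f(p\xi,t)\,\hat f(q\xi,t)-\hat f(\xi,t),\qquad\hat f(\xi,0)=\hat f_0(\xi),$$ let $E(t)=e^{(p^2+q^2-1)t}$, and let $$f_\infty(v,t)=\frac1{\sqrt{E(t)}}\,g_\infty\!\left(\frac v{\sqrt{E(t)}}\right)$$ be the self-similar state. Then there exist positive constants $C$ and $\gamma$ such that $$\|f(t)-f_\infty(t)\|_{L^1(\mathbb R)}\le Ce^{-\gamma t},\qquad t\ge0 .$$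
   Context: For $p,q>0$ and $\delta\ge0$, $\mathcal S_{p,q}(\delta)=p^{2+\delta}+q^{2+\delta}-1-\frac{2+\delta}{2}\,(p^2+q^2-1)$. The Fourier transform is $\hat h(\xi)=\int_{\mathbb R}h(v)e^{-i\xi v}\,dv$ (in the variable $v$ only). $H^\eta(\mathbb R)$ is the usual Sobolev space, and $\|h\|_{\dot H^\eta(\mathbb R)}^2=\int_{\mathbb R}|\xi|^{2\eta}|\hat h(\xi)|^2\,d\xi$ is the homogeneous Sobolev norm. The solution $f$ is the unique nonnegative solution in $C^1([0,+\infty),L^1(\mathbb R))$ (known to exist, with unit mass and zero mean for all times); $E(t)=\int_{\mathbb R} v^2f(v,t)\,dv$ is its second moment. $g_\infty$ is the unique stationary solution of the scaled equation $\partial_t\hat g+\tfrac12(p^2+q^2-1)\xi\partial_\xi\hat g=\hat g(p\xi,t)\hat g(q\xi,t)-\hat g(\xi,t)$: under the stated assumptions on $p,q,\tilde\delta$ it is known (Pareschi–Toscani) that there is a unique $g_\infty\ge0$ with $\int_{\mathbb R} g_\infty\,dv=1$, $\int_{\mathbb R} v g_\infty\,dv=0$, $\int_{\mathbb R} v^2g_\infty\,dv=1$, $\int_{\mathbb R}|v|^{2+\delta}g_\infty\,dv<+\infty$ for every $0<\delta<\tilde\delta$, and $\tfrac12(p^2+q^2-1)\,\xi\,\hat g_\infty'(\xi)=\hat g_\infty(p\xi)\hat g_\infty(q\xi)-\hat g_\infty(\xi)$ for $\xi\in\mathbb R$. *)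

theory Defs
  imports "HOL-Analysis.Analysis"
begin

definition S_pq :: "real \<Rightarrow> real \<Rightarrow> real \<Rightarrow> real" where
  "S_pq p q \<delta> = p powr (2 + \<delta>) + q powr (2 + \<delta>) - 1 - (2 + \<delta>) / 2 * (p\<^sup>2 + q\<^sup>2 - 1)"

text \<open>Elements of Lebesgue spaces are represented by Borel functions; sign conditions on them are
  therefore imposed almost everywhere only.\<close>

definition fourier :: "(real \<Rightarrow> real) \<Rightarrow> real \<Rightarrow> complex" where
  "fourier h \<xi> = (LINT v|lborel. complex_of_real (h v) * exp (- (\<i> * complex_of_real (\<xi> * v))))"

definition L1_norm :: "(real \<Rightarrow> real) \<Rightarrow> real" where
  "L1_norm h = (LINT v|lborel. \<bar>h v\<bar>)"

definition square_integrable :: "(real \<Rightarrow> 'a::{real_normed_vector,second_countable_topology}) \<Rightarrow> bool" where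
  "square_integrable h \<longleftrightarrow>
     h \<in> borel_measurable lborel \<and> integrable lborel (\<lambda>v. (norm (h v))\<^sup>2)"

text \<open>A square-integrable function (such as the square root of a probability density) need not
  be integrable, so the integral \<^term>\<open>fourier h\<close> may be meaningless. Its Fourier--Plancherel
  transform is the limit in the space of square-integrable functions of the transforms of its
  truncations, which are integrable; it is unique up to null sets, and agrees almost everywhere
  with \<^term>\<open>fourier h\<close> if \<^term>\<open>h\<close> is integrable as well.\<close>

definition is_L2_fourier :: "(real \<Rightarrow> real) \<Rightarrow> (real \<Rightarrow> complex) \<Rightarrow> bool" where
  "is_L2_fourier h H \<longleftrightarrow> square_integrable h \<and> square_integrable H \<and>
     ((\<lambda>R. \<integral>\<^sup>+ \<xi>. ennreal ((cmod (fourier (\<lambda>v. indicator {-R..R} v * h v) \<xi> - H \<xi>))\<^sup>2) \<partial>lborel)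
        \<longlongrightarrow> 0) at_top"

definition sobolev_space :: "real \<Rightarrow> (real \<Rightarrow> real) set" where
  "sobolev_space \<eta> = {h. \<exists>H. is_L2_fourier h H \<and>
     (\<integral>\<^sup>+ \<xi>. ennreal ((1 + \<xi>\<^sup>2) powr \<eta> * (cmod (H \<xi>))\<^sup>2) \<partial>lborel) < \<infinity>}"

text \<open>The homogeneous norm is only considered on square-integrable functions.\<close>

definition hom_sobolev_space :: "real \<Rightarrow> (real \<Rightarrow> real) set" where
  "hom_sobolev_space \<nu> = {h. \<exists>H. is_L2_fourier h H \<and>
     (\<integral>\<^sup>+ \<xi>. ennreal (\<bar>\<xi>\<bar> powr (2 * \<nu>) * (cmod (H \<xi>))\<^sup>2) \<partial>lborel) < \<infinity>}"

text \<open>Functions of time and velocity are curried with time first, so that \<^term>\<open>f t\<close> is the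
  velocity profile at time \<^term>\<open>t\<close>. The function \<open>f'\<close> below is the strong derivative
  (one-sided at time 0), the limit of the difference quotients in the \<^const>\<open>L1_norm\<close>.\<close>

definition C1_L1 :: "(real \<Rightarrow> real \<Rightarrow> real) \<Rightarrow> bool" where
  "C1_L1 f \<longleftrightarrow> (\<forall>t\<ge>0. integrable lborel (f t)) \<and>
     (\<exists>f'. \<forall>t\<ge>0. integrable lborel (f' t) \<and>
        ((\<lambda>s. L1_norm (\<lambda>v. (f s v - f t v) / (s - t) - f' t v)) \<longlongrightarrow> 0) (at t within {0..}) \<and>
        ((\<lambda>s. L1_norm (\<lambda>v. f' s v - f' t v)) \<longlongrightarrow> 0) (at t within {0..}))"

definition is_solution :: "real \<Rightarrow> real \<Rightarrow> (real \<Rightarrow> real) \<Rightarrow> (real \<Rightarrow> real \<Rightarrow> real) \<Rightarrow> bool" where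
  "is_solution p q f0 f \<longleftrightarrow>
     C1_L1 f \<and> (\<forall>t\<ge>0. AE v in lborel. f t v \<ge> 0) \<and>
     (\<forall>\<xi>. fourier (f 0) \<xi> = fourier f0 \<xi>) \<and>
     (\<forall>t\<ge>0. \<forall>\<xi>. ((\<lambda>s. fourier (f s) \<xi>) has_vector_derivative
        (fourier (f t) (p * \<xi>) * fourier (f t) (q * \<xi>) - fourier (f t) \<xi>)) (at t within {0..}))"

definition is_stationary_profile :: "real \<Rightarrow> real \<Rightarrow> real \<Rightarrow> (real \<Rightarrow> real) \<Rightarrow> bool" where
  "is_stationary_profile p q \<delta>max g \<longleftrightarrow>
     (AE v in lborel. g v \<ge> 0) \<and>
     has_bochner_integral lborel g 1 \<and>
     has_bochner_integral lborel (\<lambda>v. v * g v) 0 \<and>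
     has_bochner_integral lborel (\<lambda>v. v\<^sup>2 * g v) 1 \<and>
     (\<forall>\<delta>. 0 < \<delta> \<and> \<delta> < \<delta>max \<longrightarrow> integrable lborel (\<lambda>v. \<bar>v\<bar> powr (2 + \<delta>) * g v)) \<and>
     (\<forall>\<xi>. fourier g differentiable (at \<xi>) \<and>
        complex_of_real ((p\<^sup>2 + q\<^sup>2 - 1) / 2 * \<xi>) * vector_derivative (fourier g) (at \<xi>)
          = fourier g (p * \<xi>) * fourier g (q * \<xi>) - fourier g \<xi>)"

definition E_pq :: "real \<Rightarrow> real \<Rightarrow> real \<Rightarrow> real" where
  "E_pq p q t = exp ((p\<^sup>2 + q\<^sup>2 - 1) * t)"

definition self_similar_state :: "real \<Rightarrow> real \<Rightarrow> (real \<Rightarrow> real) \<Rightarrow> real \<Rightarrow> real \<Rightarrow> real" where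
  "self_similar_state p q g t v = 1 / sqrt (E_pq p q t) * g (v / sqrt (E_pq p q t))"

end

theory Submission
  imports Defs "HOL-Probability.Probability" "HOL-Real_Asymp.Real_Asymp"
begin

text \<open>Everything is done on the Fourier side, for the unscaled equation. Put \<open>c = (1 - p\<^sup>2 - q\<^sup>2) / 2\<close>, so
that \<open>1 / sqrt (E_pq p q t) = exp (c * t)\<close>: the self-similar change of variables sends the frequency \<open>y\<close> to
\<open>exp (c * t) * y\<close>. The transforms of \<open>f t\<close> and of the self-similar state are two solutions, bounded
by 1, of the same equation, and the \<open>L\<^sup>1\<close> distance is invariant under the change of variables. Three
estimates are combined.

\<^emph>\<open>Contraction.\<close> The two initial transforms have the same Taylor polynomial of degree 2 at the origin, so
they differ by at most \<open>D * \<bar>\<xi>\<bar> powr a\<close> with \<open>a = 2 + \<delta>\<close>. This weight is an eigenfunction of the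
linearised equation with eigenvalue \<open>p powr a + q powr a - 1\<close>; after scaling, the eigenvalue becomes
\<^term>\<open>S_pq p q \<delta>\<close>, which is negative. Hence the scaled transforms converge exponentially fast, locally
uniformly in frequency (lemma \<open>flow_contraction\<close>).

\<^emph>\<open>Uniform regularity.\<close> Since \<open>f0\<close> has a first moment, its transform is Lipschitz; as it also
lies in a weighted \<open>L\<^sup>2\<close> space, it vanishes at infinity, and then its modulus stays below a constant
smaller than 1 away from the origin. The contraction estimate shows that near the origin the scaled
transforms are below \<open>1 - y\<^sup>2 / 4\<close> at all times. The quadratic gain term turns this into decay
at infinity, uniformly in time: a bound \<open>\<theta>\<close> valid outside a ball improves to \<open>\<theta>\<^sup>2\<close> outside a
larger one (lemmas \<open>bound_propagates_from_annulus\<close> and \<open>uniform_decay\<close>). Once one of the two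
factors of the gain term is small at high frequency, the loss term absorbs the gain term in the
weighted \<open>L\<^sup>2\<close> norm, and the weighted norm of the scaled transforms, restricted to high frequencies,
stays bounded (lemma \<open>weighted_L2_scaled\<close>). By Fatou's lemma the profile inherits this bound.

\<^emph>\<open>From frequency to velocity.\<close> Let \<open>w\<close> be the difference of the scaled solution and the profile.
Splitting frequencies at \<open>M = R * exp (\<mu> * t)\<close>, the contraction handles the low part and the
regularity the high part, so that the \<open>L\<^sup>2\<close> norm of the transform of \<open>w\<close> decays exponentially. A
Plancherel inequality controls the \<open>L\<^sup>1\<close> norm of \<open>w\<close> on an exponentially growing interval
(lemma \<open>local_L1_le\<close>), and second moments, bounded uniformly in time by the behaviour of the
transforms at the origin (lemma \<open>second_moment_le\<close>), control the rest.\<close>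

section \<open>Fourier transforms of integrable functions\<close>

lemma norm_integral_le_AE:
  fixes f :: "'a \<Rightarrow> 'b::{banach, second_countable_topology}"
  assumes "integrable M f" "integrable M g" "AE x in M. norm (f x) \<le> g x"
  shows "norm (integral\<^sup>L M f) \<le> integral\<^sup>L M g"
  using assms by (intro order_trans[OF integral_norm_bound] integral_mono_AE) auto

lemma norm_fourier_kernel [simp]:
  "cmod (exp (- (\<i> * complex_of_real x))) = 1"
  using norm_exp_i_times[of "-x"] by simp

lemma integrable_fourier_kernel:
  assumes "integrable lborel h"
  shows "integrable lborel (\<lambda>v. complex_of_real (h v) * exp (- (\<i> * complex_of_real (\<xi> * v))))"
proof (rule Bochner_Integration.integrable_bound[OF assms])
  show "(\<lambda>v. complex_of_real (h v) * exp (- (\<i> * complex_of_real (\<xi> * v)))) \<in> borel_measurable lborel"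
    using borel_measurable_integrable[OF assms] by measurable
qed (simp add: norm_mult)

lemma norm_fourier_le: "cmod (fourier h \<xi>) \<le> L1_norm h"
proof -
  have "cmod (fourier h \<xi>) \<le> (LINT v|lborel. cmod (complex_of_real (h v) * exp (- (\<i> * complex_of_real (\<xi> * v)))))"
    unfolding fourier_def by (rule integral_norm_bound)
  then show ?thesis by (simp add: norm_mult L1_norm_def)
qed

lemma continuous_on_fourier:
  assumes "integrable lborel h"
  shows "continuous_on UNIV (fourier h)"
proof -
  have [measurable]: "h \<in> borel_measurable borel" using borel_measurable_integrable[OF assms] by simp
  have "isCont (fourier h) \<xi>" for \<xi>
    unfolding continuous_at_sequentially
  proof safe
    fix X assume X: "X \<longlonglongrightarrow> \<xi>"
    show "(fourier h \<circ> X) \<longlonglongrightarrow> fourier h \<xi>"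
      unfolding comp_def fourier_def
      by (rule integral_dominated_convergence[where w="\<lambda>v. \<bar>h v\<bar>"])
        (use assms in \<open>auto intro!: tendsto_intros X simp: norm_mult\<close>)
  qed
  then show ?thesis by (simp add: continuous_at_imp_continuous_on)
qed

lemma fourier_measurable [measurable (raw)]:
  assumes "integrable lborel h"
  shows "fourier h \<in> borel_measurable borel"
  using continuous_on_fourier[OF assms] by (rule borel_measurable_continuous_onI)

lemma fourier_diff:
  assumes "integrable lborel g" "integrable lborel h"
  shows "fourier (\<lambda>v. g v - h v) \<xi> = fourier g \<xi> - fourier h \<xi>"
  unfolding fourier_def
    Bochner_Integration.integral_diff[OF integrable_fourier_kernel[OF assms(1)] integrable_fourier_kernel[OF assms(2)], symmetric]
  by (intro Bochner_Integration.integral_cong refl) (simp add: algebra_simps)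

lemma
  assumes "s > 0" "integrable lborel h"
  shows integrable_dilation: "integrable lborel (\<lambda>v. s * h (s * v))"
    and fourier_dilation: "fourier (\<lambda>v. s * h (s * v)) \<xi> = fourier h (\<xi> / s)"
proof -
  show "integrable lborel (\<lambda>v. s * h (s * v))"
    using lborel_integrable_real_affine[OF assms(2), of s 0] assms by simp
  have "fourier h (\<xi> / s) = s *\<^sub>R (LINT v|lborel. complex_of_real (h (0 + s * v)) * exp (- (\<i> * complex_of_real (\<xi> / s * (0 + s * v)))))"
    unfolding fourier_def using assms(1) by (subst lborel_integral_real_affine[where c=s and t=0]) auto
  also have "\<dots> = fourier (\<lambda>v. s * h (s * v)) \<xi>"
    using assms(1) by (simp add: fourier_def scaleR_conv_of_real mult.assoc flip: integral_mult_right_zero)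
  finally show "fourier (\<lambda>v. s * h (s * v)) \<xi> = fourier h (\<xi> / s)" ..
qed

lemma fourier_lipschitz:
  assumes "integrable lborel h" "integrable lborel (\<lambda>v. v * h v)"
  shows "cmod (fourier h \<xi> - fourier h \<zeta>) \<le> L1_norm (\<lambda>v. v * h v) * \<bar>\<xi> - \<zeta>\<bar>"
proof -
  have k: "cmod (exp (- (\<i> * complex_of_real x)) - exp (- (\<i> * complex_of_real y))) \<le> \<bar>x - y\<bar>" for x y :: real
  proof -
    have "exp (- (\<i> * complex_of_real x)) - exp (- (\<i> * complex_of_real y)) 
      = exp (- (\<i> * complex_of_real y)) * (iexp (y - x) - 1)"
      by (simp add: algebra_simps flip: exp_add)
    then show ?thesis using iexp_approx1[of "y - x" 0] by (simp add: norm_mult abs_minus_commute)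
  qed
  have "fourier h \<xi> - fourier h \<zeta> = (LINT v|lborel. complex_of_real (h v) * exp (- (\<i> * complex_of_real (\<xi> * v))) - complex_of_real (h v) * exp (- (\<i> * complex_of_real (\<zeta> * v))))"
    unfolding fourier_def by (intro Bochner_Integration.integral_diff[symmetric] integrable_fourier_kernel assms)
  also have "cmod \<dots> \<le> (LINT v|lborel. \<bar>v * h v\<bar> * \<bar>\<xi> - \<zeta>\<bar>)"
  proof (rule norm_integral_le_AE, goal_cases)
    case 3
    show ?case
    proof (rule AE_I2)
      fix v
      have "cmod (complex_of_real (h v) * exp (- (\<i> * complex_of_real (\<xi> * v))) - complex_of_real (h v) * exp (- (\<i> * complex_of_real (\<zeta> * v))))
        = \<bar>h v\<bar> * cmod (exp (- (\<i> * complex_of_real (\<xi> * v))) - exp (- (\<i> * complex_of_real (\<zeta> * v))))"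
        by (simp add: norm_mult flip: right_diff_distrib)
      also have "\<dots> \<le> \<bar>h v\<bar> * \<bar>\<xi> * v - \<zeta> * v\<bar>" by (intro mult_left_mono k) auto
      also have "\<dots> = \<bar>v * h v\<bar> * \<bar>\<xi> - \<zeta>\<bar>" by (simp add: abs_mult flip: left_diff_distrib)
      finally show "cmod (complex_of_real (h v) * exp (- (\<i> * complex_of_real (\<xi> * v))) - complex_of_real (h v) * exp (- (\<i> * complex_of_real (\<zeta> * v)))) \<le> \<bar>v * h v\<bar> * \<bar>\<xi> - \<zeta>\<bar>" .
    qed
  qed (intro Bochner_Integration.integrable_diff integrable_fourier_kernel integrable_mult_left integrable_abs assms)+
  finally show ?thesis by (simp add: L1_norm_def)
qed

text \<open>For \<open>\<bar>y\<bar> \<le> 1\<close> the cubic bound on the remainder is the better one, for \<open>\<bar>y\<bar> \<ge> 1\<close> the quadratic one;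
\<open>\<bar>y\<bar> powr (2 + \<delta>)\<close> dominates both.\<close>

lemma iexp_taylor2:
  assumes "0 \<le> \<delta>" "\<delta> \<le> 1"
  shows "cmod (exp (- (\<i> * complex_of_real y)) - (1 - \<i> * complex_of_real y - complex_of_real (y\<^sup>2 / 2))) \<le> \<bar>y\<bar> powr (2 + \<delta>)"
proof -
  have eq: "exp (- (\<i> * complex_of_real y)) - (1 - \<i> * complex_of_real y - complex_of_real (y\<^sup>2 / 2))
     = iexp (- y) - (\<Sum>k\<le>2. (\<i> * complex_of_real (- y)) ^ k / fact k)"
    by (simp add: eval_nat_numeral power_mult_distrib algebra_simps)
  show ?thesis
  proof (cases "\<bar>y\<bar> \<le> 1")
    case True
    have "\<bar>y\<bar> ^ 3 = \<bar>y\<bar> powr 3" by (simp add: powr_realpow')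
    also have "\<dots> \<le> \<bar>y\<bar> powr (2 + \<delta>)" using True assms by (intro powr_mono') auto
    finally have "\<bar>y\<bar> ^ 3 / 6 \<le> \<bar>y\<bar> powr (2 + \<delta>)" using zero_le_power[of "\<bar>y\<bar>" 3] by linarith
    then show ?thesis unfolding eq using iexp_approx1[of "-y" 2] by (simp add: eval_nat_numeral)
  next
    case False
    have "\<bar>y\<bar> ^ 2 = \<bar>y\<bar> powr 2" using False by (simp add: powr_realpow')
    also have "\<dots> \<le> \<bar>y\<bar> powr (2 + \<delta>)" using False assms by (intro powr_mono) auto
    finally show ?thesis unfolding eq using iexp_approx2[of "-y" 2] by (simp add: eval_nat_numeral)
  qed
qed

text \<open>The Taylor polynomial depends on the normalised moments alone. Two densities with these moments
therefore have transforms that agree to order \<open>2 + \<delta>\<close> at the origin.\<close>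

lemma fourier_taylor2:
  assumes "AE v in lborel. h v \<ge> 0" "has_bochner_integral lborel h 1"
    and "has_bochner_integral lborel (\<lambda>v. v * h v) 0" "has_bochner_integral lborel (\<lambda>v. v\<^sup>2 * h v) 1"
    and m: "integrable lborel (\<lambda>v. \<bar>v\<bar> powr (2 + \<delta>) * h v)" and \<delta>: "0 \<le> \<delta>" "\<delta> \<le> 1"
  shows "cmod (fourier h \<xi> - complex_of_real (1 - \<xi>\<^sup>2 / 2)) \<le> (LINT v|lborel. \<bar>v\<bar> powr (2 + \<delta>) * h v) * \<bar>\<xi>\<bar> powr (2 + \<delta>)"
proof -
  have i: "has_bochner_integral lborel (\<lambda>v. complex_of_real (h v) * (1 - \<i> * complex_of_real (\<xi> * v) - complex_of_real ((\<xi> * v)\<^sup>2 / 2))) (complex_of_real 1 - \<i> * complex_of_real \<xi> * complex_of_real 0 - complex_of_real (\<xi>\<^sup>2 / 2) * complex_of_real 1)"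
    (is "has_bochner_integral _ ?P _")
  proof -
    have "has_bochner_integral lborel (\<lambda>v. complex_of_real (h v) - \<i> * complex_of_real \<xi> * complex_of_real (v * h v) - complex_of_real (\<xi>\<^sup>2 / 2) * complex_of_real (v\<^sup>2 * h v)) (complex_of_real 1 - \<i> * complex_of_real \<xi> * complex_of_real 0 - complex_of_real (\<xi>\<^sup>2 / 2) * complex_of_real 1)"
      by (intro has_bochner_integral_diff has_bochner_integral_mult_right has_bochner_integral_of_real assms)
    then show ?thesis by (simp add: algebra_simps power_mult_distrib)
  qed
  have ih: "integrable lborel h" using assms(2) by (auto simp: has_bochner_integral_iff)
  have eq: "fourier h \<xi> - complex_of_real (1 - \<xi>\<^sup>2 / 2) = (LINT v|lborel. complex_of_real (h v) * exp (- (\<i> * complex_of_real (\<xi> * v))) - ?P v)"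
    using i integrable_fourier_kernel[OF ih, of \<xi>] 
    by (subst Bochner_Integration.integral_diff) (auto simp: fourier_def has_bochner_integral_iff)
  have "cmod (LINT v|lborel. complex_of_real (h v) * exp (- (\<i> * complex_of_real (\<xi> * v))) - ?P v) \<le> (LINT v|lborel. \<bar>v\<bar> powr (2 + \<delta>) * h v * \<bar>\<xi>\<bar> powr (2 + \<delta>))"
  proof (rule norm_integral_le_AE)
    show "AE v in lborel. cmod (complex_of_real (h v) * exp (- (\<i> * complex_of_real (\<xi> * v))) - ?P v) \<le> \<bar>v\<bar> powr (2 + \<delta>) * h v * \<bar>\<xi>\<bar> powr (2 + \<delta>)"
      using assms(1)
    proof eventually_elim
      case (elim v)
      have "cmod (complex_of_real (h v) * exp (- (\<i> * complex_of_real (\<xi> * v))) - ?P v) = h v * cmod (exp (- (\<i> * complex_of_real (\<xi> * v))) - (1 - \<i> * complex_of_real (\<xi> * v) - complex_of_real ((\<xi> * v)\<^sup>2 / 2)))"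
        using elim by (simp add: norm_mult flip: right_diff_distrib)
      also have "\<dots> \<le> h v * \<bar>\<xi> * v\<bar> powr (2 + \<delta>)" by (intro mult_left_mono iexp_taylor2 \<delta> elim)
      also have "\<dots> = \<bar>v\<bar> powr (2 + \<delta>) * h v * \<bar>\<xi>\<bar> powr (2 + \<delta>)" by (simp add: abs_mult powr_mult)
      finally show ?case .
    qed
  qed (use m i integrable_fourier_kernel[OF ih, of \<xi>] in \<open>auto intro!: Bochner_Integration.integrable_diff simp: has_bochner_integral_iff\<close>)
  then show ?thesis unfolding eq by simp
qed

text \<open>With \<open>b\<close> the argument of \<^term>\<open>fourier h \<xi>\<close>, the quantity \<open>1 - cmod (fourier h \<xi>)\<close> is the integral
of \<open>h v * (1 - cos (\<xi> * v + b))\<close>, and \<open>1 - cos (2 * x) \<le> 4 * (1 - cos x)\<close>. Iterated, the inequality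
carries a bound away from 1 at high frequencies down to low frequencies.\<close>

lemma fourier_doubling:
  assumes "AE v in lborel. h v \<ge> 0" "has_bochner_integral lborel h 1"
  shows "1 - cmod (fourier h (2 * \<xi>)) \<le> 4 * (1 - cmod (fourier h \<xi>))"
proof -
  have ih: "integrable lborel h" and h1: "integral\<^sup>L lborel h = 1" using assms(2) by (auto simp: has_bochner_integral_iff)
  have [measurable]: "h \<in> borel_measurable borel" using ih by (auto dest: borel_measurable_integrable)
  have icos: "integrable lborel (\<lambda>v. h v * cos (a * v + b))" for a b
    by (rule Bochner_Integration.integrable_bound[OF ih])
      (auto simp: abs_mult intro!: mult_left_le)
  have Re: "(LINT v|lborel. h v * cos (a * v + b)) = Re (exp (- (\<i> * complex_of_real b)) * fourier h a)" for a b
  proof -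
    have "exp (- (\<i> * complex_of_real b)) * fourier h a = (LINT v|lborel. exp (- (\<i> * complex_of_real b)) * (complex_of_real (h v) * exp (- (\<i> * complex_of_real (a * v)))))"
      unfolding fourier_def by simp
    also have "Re \<dots> = (LINT v|lborel. Re (exp (- (\<i> * complex_of_real b)) * (complex_of_real (h v) * exp (- (\<i> * complex_of_real (a * v))))))"
      by (intro integral_Re[symmetric] integrable_mult_right integrable_fourier_kernel ih)
    also have "\<dots> = (LINT v|lborel. h v * cos (a * v + b))"
    proof (rule Bochner_Integration.integral_cong[OF refl])
      fix v
      have "exp (- (\<i> * complex_of_real b)) * (complex_of_real (h v) * exp (- (\<i> * complex_of_real (a * v))))
        = complex_of_real (h v) * exp (\<i> * complex_of_real (- (a * v + b)))"
        by (simp add: algebra_simps flip: exp_add)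
      also have "Re \<dots> = h v * cos (a * v + b)" using Re_exp[of "\<i> * complex_of_real (- (a * v + b))"] cos_minus[of "a * v + b"]
        by (simp del: of_real_minus of_real_add of_real_mult)
      finally show "Re (exp (- (\<i> * complex_of_real b)) * (complex_of_real (h v) * exp (- (\<i> * complex_of_real (a * v))))) = h v * cos (a * v + b)" .
    qed
    finally show ?thesis ..
  qed
  define b where "b = Arg (fourier h \<xi>)"
  have polar: "exp (- (\<i> * complex_of_real b)) * fourier h \<xi> = complex_of_real (cmod (fourier h \<xi>))"
  proof (cases "fourier h \<xi> = 0")
    case False
    then have "fourier h \<xi> = complex_of_real (cmod (fourier h \<xi>)) * exp (\<i> * complex_of_real b)"
      using Arg_eq b_def by blast
    then have "exp (- (\<i> * complex_of_real b)) * fourier h \<xi> = exp (- (\<i> * complex_of_real b)) * (complex_of_real (cmod (fourier h \<xi>)) * exp (\<i> * complex_of_real b))"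
      by simp
    then show ?thesis by (simp add: exp_minus field_simps)
  qed auto
  have i2: "integrable lborel (\<lambda>v. h v * (1 - cos (a * v + b)))" for a b
    using Bochner_Integration.integrable_diff[OF ih icos[of a b]] by (simp add: right_diff_distrib)
  have e: "(LINT v|lborel. h v * (1 - cos (a * v + b))) = 1 - Re (exp (- (\<i> * complex_of_real b)) * fourier h a)" for a b
    using Bochner_Integration.integral_diff[OF ih icos[of a b]] Re[of a b] h1 by (simp add: right_diff_distrib)
  have "Re (exp (- (\<i> * complex_of_real (2 * b))) * fourier h (2 * \<xi>)) \<le> cmod (fourier h (2 * \<xi>))"
    using complex_Re_le_cmod[of "exp (- (\<i> * complex_of_real (2 * b))) * fourier h (2 * \<xi>)"] by (simp only: norm_mult norm_fourier_kernel)
  then have "1 - cmod (fourier h (2 * \<xi>)) \<le> (LINT v|lborel. h v * (1 - cos (2 * \<xi> * v + 2 * b)))"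
    unfolding e by simp
  also have "\<dots> \<le> (LINT v|lborel. 4 * (h v * (1 - cos (\<xi> * v + b))))"
  proof (rule integral_mono_AE)
    show "AE v in lborel. h v * (1 - cos (2 * \<xi> * v + 2 * b)) \<le> 4 * (h v * (1 - cos (\<xi> * v + b)))"
      using assms(1)
    proof eventually_elim
      case (elim v)
      define c where "c = cos (\<xi> * v + b)"
      have "cos (2 * \<xi> * v + 2 * b) = 2 * c\<^sup>2 - 1" using cos_double_cos[of "\<xi> * v + b"] by (simp add: c_def algebra_simps)
      moreover have "0 \<le> 2 * (1 - c)\<^sup>2" by simp
      ultimately have "1 - cos (2 * \<xi> * v + 2 * b) \<le> 4 * (1 - c)" by (simp add: power2_eq_square algebra_simps)
      from mult_left_mono[OF this elim] show ?case unfolding c_def by (simp only: mult_ac)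
    qed
  qed (intro i2 integrable_mult_right)+
  also have "\<dots> = 4 * (1 - cmod (fourier h \<xi>))" by (simp add: e polar)
  finally show ?thesis .
qed

text \<open>Fatou's lemma, since \<open>2 * (1 - cos (x * v)) / x\<^sup>2\<close> tends to \<open>v\<^sup>2\<close> as \<open>x\<close> tends to 0.\<close>

lemma second_moment_le:
  assumes "AE v in lborel. h v \<ge> 0" "has_bochner_integral lborel h 1" "\<rho> > 0"
    and K: "\<And>\<xi>. \<bar>\<xi>\<bar> \<le> \<rho> \<Longrightarrow> cmod (1 - fourier h \<xi>) \<le> K * \<xi>\<^sup>2"
  shows "(\<integral>\<^sup>+v. ennreal (v\<^sup>2 * h v) \<partial>lborel) \<le> ennreal (2 * K)"
proof -
  have ih: "integrable lborel h" and h1: "integral\<^sup>L lborel h = 1" using assms(2) by (auto simp: has_bochner_integral_iff)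
  have [measurable]: "h \<in> borel_measurable borel" using ih by (auto dest: borel_measurable_integrable)
  define x where "x n = \<rho> / real (Suc n)" for n
  have x: "x n > 0" "x n \<le> \<rho>" for n using assms(3) by (auto simp: x_def field_simps)
  have x0: "x \<longlonglongrightarrow> 0" unfolding x_def using tendsto_mult_right_zero[OF LIMSEQ_inverse_real_of_nat, of \<rho>] by (simp add: field_simps)
  have c: "(LINT v|lborel. h v * (1 - cos (x n * v))) = Re (1 - fourier h (x n))" 
    and ic: "integrable lborel (\<lambda>v. h v * (1 - cos (x n * v)))" for n
  proof -
    have r: "Re (complex_of_real (h v) * exp (- (\<i> * complex_of_real (x n * v)))) = h v * cos (x n * v)" for v
      using Re_exp[of "\<i> * complex_of_real (- (x n * v))"] by simp
    have i: "integrable lborel (\<lambda>v. h v * cos (x n * v))"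
      using integrable_Re[OF integrable_fourier_kernel[OF ih, of "x n"]] by (simp only: r)
    have "(LINT v|lborel. h v * cos (x n * v)) = Re (fourier h (x n))"
      using integral_Re[OF integrable_fourier_kernel[OF ih, of "x n"]] by (simp only: r fourier_def)
    then show "(LINT v|lborel. h v * (1 - cos (x n * v))) = Re (1 - fourier h (x n))" 
      using Bochner_Integration.integral_diff[OF ih i] h1 by (simp add: right_diff_distrib)
    show "integrable lborel (\<lambda>v. h v * (1 - cos (x n * v)))"
      using Bochner_Integration.integrable_diff[OF ih i] by (simp add: right_diff_distrib)
  qed
  have "(\<integral>\<^sup>+v. ennreal (v\<^sup>2 * h v) \<partial>lborel) \<le> (\<integral>\<^sup>+v. liminf (\<lambda>n. ennreal (2 / (x n)\<^sup>2 * (h v * (1 - cos (x n * v))))) \<partial>lborel)"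
  proof (rule nn_integral_mono_AE)
    show "AE v in lborel. ennreal (v\<^sup>2 * h v) \<le> liminf (\<lambda>n. ennreal (2 / (x n)\<^sup>2 * (h v * (1 - cos (x n * v)))))"
    proof (rule AE_I2)
      fix v :: real
      have lim: "((\<lambda>y. (1 - cos (y * v)) / y\<^sup>2) \<longlongrightarrow> v * v / 2) (at_right 0)"
        by real_asymp
      have "filterlim x (at_right 0) sequentially"
        unfolding filterlim_at using x0 x(1) by (auto simp: less_imp_neq[THEN not_sym])
      then have "(\<lambda>n. (1 - cos (x n * v)) / (x n)\<^sup>2) \<longlonglongrightarrow> v\<^sup>2 / 2"
        unfolding power2_eq_square[of v] by (rule filterlim_compose[OF lim])
      then have "(\<lambda>n. 2 * h v * ((1 - cos (x n * v)) / (x n)\<^sup>2)) \<longlonglongrightarrow> 2 * h v * (v\<^sup>2 / 2)"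
        by (intro tendsto_mult_left)
      then have "(\<lambda>n. 2 / (x n)\<^sup>2 * (h v * (1 - cos (x n * v)))) \<longlonglongrightarrow> v\<^sup>2 * h v"
        by (simp add: field_simps)
      then have "(\<lambda>n. ennreal (2 / (x n)\<^sup>2 * (h v * (1 - cos (x n * v))))) \<longlonglongrightarrow> ennreal (v\<^sup>2 * h v)"
        by (rule tendsto_ennrealI)
      from lim_imp_Liminf[OF _ this] show "ennreal (v\<^sup>2 * h v) \<le> liminf (\<lambda>n. ennreal (2 / (x n)\<^sup>2 * (h v * (1 - cos (x n * v)))))" by simp
    qed
  qed
  also have "\<dots> \<le> liminf (\<lambda>n. \<integral>\<^sup>+v. ennreal (2 / (x n)\<^sup>2 * (h v * (1 - cos (x n * v)))) \<partial>lborel)"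
    by (rule nn_integral_liminf) measurable
  also have "\<dots> \<le> liminf (\<lambda>n. ennreal (2 * K))"
  proof (rule Liminf_mono, rule always_eventually, rule allI)
    fix n
    have "(\<integral>\<^sup>+v. ennreal (2 / (x n)\<^sup>2 * (h v * (1 - cos (x n * v)))) \<partial>lborel) = ennreal (LINT v|lborel. 2 / (x n)\<^sup>2 * (h v * (1 - cos (x n * v))))"
    proof (rule nn_integral_eq_integral)
      show "AE v in lborel. 0 \<le> 2 / (x n)\<^sup>2 * (h v * (1 - cos (x n * v)))"
        using assms(1) by eventually_elim auto
    qed (intro integrable_mult_right ic)
    also have "(LINT v|lborel. 2 / (x n)\<^sup>2 * (h v * (1 - cos (x n * v)))) = 2 / (x n)\<^sup>2 * Re (1 - fourier h (x n))"
      by (simp only: integral_mult_right_zero c)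
    also have "\<dots> \<le> 2 / (x n)\<^sup>2 * (K * (x n)\<^sup>2)"
      using K[of "x n"] x[of n] complex_Re_le_cmod[of "1 - fourier h (x n)"] by (intro mult_left_mono) auto
    also have "\<dots> = 2 * K" using x(1)[of n] by simp
    finally show "(\<integral>\<^sup>+v. ennreal (2 / (x n)\<^sup>2 * (h v * (1 - cos (x n * v)))) \<partial>lborel) \<le> ennreal (2 * K)"
      by (simp add: ennreal_leI)
  qed
  also have "\<dots> = ennreal (2 * K)" by (simp add: Liminf_const)
  finally show ?thesis .
qed

text \<open>The transforms of the truncations converge to \<^term>\<open>H\<close> in \<open>L\<^sup>2\<close> and, by dominated
convergence, to \<^term>\<open>fourier h\<close> pointwise.\<close>

lemma L2_fourier_eq_fourier:
  assumes L2: "is_L2_fourier h H" and ih: "integrable lborel h"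
  shows "AE \<xi> in lborel. H \<xi> = fourier h \<xi>"
proof -
  have [measurable]: "h \<in> borel_measurable borel" using ih by (auto dest: borel_measurable_integrable)
  have [measurable]: "H \<in> borel_measurable borel" using L2 by (auto simp: is_L2_fourier_def square_integrable_def)
  define T where "T n v = indicator {- real n..real n} v * h v" for n :: nat and v :: real
  have iT: "integrable lborel (T n)" for n
    unfolding T_def by (rule Bochner_Integration.integrable_bound[OF ih]) (auto simp: indicator_def)
  have [measurable]: "fourier (T n) \<in> borel_measurable borel" for n by (intro fourier_measurable iT)
  have [measurable]: "fourier h \<in> borel_measurable borel" by (intro fourier_measurable ih)
  have T: "(\<lambda>n. fourier (T n) \<xi>) \<longlonglongrightarrow> fourier h \<xi>" for \<xi>
    unfolding fourier_def
  proof (rule integral_dominated_convergence[where w="\<lambda>v. \<bar>h v\<bar>"])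
    show "AE v in lborel. (\<lambda>n. complex_of_real (T n v) * exp (- (\<i> * complex_of_real (\<xi> * v)))) \<longlonglongrightarrow> complex_of_real (h v) * exp (- (\<i> * complex_of_real (\<xi> * v)))"
    proof (rule AE_I2)
      fix v :: real
      obtain N where N: "\<bar>v\<bar> \<le> real N" using real_arch_simple by blast
      have "eventually (\<lambda>n. complex_of_real (T n v) * exp (- (\<i> * complex_of_real (\<xi> * v))) = complex_of_real (h v) * exp (- (\<i> * complex_of_real (\<xi> * v)))) sequentially"
        using eventually_ge_at_top[of N]
      proof eventually_elim
        case (elim n)
        then have "\<bar>v\<bar> \<le> real n" using N by linarith
        then show ?case by (simp add: T_def abs_le_iff)
      qed
      then show "(\<lambda>n. complex_of_real (T n v) * exp (- (\<i> * complex_of_real (\<xi> * v)))) \<longlonglongrightarrow> complex_of_real (h v) * exp (- (\<i> * complex_of_real (\<xi> * v)))"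
        by (rule tendsto_eventually)
    qed
  qed (use ih in \<open>auto simp: T_def norm_mult indicator_def\<close>)
  have "((\<lambda>n. \<integral>\<^sup>+ \<xi>. ennreal ((cmod (fourier (T n) \<xi> - H \<xi>))\<^sup>2) \<partial>lborel) \<longlongrightarrow> 0) sequentially"
    using L2 filterlim_compose[OF _ filterlim_real_sequentially] unfolding is_L2_fourier_def T_def by blast
  then have 0: "liminf (\<lambda>n. \<integral>\<^sup>+ \<xi>. ennreal ((cmod (fourier (T n) \<xi> - H \<xi>))\<^sup>2) \<partial>lborel) = 0"
    by (intro lim_imp_Liminf) auto
  have "(\<integral>\<^sup>+ \<xi>. ennreal ((cmod (fourier h \<xi> - H \<xi>))\<^sup>2) \<partial>lborel) = (\<integral>\<^sup>+ \<xi>. liminf (\<lambda>n. ennreal ((cmod (fourier (T n) \<xi> - H \<xi>))\<^sup>2)) \<partial>lborel)"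
    by (intro nn_integral_cong lim_imp_Liminf[symmetric] tendsto_ennrealI tendsto_intros T) auto
  also have "\<dots> \<le> 0" unfolding 0[symmetric] by (rule nn_integral_liminf) measurable
  finally have "(\<integral>\<^sup>+ \<xi>. ennreal ((cmod (fourier h \<xi> - H \<xi>))\<^sup>2) \<partial>lborel) = 0" by simp
  then have "AE \<xi> in lborel. ennreal ((cmod (fourier h \<xi> - H \<xi>))\<^sup>2) = 0"
    by (subst (asm) nn_integral_0_iff_AE) auto
  then show ?thesis by eventually_elim (auto simp: ennreal_eq_0_iff)
qed

section \<open>A priori bounds by iteration\<close>

text \<open>A substitute for the Gronwall lemma. The a priori estimates below have the form: if a bound holds
with constant \<open>z\<close>, then it holds with a constant closer to \<open>a\<close> by a fixed factor. Starting from any crude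
constant, iteration gives the bound with constant \<open>a\<close>, and no supremum has to be formed.\<close>

lemma contraction_limit:
  fixes a r z0 :: real
  assumes "0 \<le> r" "r < 1" "a \<le> z0" "P z0"
    and step: "\<And>z. a \<le> z \<Longrightarrow> P z \<Longrightarrow> P (a + r * (z - a))"
    and closed: "\<And>Z. (\<And>n::nat. P (Z n)) \<Longrightarrow> Z \<longlonglongrightarrow> a \<Longrightarrow> P a"
  shows "P a"
proof (rule closed)
  show "P (a + r ^ n * (z0 - a))" for n
  proof (induction n)
    case (Suc n)
    have "a \<le> a + r ^ n * (z0 - a)" using assms by simp
    from step[OF this Suc] show ?case by (simp add: mult.assoc)
  qed (use assms in simp)
  have "(\<lambda>n. a + r ^ n * (z0 - a)) \<longlonglongrightarrow> a + 0 * (z0 - a)"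
    using assms by (intro tendsto_intros LIMSEQ_realpow_zero)
  then show "(\<lambda>n. a + r ^ n * (z0 - a)) \<longlonglongrightarrow> a" by simp
qed

lemma has_vector_derivative_within_ge_0:
  "0 < s \<Longrightarrow> (f has_vector_derivative f') (at s within {0..}) \<Longrightarrow> (f has_vector_derivative f') (at (s::real))"
  using at_within_interior[of s "{0..}"] by simp

text \<open>The equation \<open>u' = g - u\<close> says that \<open>exp s *\<^sub>R u s\<close> has derivative \<open>exp s *\<^sub>R g s\<close>.\<close>

lemma duhamel_bound:
  fixes u g :: "real \<Rightarrow> 'a::real_normed_vector"
  assumes u: "\<And>s. 0 \<le> s \<Longrightarrow> (u has_vector_derivative (g s - u s)) (at s within {0..})"
    and \<phi>: "\<And>s. (\<phi> has_real_derivative \<phi>' s) (at s)"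
    and bnd: "\<And>s. 0 \<le> s \<Longrightarrow> s \<le> t \<Longrightarrow> exp s * norm (g s) \<le> \<phi>' s" and t: "0 \<le> t"
  shows "exp t * norm (u t) \<le> norm (u 0) + (\<phi> t - \<phi> 0)"
proof (cases "t = 0")
  case False
  have d: "((\<lambda>s. exp s *\<^sub>R u s) has_vector_derivative exp s *\<^sub>R g s) (at s within {0..})" if "0 \<le> s" for s
    by (auto intro!: derivative_eq_intros u that simp: algebra_simps)
  have "norm (exp t *\<^sub>R u t - exp 0 *\<^sub>R u 0) \<le> \<phi> t - \<phi> 0"
  proof (rule differentiable_bound_general)
    show "continuous_on {0..t} (\<lambda>s. exp s *\<^sub>R u s)"
      by (rule continuous_on_subset[OF continuous_on_vector_derivative[of "{0..}"]]) (use d in auto)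
    show "continuous_on {0..t} \<phi>"
      using \<phi> by (meson DERIV_continuous_on has_field_derivative_at_within)
    show "((\<lambda>s. exp s *\<^sub>R u s) has_vector_derivative exp s *\<^sub>R g s) (at s)" if "0 < s" "s < t" for s
      using d that by (intro has_vector_derivative_within_ge_0) auto
    show "(\<phi> has_vector_derivative \<phi>' s) (at s)" for s
      using \<phi> by (simp flip: has_real_derivative_iff_has_vector_derivative)
  qed (use t False bnd in auto)
  moreover have "norm (exp t *\<^sub>R u t) \<le> norm (exp t *\<^sub>R u t - exp 0 *\<^sub>R u 0) + norm (exp 0 *\<^sub>R u 0)"
    using norm_triangle_sub[of "exp t *\<^sub>R u t" "exp 0 *\<^sub>R u 0"] by simp
  ultimately show ?thesis by simp
qed simp

section \<open>Flows of the Fourier-transformed equation\<close>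

text \<open>The square root of the energy \<^term>\<open>E_pq p q t\<close> is \<open>exp (- cooling_rate p q * t)\<close>.\<close>

definition cooling_rate :: "real \<Rightarrow> real \<Rightarrow> real" where
  "cooling_rate p q = (1 - p\<^sup>2 - q\<^sup>2) / 2"

text \<open>The properties shared by the Fourier transforms of the solution and of the self-similar state. The
estimates that follow use nothing else about them.\<close>

locale wild_flow =
  fixes p q :: real and F :: "real \<Rightarrow> real \<Rightarrow> complex"
  assumes q_pos: "0 < q" and q_le_p: "q \<le> p" and dissipative: "p\<^sup>2 + q\<^sup>2 < 1"
    and norm_le_1: "0 \<le> t \<Longrightarrow> cmod (F t \<xi>) \<le> 1"
    and continuous_F: "0 \<le> t \<Longrightarrow> continuous_on UNIV (F t)"
    and deriv_F: "0 \<le> t \<Longrightarrow> ((\<lambda>s. F s \<xi>) has_vector_derivative (F t (p * \<xi>) * F t (q * \<xi>) - F t \<xi>)) (at t within {0..})"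
begin

text \<open>The scaled transform at time \<open>t\<close> is \<open>\<lambda>y. F t (dil t * y)\<close>.\<close>

abbreviation dil :: "real \<Rightarrow> real" where "dil t \<equiv> exp (cooling_rate p q * t)"

lemma p_pos: "0 < p" and p_less_1: "p < 1" and q_less_1: "q < 1"
proof -
  show "0 < p" using q_pos q_le_p by simp
  have "p\<^sup>2 < 1" using dissipative zero_le_power2[of q] by linarith
  then have "p\<^sup>2 < 1\<^sup>2" by simp
  then show "p < 1" by (rule power2_less_imp_less) simp
  then show "q < 1" using q_le_p by simp
qed

lemma cooling_rate_pos: "0 < cooling_rate p q" using dissipative by (simp add: cooling_rate_def)

lemma dil_mono: "s \<le> t \<Longrightarrow> dil s \<le> dil t"
  using cooling_rate_pos by simp

lemma dil_ge_1: "0 \<le> t \<Longrightarrow> 1 \<le> dil t"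
  using cooling_rate_pos by simp

lemma flow_bound:
  assumes "\<And>s. (\<phi> has_real_derivative \<phi>' s) (at s)"
    and "\<And>s. 0 \<le> s \<Longrightarrow> s \<le> t \<Longrightarrow> exp s * (cmod (F s (p * \<xi>)) * cmod (F s (q * \<xi>))) \<le> \<phi>' s" and "0 \<le> t"
  shows "exp t * cmod (F t \<xi>) \<le> cmod (F 0 \<xi>) + (\<phi> t - \<phi> 0)"
  by (rule duhamel_bound[OF deriv_F]) (use assms in \<open>auto simp: norm_mult\<close>)

text \<open>In scaled variables, the gain term at a frequency of modulus at least \<open>R\<close> only involves frequencies
of modulus at least \<open>q * R\<close>: the factors \<open>p\<close> and \<open>q\<close> move frequencies inwards by at most \<open>q\<close>, and the
scaling moves them outwards. So values above \<open>\<theta>\<close> outside the annulus cannot be created by the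
equation; they would have to come from the initial datum or through the annulus.\<close>

lemma bound_propagates_from_annulus:
  assumes "0 < R" "\<theta> \<le> 1"
    and init: "\<And>\<xi>. R \<le> \<bar>\<xi>\<bar> \<Longrightarrow> cmod (F 0 \<xi>) \<le> \<theta>"
    and annulus: "\<And>t \<xi>. 0 \<le> t \<Longrightarrow> q * R * dil t \<le> \<bar>\<xi>\<bar> \<Longrightarrow> \<bar>\<xi>\<bar> \<le> R * dil t \<Longrightarrow> cmod (F t \<xi>) \<le> \<theta>"
    and T: "0 \<le> T" "q * R * dil T \<le> \<bar>\<zeta>\<bar>"
  shows "cmod (F T \<zeta>) \<le> \<theta>"
proof -
  define P where "P N \<longleftrightarrow> (\<forall>t \<xi>. 0 \<le> t \<longrightarrow> t \<le> T \<longrightarrow> q * R * dil t \<le> \<bar>\<xi>\<bar> \<longrightarrow> cmod (F t \<xi>) \<le> N)" for N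
  have "P \<theta>"
  proof (rule contraction_limit[of "1 - exp (- T)" \<theta> 1])
    show "P 1" unfolding P_def using norm_le_1 by blast
    show "P \<theta>" if "\<And>n. P (Z n)" "Z \<longlonglongrightarrow> \<theta>" for Z
      unfolding P_def
    proof (intro allI impI)
      fix t \<xi> assume "0 \<le> t" "t \<le> T" "q * R * dil t \<le> \<bar>\<xi>\<bar>"
      then show "cmod (F t \<xi>) \<le> \<theta>"
        using that(1) unfolding P_def by (intro LIMSEQ_le_const[OF that(2)]) auto
    qed
    show "P (\<theta> + (1 - exp (- T)) * (N - \<theta>))" if N: "\<theta> \<le> N" "P N" for N
      unfolding P_def
    proof (intro allI impI)
      fix t \<xi> assume t: "0 \<le> t" "t \<le> T" and \<xi>: "q * R * dil t \<le> \<bar>\<xi>\<bar>"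
      show "cmod (F t \<xi>) \<le> \<theta> + (1 - exp (- T)) * (N - \<theta>)"
      proof (cases "\<bar>\<xi>\<bar> \<le> R * dil t")
        case True
        have "0 \<le> (1 - exp (- T)) * (N - \<theta>)" using N T by (intro mult_nonneg_nonneg) auto
        with annulus[OF t(1) \<xi> True] show ?thesis by linarith
      next
        case False
        have "R * 1 \<le> R * dil t" using dil_ge_1[OF t(1)] \<open>0 < R\<close> by (intro mult_left_mono) auto
        then have "cmod (F 0 \<xi>) \<le> \<theta>" using False by (intro init) linarith
        moreover have "exp t * cmod (F t \<xi>) \<le> cmod (F 0 \<xi>) + (N * exp t - N * exp 0)"
        proof (rule flow_bound)
          fix s assume s: "0 \<le> s" "s \<le> t"
          have "q * (R * dil s) \<le> q * (R * dil t)" using s q_pos \<open>0 < R\<close> dil_mono by (intro mult_left_mono) auto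
          also have "\<dots> \<le> q * \<bar>\<xi>\<bar>" using False q_pos by (intro mult_left_mono) auto
          also have "\<dots> \<le> p * \<bar>\<xi>\<bar>" using q_le_p by (intro mult_right_mono) auto
          finally have "q * R * dil s \<le> \<bar>p * \<xi>\<bar>" using p_pos by (simp add: abs_mult mult.assoc)
          then have F1: "cmod (F s (p * \<xi>)) \<le> N" using N(2) s t unfolding P_def by auto
          have "cmod (F s (p * \<xi>)) * cmod (F s (q * \<xi>)) \<le> N * 1"
            using F1 norm_le_1[OF s(1)] by (intro mult_mono) (auto intro: order_trans[OF norm_ge_zero])
          then show "exp s * (cmod (F s (p * \<xi>)) * cmod (F s (q * \<xi>))) \<le> N * exp s" by simp
        qed (use t in \<open>auto intro!: derivative_eq_intros\<close>)
        ultimately have "exp t * cmod (F t \<xi>) \<le> N * exp t - (N - \<theta>)" by simp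
        then have "exp (- t) * (exp t * cmod (F t \<xi>)) \<le> exp (- t) * (N * exp t - (N - \<theta>))" by (intro mult_left_mono) auto
        then have "cmod (F t \<xi>) \<le> N - exp (- t) * (N - \<theta>)" by (simp add: exp_minus field_simps)
        moreover have "exp (- T) * (N - \<theta>) \<le> exp (- t) * (N - \<theta>)" using t N by (intro mult_right_mono) auto
        ultimately show ?thesis by (simp add: algebra_simps)
      qed
    qed
  qed (use assms in auto)
  then show ?thesis unfolding P_def using T by blast
qed

text \<open>A bound on the scaled transforms outside the ball of radius \<open>R\<close>, uniform in time.\<close>

definition bounded_beyond :: "real \<Rightarrow> real \<Rightarrow> bool" where
  "bounded_beyond R \<theta> \<longleftrightarrow> (\<forall>t \<xi>. 0 \<le> t \<longrightarrow> R * dil t \<le> \<bar>\<xi>\<bar> \<longrightarrow> cmod (F t \<xi>) \<le> \<theta>)"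

text \<open>Both factors of the gain term are evaluated in the region where the bound \<open>\<theta>\<close> is available.\<close>

lemma bounded_beyond_square:
  assumes b: "bounded_beyond R \<theta>" and "0 < R" "R \<le> q * R'"
    and init: "\<And>\<xi>. R' \<le> \<bar>\<xi>\<bar> \<Longrightarrow> cmod (F 0 \<xi>) \<le> \<theta>\<^sup>2"
  shows "bounded_beyond R' (\<theta>\<^sup>2)"
  unfolding bounded_beyond_def
proof (intro allI impI)
  fix t \<xi> assume t: "0 \<le> t" and \<xi>: "R' * dil t \<le> \<bar>\<xi>\<bar>"
  have "0 < q * R'" using assms by linarith
  then have R': "0 < R'" using q_pos by (simp add: zero_less_mult_iff)
  have "R' * 1 \<le> R' * dil t" using dil_ge_1[OF t(1)] R' by (intro mult_left_mono) auto
  then have "cmod (F 0 \<xi>) \<le> \<theta>\<^sup>2" using \<xi> by (intro init) linarith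
  moreover have "exp t * cmod (F t \<xi>) \<le> cmod (F 0 \<xi>) + (\<theta>\<^sup>2 * exp t - \<theta>\<^sup>2 * exp 0)"
  proof (rule flow_bound)
    fix s assume s: "0 \<le> s" "s \<le> t"
    have "R * dil s \<le> (q * R') * dil t" using s assms dil_mono by (intro mult_mono) auto
    also have "\<dots> \<le> q * \<bar>\<xi>\<bar>" using \<xi> q_pos by (simp add: mult.assoc)
    finally have 1: "R * dil s \<le> q * \<bar>\<xi>\<bar>" .
    also have "\<dots> \<le> p * \<bar>\<xi>\<bar>" using q_le_p by (intro mult_right_mono) auto
    finally have 2: "cmod (F s (p * \<xi>)) \<le> \<theta>" "cmod (F s (q * \<xi>)) \<le> \<theta>" 
      using b 1 s p_pos q_pos unfolding bounded_beyond_def by (auto simp: abs_mult)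
    have "cmod (F s (p * \<xi>)) * cmod (F s (q * \<xi>)) \<le> \<theta> * \<theta>"
      using 2 by (intro mult_mono) (auto intro: order_trans[OF norm_ge_zero])
    then show "exp s * (cmod (F s (p * \<xi>)) * cmod (F s (q * \<xi>))) \<le> \<theta>\<^sup>2 * exp s" 
      by (simp add: power2_eq_square)
  qed (use t in \<open>auto intro!: derivative_eq_intros\<close>)
  ultimately have "cmod (F t \<xi>) * exp t \<le> \<theta>\<^sup>2 * exp t" by (simp only: mult.commute[of "exp t"] exp_zero)
  then show "cmod (F t \<xi>) \<le> \<theta>\<^sup>2" by simp
qed

text \<open>The bound is squared repeatedly. Each squaring needs the initial datum to satisfy the new bound outside
the new ball, which is where its decay at infinity enters.\<close>

lemma uniform_decay:
  assumes init: "(F 0 \<longlongrightarrow> 0) at_infinity"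
    and b: "bounded_beyond R \<theta>" "0 < R" "0 \<le> \<theta>" "\<theta> < 1" and \<epsilon>: "0 < \<epsilon>"
  obtains R' where "0 < R'" "bounded_beyond R' \<epsilon>"
proof (cases "\<theta> = 0")
  case True
  then have "bounded_beyond R \<epsilon>" using b \<epsilon> unfolding bounded_beyond_def by force
  then show thesis using b(2) that by blast
next
  case False
  have small: "\<exists>R'. \<forall>\<xi>. R' \<le> \<bar>\<xi>\<bar> \<longrightarrow> cmod (F 0 \<xi>) \<le> e" if "0 < e" for e
  proof -
    have "eventually (\<lambda>\<xi>. dist (F 0 \<xi>) 0 < e) at_infinity" using tendstoD[OF init that] .
    then show ?thesis unfolding eventually_at_infinity by (auto intro: less_imp_le)
  qed
  have *: "\<exists>R'>0. bounded_beyond R' (\<theta> ^ (2 ^ n))" for n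
  proof (induction n)
    case 0 then show ?case using b by auto
  next
    case (Suc n)
    then obtain R1 where R1: "0 < R1" "bounded_beyond R1 (\<theta> ^ (2 ^ n))" by blast
    obtain R2 where R2: "\<And>\<xi>. R2 \<le> \<bar>\<xi>\<bar> \<Longrightarrow> cmod (F 0 \<xi>) \<le> (\<theta> ^ (2 ^ n))\<^sup>2"
      using small[of "(\<theta> ^ (2 ^ n))\<^sup>2"] False b(3) by auto
    have "bounded_beyond (max R2 (R1 / q)) ((\<theta> ^ (2 ^ n))\<^sup>2)"
    proof (rule bounded_beyond_square[OF R1(2,1)])
      have "q * (R1 / q) \<le> q * max R2 (R1 / q)" using q_pos by (intro mult_left_mono) auto
      then show "R1 \<le> q * max R2 (R1 / q)" using q_pos by simp
    qed (use R2 in auto)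
    moreover have "0 < max R2 (R1 / q)" using R1 q_pos by (simp add: less_max_iff_disj)
    moreover have "(\<theta> ^ (2 ^ n))\<^sup>2 = \<theta> ^ (2 ^ Suc n)" by (simp add: mult.commute flip: power_mult)
    ultimately show ?case by metis
  qed
  have "(\<lambda>n. \<theta> ^ n) \<longlonglongrightarrow> 0" using b by (intro LIMSEQ_realpow_zero)
  then obtain n where n: "\<theta> ^ n < \<epsilon>" using order_tendstoD(2)[OF _ \<epsilon>] by (metis eventually_sequentially order_refl)
  have "n \<le> 2 ^ n" by (simp add: less_imp_le)
  then have "\<theta> ^ (2 ^ n) \<le> \<theta> ^ n" using b by (intro power_decreasing) auto
  then have "bounded_beyond R' \<epsilon>" if "bounded_beyond R' (\<theta> ^ (2 ^ n))" for R'
    using that n unfolding bounded_beyond_def by (meson less_imp_le order_trans)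
  then show thesis using *[of n] that by blast
qed

end

text \<open>Since both flows are bounded by 1, the difference \<open>u\<close> satisfies a linear inequality with gain
\<open>\<bar>u (p * \<xi>)\<bar> + \<bar>u (q * \<xi>)\<bar>\<close>, for which \<open>\<bar>\<xi>\<bar> powr a\<close> is an eigenfunction. The comparison function also
carries a small multiple of the eigenfunction \<open>1\<close> (eigenvalue 1): it makes the quotient of \<open>\<bar>u\<bar>\<close> by the
comparison function bounded near the origin for positive times, where nothing is known beforehand.\<close>

lemma flow_contraction:
  assumes "wild_flow p q F" "wild_flow p q G" and a: "0 < a" and D: "0 \<le> D"
    and init: "\<And>\<xi>. cmod (F 0 \<xi> - G 0 \<xi>) \<le> D * \<bar>\<xi>\<bar> powr a" and T: "0 \<le> T"
  shows "cmod (F T \<zeta> - G T \<zeta>) \<le> D * \<bar>\<zeta>\<bar> powr a * exp ((p powr a + q powr a - 1) * T)"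
proof -
  interpret F: wild_flow p q F by fact
  interpret G: wild_flow p q G by fact
  define u where "u s \<xi> = F s \<xi> - G s \<xi>" for s \<xi>
  define \<mu> where "\<mu> = p powr a + q powr a"
  have \<mu>: "0 \<le> \<mu>" "\<mu> \<le> 2"
    using powr_le1[of a p] powr_le1[of a q] a F.p_pos F.q_pos F.p_less_1 F.q_less_1 by (auto simp: \<mu>_def)
  define W where "W \<epsilon> s \<xi> = D * \<bar>\<xi>\<bar> powr a * exp ((\<mu> - 1) * s) + \<epsilon> * exp s" for \<epsilon> s \<xi> :: real
  have main: "cmod (u T \<zeta>) \<le> W \<epsilon> T \<zeta>" if \<epsilon>: "0 < \<epsilon>" for \<epsilon>
  proof -
    define P where "P z \<longleftrightarrow> (\<forall>t \<xi>. 0 \<le> t \<longrightarrow> t \<le> T \<longrightarrow> cmod (u t \<xi>) \<le> z * W \<epsilon> t \<xi>)" for z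
    have "P 1"
    proof (rule contraction_limit[of "1 - exp (- (2 * T))" 1 "max 1 (2 / \<epsilon>)"])
      show "P (max 1 (2 / \<epsilon>))" unfolding P_def
      proof (intro allI impI)
        fix t \<xi> assume t: "0 \<le> t" "t \<le> T"
        have "cmod (u t \<xi>) \<le> 1 + 1" unfolding u_def
          by (rule order_trans[OF norm_triangle_ineq4]) (intro add_mono F.norm_le_1 G.norm_le_1 t)
        also have "\<dots> = (2 / \<epsilon>) * (\<epsilon> * 1)" using \<epsilon> by simp
        also have "\<dots> \<le> max 1 (2 / \<epsilon>) * W \<epsilon> t \<xi>"
        proof (rule mult_mono)
          have "\<epsilon> * 1 \<le> \<epsilon> * exp t" using \<epsilon> t by (intro mult_left_mono) auto
          moreover have "0 \<le> D * \<bar>\<xi>\<bar> powr a * exp ((\<mu> - 1) * t)" using D by simp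
          ultimately show "\<epsilon> * 1 \<le> W \<epsilon> t \<xi>" unfolding W_def by linarith
        qed (use \<epsilon> in auto)
        finally show "cmod (u t \<xi>) \<le> max 1 (2 / \<epsilon>) * W \<epsilon> t \<xi>" .
      qed
      show "P 1" if "\<And>n. P (Z n)" "Z \<longlonglongrightarrow> 1" for Z
        unfolding P_def
      proof (intro allI impI)
        fix t \<xi> assume "0 \<le> t" "t \<le> T"
        then show "cmod (u t \<xi>) \<le> 1 * W \<epsilon> t \<xi>"
          using that(1) unfolding P_def by (intro LIMSEQ_le_const[OF tendsto_mult_right[OF that(2)]]) auto
      qed
      show "P (1 + (1 - exp (- (2 * T))) * (z - 1))" if z: "1 \<le> z" "P z" for z
        unfolding P_def
      proof (intro allI impI)
        fix t \<xi> assume t: "0 \<le> t" "t \<le> T"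
        \<comment> \<open>\<open>\<phi> s\<close> is \<open>exp s\<close> times the comparison function, and \<open>\<phi>'\<close> its derivative.\<close>
        define \<phi> where "\<phi> s = D * \<bar>\<xi>\<bar> powr a * exp (\<mu> * s) + \<epsilon> * exp (2 * s)" for s
        have \<phi>W: "\<phi> s = exp s * W \<epsilon> s \<xi>" for s
        proof -
          have "exp (\<mu> * s) = exp s * exp ((\<mu> - 1) * s)" "exp (2 * s) = exp s * exp s"
            by (simp_all add: algebra_simps flip: exp_add)
          then show ?thesis by (simp add: \<phi>_def W_def algebra_simps)
        qed
        define \<phi>' where "\<phi>' s = D * \<bar>\<xi>\<bar> powr a * exp (\<mu> * s) * \<mu> + \<epsilon> * exp (2 * s) * 2" for s
        have \<phi>': "\<phi>' s = exp s * (W \<epsilon> s (p * \<xi>) + W \<epsilon> s (q * \<xi>))" for s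
        proof -
          have "exp (\<mu> * s) = exp s * exp ((\<mu> - 1) * s)" "exp (2 * s) = exp s * exp s"
            by (simp_all add: algebra_simps flip: exp_add)
          moreover have "\<bar>p * \<xi>\<bar> powr a = p powr a * \<bar>\<xi>\<bar> powr a" "\<bar>q * \<xi>\<bar> powr a = q powr a * \<bar>\<xi>\<bar> powr a"
            using F.p_pos F.q_pos by (auto simp: abs_mult powr_mult)
          ultimately show ?thesis by (simp add: \<phi>'_def W_def algebra_simps \<mu>_def)
        qed
        have "exp t * cmod (u t \<xi>) \<le> cmod (u 0 \<xi>) + (z * \<phi> t - z * \<phi> 0)"
        proof (rule duhamel_bound[where g="\<lambda>s. F s (p * \<xi>) * F s (q * \<xi>) - G s (p * \<xi>) * G s (q * \<xi>)"])
          fix s :: real assume s: "0 \<le> s"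
          from has_vector_derivative_diff[OF F.deriv_F[OF s] G.deriv_F[OF s]]
          show "((\<lambda>s. u s \<xi>) has_vector_derivative F s (p * \<xi>) * F s (q * \<xi>) - G s (p * \<xi>) * G s (q * \<xi>) - u s \<xi>) (at s within {0..})"
            by (simp add: u_def algebra_simps)
        next
          fix s assume s: "0 \<le> s" "s \<le> t"
          have "F s (p * \<xi>) * F s (q * \<xi>) - G s (p * \<xi>) * G s (q * \<xi>) = u s (p * \<xi>) * F s (q * \<xi>) + G s (p * \<xi>) * u s (q * \<xi>)"
            by (simp add: u_def algebra_simps)
          also have "cmod \<dots> \<le> cmod (u s (p * \<xi>)) * 1 + 1 * cmod (u s (q * \<xi>))"
            by (rule order_trans[OF norm_triangle_ineq])
              (unfold norm_mult, intro add_mono mult_mono F.norm_le_1 G.norm_le_1 s, auto)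
          also have "\<dots> \<le> z * W \<epsilon> s (p * \<xi>) * 1 + 1 * (z * W \<epsilon> s (q * \<xi>))"
            using z s t unfolding P_def by (intro add_mono) auto
          finally have "cmod (F s (p * \<xi>) * F s (q * \<xi>) - G s (p * \<xi>) * G s (q * \<xi>)) \<le> z * (W \<epsilon> s (p * \<xi>) + W \<epsilon> s (q * \<xi>))"
            by (simp add: algebra_simps)
          then show "exp s * cmod (F s (p * \<xi>) * F s (q * \<xi>) - G s (p * \<xi>) * G s (q * \<xi>)) \<le> z * \<phi>' s"
            unfolding \<phi>' by (simp add: mult.left_commute)
        qed (auto simp: \<phi>_def \<phi>'_def algebra_simps intro!: derivative_eq_intros t)
        moreover have "cmod (u 0 \<xi>) \<le> \<phi> 0" using init[of \<xi>] \<epsilon> by (simp add: u_def \<phi>_def)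
        ultimately have 1: "exp t * cmod (u t \<xi>) \<le> z * \<phi> t - (z - 1) * \<phi> 0" by (simp add: algebra_simps)
        \<comment> \<open>The contraction factor: up to time \<open>T\<close>, \<open>\<phi>\<close> grows by at most \<open>exp (2 * T)\<close>, as \<open>\<mu> \<le> 2\<close>.\<close>
        have "\<phi> t \<le> D * \<bar>\<xi>\<bar> powr a * exp (2 * T) + \<epsilon> * exp (2 * T)"
          unfolding \<phi>_def using D \<epsilon> t \<mu> by (intro add_mono mult_left_mono) (auto intro: mult_mono)
        also have "\<dots> = exp (2 * T) * \<phi> 0" by (simp add: \<phi>_def algebra_simps)
        finally have "exp (- (2 * T)) * \<phi> t \<le> exp (- (2 * T)) * (exp (2 * T) * \<phi> 0)" by (intro mult_left_mono) auto
        then have "exp (- (2 * T)) * \<phi> t \<le> \<phi> 0" by (simp add: exp_minus field_simps)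
        then have "(z - 1) * (exp (- (2 * T)) * \<phi> t) \<le> (z - 1) * \<phi> 0" using z by (intro mult_left_mono) auto
        with 1 have "exp t * cmod (u t \<xi>) \<le> (1 + (1 - exp (- (2 * T))) * (z - 1)) * \<phi> t"
          by (simp add: algebra_simps)
        then have "exp t * cmod (u t \<xi>) \<le> exp t * ((1 + (1 - exp (- (2 * T))) * (z - 1)) * W \<epsilon> t \<xi>)"
          unfolding \<phi>W by (simp add: mult.left_commute)
        then show "cmod (u t \<xi>) \<le> (1 + (1 - exp (- (2 * T))) * (z - 1)) * W \<epsilon> t \<xi>" by simp
      qed
    qed (use T in auto)
    then show ?thesis unfolding P_def using T by simp
  qed
  show ?thesis
  proof (rule field_le_epsilon)
    fix e :: real assume "0 < e"
    from main[of "e / exp T"] this show "cmod (F T \<zeta> - G T \<zeta>) \<le> D * \<bar>\<zeta>\<bar> powr a * exp ((p powr a + q powr a - 1) * T) + e"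
      by (simp add: W_def u_def \<mu>_def)
  qed
qed


section \<open>Uniform weighted square-integrability at high frequency\<close>

context wild_flow
begin

text \<open>Differentiating \<open>exp s * (cmod (F s \<xi>))\<^sup>2\<close> produces twice the inner product of \<open>F s \<xi>\<close> with the gain term,
and completing the square replaces it by the squared modulus of the gain term.\<close>

lemma cmod2_duhamel:
  assumes "0 \<le> t"
  shows "exp t * (cmod (F t \<xi>))\<^sup>2 \<le> (cmod (F 0 \<xi>))\<^sup>2 + integral {0..t} (\<lambda>s. exp s * (cmod (F s (p * \<xi>) * F s (q * \<xi>)))\<^sup>2)"
proof (cases "t = 0")
  case False
  define h where "h s = exp s * (cmod (F s (p * \<xi>) * F s (q * \<xi>)))\<^sup>2" for s
  have contF: "continuous_on {0..t} (\<lambda>s. F s x)" for x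
    by (rule continuous_on_subset[OF continuous_on_vector_derivative[of "{0..}"]]) (use deriv_F in auto)
  have conth: "continuous_on {0..t} h" unfolding h_def by (intro continuous_intros contF)
  define \<psi> where "\<psi> s = exp s * (F s \<xi> \<bullet> F s \<xi>) - integral {0..s} h" for s
  have "\<psi> t \<le> \<psi> 0"
  proof (rule DERIV_nonpos_imp_decreasing_open[where f=\<psi> and a=0 and b=t])
    show "continuous_on {0..t} \<psi>" unfolding \<psi>_def
      by (intro continuous_intros contF indefinite_integral_continuous_1 integrable_continuous_interval conth)
    fix s assume s: "0 < s" "s < t"
    define g where "g = F s (p * \<xi>) * F s (q * \<xi>)"
    have dF: "((\<lambda>s. F s \<xi>) has_vector_derivative g - F s \<xi>) (at s)"
      unfolding g_def using s by (intro has_vector_derivative_within_ge_0 deriv_F) auto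
    have dI: "((\<lambda>s. integral {0..s} h) has_real_derivative h s) (at s)"
    proof -
      have "((\<lambda>s. integral {0..s} h) has_real_derivative h s) (at s within {0..t})"
        using s by (intro integral_has_real_derivative conth) auto
      moreover have "at s within {0..t} = at s" using s by (intro at_within_interior) auto
      ultimately show ?thesis by simp
    qed
    have dn: "((\<lambda>s. F s \<xi> \<bullet> F s \<xi>) has_real_derivative 2 * (F s \<xi> \<bullet> (g - F s \<xi>))) (at s)"
      unfolding has_field_derivative_def
      by (rule has_derivative_eq_rhs[OF has_derivative_inner[OF dF[unfolded has_vector_derivative_def] dF[unfolded has_vector_derivative_def]]])
        (simp add: fun_eq_iff inner_commute)
    have "(\<psi> has_real_derivative exp s * (F s \<xi> \<bullet> F s \<xi>) + exp s * (2 * (F s \<xi> \<bullet> (g - F s \<xi>))) - h s) (at s)"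
      unfolding \<psi>_def by (auto intro!: derivative_eq_intros dI dn)
    moreover have "exp s * (F s \<xi> \<bullet> F s \<xi>) + exp s * (2 * (F s \<xi> \<bullet> (g - F s \<xi>))) - h s \<le> 0"
    proof -
      have "exp s * (F s \<xi> \<bullet> F s \<xi>) + exp s * (2 * (F s \<xi> \<bullet> (g - F s \<xi>))) - h s = - exp s * ((g - F s \<xi>) \<bullet> (g - F s \<xi>))"
        unfolding h_def g_def[symmetric]
        by (simp add: power2_norm_eq_inner inner_diff_left inner_diff_right inner_commute algebra_simps)
      then show ?thesis by simp
    qed
    ultimately show "\<exists>y. (\<psi> has_real_derivative y) (at s) \<and> y \<le> 0" by blast
  qed (use assms in auto)
  then show ?thesis unfolding \<psi>_def h_def[abs_def] power2_norm_eq_inner[symmetric] by simp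
qed simp

lemma lipschitz_in_time:
  assumes "0 \<le> s" "0 \<le> t"
  shows "cmod (F t \<xi> - F s \<xi>) \<le> 2 * \<bar>t - s\<bar>"
proof -
  have *: "cmod (F t \<xi> - F s \<xi>) \<le> 2 * t - 2 * s" if "0 \<le> s" "s < t" for s t
  proof (rule differentiable_bound_general)
    show "continuous_on {s..t} (\<lambda>s. F s \<xi>)"
      by (rule continuous_on_subset[OF continuous_on_vector_derivative[of "{0..}"]]) (use deriv_F that in auto)
    fix x assume x: "s < x" "x < t"
    show "((\<lambda>s. F s \<xi>) has_vector_derivative F x (p * \<xi>) * F x (q * \<xi>) - F x \<xi>) (at x)"
      using that x by (intro has_vector_derivative_within_ge_0 deriv_F) auto
    have "cmod (F x (p * \<xi>) * F x (q * \<xi>)) \<le> 1 * 1"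
      unfolding norm_mult using that x by (intro mult_mono norm_le_1) auto
    then show "cmod (F x (p * \<xi>) * F x (q * \<xi>) - F x \<xi>) \<le> 2"
      using norm_triangle_ineq4[of "F x (p * \<xi>) * F x (q * \<xi>)" "F x \<xi>"] norm_le_1[of x \<xi>] that x by linarith
  qed (use that in \<open>auto intro!: derivative_eq_intros continuous_intros\<close>)
  show ?thesis using *[of s t] *[of t s] assms by (cases s t rule: linorder_cases) (auto simp: norm_minus_commute)
qed

text \<open>Continuity in frequency together with a Lipschitz bound in time that is uniform in frequency. Joint
measurability is what the exchange of the integrals over time and frequency rests on.\<close>

lemma continuous_F_joint: "continuous_on UNIV (\<lambda>(s, \<xi>). F (max 0 s) \<xi>)"
proof -
  have "((\<lambda>x. F (max 0 (fst x)) (snd x)) \<longlongrightarrow> F (max 0 s) \<xi>) (at (s, \<xi>))" for s \<xi>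
  proof (rule LIM_zero_cancel, rule Lim_null_comparison)
    let ?b = "\<lambda>x. 2 * \<bar>max 0 (fst x) - max 0 s\<bar> + cmod (F (max 0 s) (snd x) - F (max 0 s) \<xi>)"
    show "eventually (\<lambda>x. cmod (F (max 0 (fst x)) (snd x) - F (max 0 s) \<xi>) \<le> ?b x) (at (s, \<xi>))"
    proof (rule always_eventually, rule allI)
      fix x :: "real \<times> real"
      have "cmod (F (max 0 (fst x)) (snd x) - F (max 0 s) \<xi>) \<le> cmod (F (max 0 (fst x)) (snd x) - F (max 0 s) (snd x)) + cmod (F (max 0 s) (snd x) - F (max 0 s) \<xi>)"
        using norm_triangle_ineq[of "F (max 0 (fst x)) (snd x) - F (max 0 s) (snd x)" "F (max 0 s) (snd x) - F (max 0 s) \<xi>"] by simp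
      then show "cmod (F (max 0 (fst x)) (snd x) - F (max 0 s) \<xi>) \<le> ?b x"
        using lipschitz_in_time[of "max 0 s" "max 0 (fst x)" "snd x"] by simp
    qed
    have snd: "(snd \<longlongrightarrow> \<xi>) (at (s, \<xi>))" and fst: "(fst \<longlongrightarrow> s) (at (s, \<xi>))"
      using tendsto_snd[OF tendsto_ident_at[of "(s, \<xi>)" UNIV]] tendsto_fst[OF tendsto_ident_at[of "(s, \<xi>)" UNIV]] by simp_all
    have "isCont (F (max 0 s)) \<xi>" using continuous_F[of "max 0 s"] by (simp add: continuous_on_eq_continuous_at)
    from isCont_tendsto_compose[OF this snd]
    have "(?b \<longlongrightarrow> 2 * \<bar>max 0 s - max 0 s\<bar> + cmod (F (max 0 s) \<xi> - F (max 0 s) \<xi>)) (at (s, \<xi>))"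
      by (intro tendsto_intros fst)
    then show "(?b \<longlongrightarrow> 0) (at (s, \<xi>))" by simp
  qed
  then show ?thesis by (auto simp: continuous_on_def case_prod_unfold)
qed

text \<open>For \<open>\<bar>\<xi>\<bar> \<ge> R * dil t\<close> the factor \<open>F s (q * \<xi>)\<close> of the gain term is at most \<open>\<theta>\<close>; the substitution
\<open>y = p * \<xi>\<close> in the other factor costs \<open>p powr - (k + 1)\<close>. By the smallness assumption the gain term
contributes at most half of the quantity to be bounded, up to the frequencies between \<open>p * R * dil t\<close> and
\<open>R * dil s\<close>, where \<open>cmod (F s y) \<le> 1\<close> suffices. Truncating at \<open>\<Lambda>\<close> makes all norms finite from the start, and
is compatible with the equation because \<open>p < 1\<close>.\<close>

lemma weighted_L2_truncated:
  assumes b: "bounded_beyond (q * R) \<theta>" and R: "0 < R" and k: "0 \<le> k"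
    and small: "\<theta>\<^sup>2 * p powr - (k + 1) \<le> 1 / 2"
    and A: "(\<integral>\<^sup>+\<xi>. ennreal (\<bar>\<xi>\<bar> powr k * (cmod (F 0 \<xi>))\<^sup>2) \<partial>lborel) \<le> ennreal A" "0 \<le> A"
    and T: "0 \<le> T" and \<Lambda>: "0 \<le> \<Lambda>"
  shows "(\<integral>\<^sup>+\<xi>. indicator {\<xi>. R * dil T \<le> \<bar>\<xi>\<bar> \<and> \<bar>\<xi>\<bar> \<le> \<Lambda>} \<xi> * ennreal (\<bar>\<xi>\<bar> powr k * (cmod (F T \<xi>))\<^sup>2) \<partial>lborel)
    \<le> ennreal ((2 * A / R powr (k + 1) + 2) * (R * dil T) powr (k + 1))"
proof -
  define J where "J t = {\<xi>. R * dil t \<le> \<bar>\<xi>\<bar> \<and> \<bar>\<xi>\<bar> \<le> \<Lambda>}" for t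
  have [measurable]: "J t \<in> sets borel" for t unfolding J_def by measurable
  have measF: "F t \<in> borel_measurable borel" if "0 \<le> t" for t
    using continuous_F[OF that] by (rule borel_measurable_continuous_onI)
  have [measurable]: "F 0 \<in> borel_measurable borel" by (rule measF) simp
  have joint: "(\<lambda>x. F (max 0 (fst x)) (snd x)) \<in> borel_measurable borel"
    using continuous_F_joint by (intro borel_measurable_continuous_onI) (simp add: case_prod_unfold)
  define w where "w t = (R * dil t) powr (k + 1)" for t
  have w_pos: "0 < w t" for t using R by (simp add: w_def)
  have w_mono: "w s \<le> w t" if "s \<le> t" for s t
    unfolding w_def using R k dil_mono[OF that] by (intro powr_mono2 mult_left_mono) auto
  define a where "a t = (\<integral>\<^sup>+\<xi>. indicator (J t) \<xi> * ennreal (\<bar>\<xi>\<bar> powr k * (cmod (F t \<xi>))\<^sup>2) \<partial>lborel)" for t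
  \<comment> \<open>The fixed point of \<open>z \<mapsto> A / w 0 + (z + 2) / 2\<close>, the improvement obtained from one use of the equation.\<close>
  define K where "K = 2 * A / R powr (k + 1) + 2"
  define P where "P z \<longleftrightarrow> (\<forall>t\<ge>0. a t \<le> ennreal (z * w t))" for z
  have ball: "(\<integral>\<^sup>+\<xi>. indicator {-r..r} \<xi> * ennreal (r powr k) \<partial>lborel) = ennreal (2 * r powr (k + 1))" if "0 \<le> r" for r
  proof -
    have "(\<integral>\<^sup>+\<xi>. indicator {-r..r} \<xi> * ennreal (r powr k) \<partial>lborel) = ennreal (2 * r) * ennreal (r powr k)"
      using that by (subst nn_integral_multc) auto
    also have "\<dots> = ennreal (2 * r powr (k + 1))" using that by (simp add: powr_add mult_ac flip: ennreal_mult)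
    finally show ?thesis .
  qed
  have w0: "w 0 = R powr (k + 1)" by (simp add: w_def)
  have "P K"
  proof (rule contraction_limit[of "1/2" K "max K (2 * \<Lambda> powr (k + 1) / w 0)"])
    show "P (max K (2 * \<Lambda> powr (k + 1) / w 0))" unfolding P_def
    proof (intro allI impI)
      fix t :: real assume t: "0 \<le> t"
      have "a t \<le> (\<integral>\<^sup>+\<xi>. indicator {-\<Lambda>..\<Lambda>} \<xi> * ennreal (\<Lambda> powr k) \<partial>lborel)"
        unfolding a_def
      proof (rule nn_integral_mono)
        fix \<xi> :: real
        have "\<bar>\<xi>\<bar> powr k * (cmod (F t \<xi>))\<^sup>2 \<le> \<Lambda> powr k * 1" if "\<xi> \<in> J t"
          using that k norm_le_1[OF t] by (intro mult_mono powr_mono2 power_le_one) (auto simp: J_def)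
        then show "indicator (J t) \<xi> * ennreal (\<bar>\<xi>\<bar> powr k * (cmod (F t \<xi>))\<^sup>2) \<le> indicator {-\<Lambda>..\<Lambda>} \<xi> * ennreal (\<Lambda> powr k)"
          by (cases "\<xi> \<in> J t") (auto simp: J_def indicator_def intro!: ennreal_leI)
      qed
      also have "\<dots> = ennreal (2 * \<Lambda> powr (k + 1))" by (rule ball) fact
      also have "\<dots> = ennreal (2 * \<Lambda> powr (k + 1) / w 0 * w 0)" using w_pos[of 0] by simp
      also have "\<dots> \<le> ennreal (max K (2 * \<Lambda> powr (k + 1) / w 0) * w t)"
        using w_pos w_mono[OF t] by (intro ennreal_leI mult_mono) (auto simp: less_imp_le le_max_iff_disj)
      finally show "a t \<le> ennreal (max K (2 * \<Lambda> powr (k + 1) / w 0) * w t)" .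
    qed
    show "P K" if "\<And>n. P (Z n)" "Z \<longlonglongrightarrow> K" for Z
      unfolding P_def
    proof (intro allI impI)
      fix t :: real assume "0 \<le> t"
      then show "a t \<le> ennreal (K * w t)"
        using that(1) unfolding P_def by (intro LIMSEQ_le_const[OF tendsto_ennrealI[OF tendsto_mult_right[OF that(2)]]]) auto
    qed
    show "P (K + 1 / 2 * (z - K))" if z: "K \<le> z" "P z" for z
      unfolding P_def
    proof (intro allI impI)
      fix t :: real assume t: "0 \<le> t"
      have z0: "0 \<le> z" using z A(2) by (auto simp: K_def intro: order_trans[rotated])
      \<comment> \<open>The flow is continuous at nonnegative times only; \<open>max 0 s\<close> makes \<open>h \<xi>\<close> measurable on the whole line.\<close>
      define h where "h \<xi> s = exp s * (\<theta>\<^sup>2 * (cmod (F (max 0 s) (p * \<xi>)))\<^sup>2)" for \<xi> s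
      define H where "H \<xi> s = indicator (J t) \<xi> * (ennreal (\<bar>\<xi>\<bar> powr k) * (ennreal (h \<xi> s) * indicator {0..t} s))" for \<xi> s
      have [measurable]: "(\<lambda>x. F (max 0 (snd x)) (p * fst x)) \<in> borel_measurable (borel \<Otimes>\<^sub>M borel)"
        unfolding borel_prod using measurable_compose[OF borel_measurable_continuous_onI joint, of "\<lambda>x. (snd x, p * fst x)"]
        by (simp add: continuous_intros)
      have measH: "case_prod H \<in> borel_measurable (lborel \<Otimes>\<^sub>M lborel)"
        unfolding H_def h_def case_prod_unfold measurable_cong_sets[OF sets_pair_measure_cong[OF sets_lborel sets_lborel] refl]
        by measurable
      have duh: "indicator (J t) \<xi> * (ennreal (exp t) * ennreal (\<bar>\<xi>\<bar> powr k * (cmod (F t \<xi>))\<^sup>2)) \<le> ennreal (\<bar>\<xi>\<bar> powr k * (cmod (F 0 \<xi>))\<^sup>2) + (\<integral>\<^sup>+s. H \<xi> s \<partial>lborel)" for \<xi>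
      proof (cases "\<xi> \<in> J t")
        case True
        have contF: "continuous_on {0..t} (\<lambda>s. F s x)" for x
          by (rule continuous_on_subset[OF continuous_on_vector_derivative[of "{0..}"]]) (use deriv_F in auto)
        have conth: "continuous_on {0..t} (h \<xi>)"
          using contF by (subst continuous_on_cong[OF refl, where g="\<lambda>s. exp s * (\<theta>\<^sup>2 * (cmod (F s (p * \<xi>)))\<^sup>2)"]) (auto simp: h_def intro!: continuous_intros)
        have [measurable]: "(\<lambda>s. F (max 0 s) (p * \<xi>)) \<in> borel_measurable borel"
          using measurable_compose[OF borel_measurable_continuous_onI joint, of "\<lambda>s. (s, p * \<xi>)"]
          by (simp add: continuous_intros)
        have mh: "(\<lambda>s. ennreal (h \<xi> s) * indicator {0..t} s) \<in> borel_measurable lborel"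
          unfolding h_def by measurable
        have hI: "(h \<xi> has_integral integral {0..t} (h \<xi>)) {0..t}"
          by (intro integrable_integral integrable_continuous_interval conth)
        have "integral {0..t} (\<lambda>s. exp s * (cmod (F s (p * \<xi>) * F s (q * \<xi>)))\<^sup>2) \<le> integral {0..t} (h \<xi>)"
        proof (rule integral_le)
          fix s assume "s \<in> {0..t}"
          then have s: "0 \<le> s" "s \<le> t" by auto
          have "q * R * dil s \<le> q * (R * dil t)" using dil_mono[OF s(2)] q_pos R by simp
          also have "\<dots> \<le> q * \<bar>\<xi>\<bar>" using True q_pos by (simp add: J_def)
          finally have "cmod (F s (q * \<xi>)) \<le> \<theta>" using b s q_pos by (simp add: bounded_beyond_def abs_mult)
          then have "(cmod (F s (q * \<xi>)))\<^sup>2 \<le> \<theta>\<^sup>2" by (intro power_mono) auto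
          from mult_right_mono[OF this, of "(cmod (F s (p * \<xi>)))\<^sup>2"]
          show "exp s * (cmod (F s (p * \<xi>) * F s (q * \<xi>)))\<^sup>2 \<le> h \<xi> s"
            using s by (simp add: h_def norm_mult power_mult_distrib mult.commute)
        qed (use conth in \<open>auto intro!: integrable_continuous_interval continuous_intros contF\<close>)
        with cmod2_duhamel[OF t, of \<xi>] have "exp t * (cmod (F t \<xi>))\<^sup>2 \<le> (cmod (F 0 \<xi>))\<^sup>2 + integral {0..t} (h \<xi>)" by linarith
        then have "\<bar>\<xi>\<bar> powr k * (exp t * (cmod (F t \<xi>))\<^sup>2) \<le> \<bar>\<xi>\<bar> powr k * ((cmod (F 0 \<xi>))\<^sup>2 + integral {0..t} (h \<xi>))" by (intro mult_left_mono) auto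
        then have "ennreal (\<bar>\<xi>\<bar> powr k * (exp t * (cmod (F t \<xi>))\<^sup>2)) \<le> ennreal (\<bar>\<xi>\<bar> powr k * (cmod (F 0 \<xi>))\<^sup>2 + \<bar>\<xi>\<bar> powr k * integral {0..t} (h \<xi>))" by (intro ennreal_leI) (simp add: distrib_left)
        also have "\<dots> = ennreal (\<bar>\<xi>\<bar> powr k * (cmod (F 0 \<xi>))\<^sup>2) + ennreal (\<bar>\<xi>\<bar> powr k) * ennreal (integral {0..t} (h \<xi>))"
          using has_integral_nonneg[OF hI] by (subst ennreal_plus) (auto simp: h_def ennreal_mult)
        also have "ennreal (integral {0..t} (h \<xi>)) = (\<integral>\<^sup>+s. ennreal (h \<xi> s) * indicator {0..t} s \<partial>lborel)"
          by (rule nn_integral_has_integral_lebesgue'[symmetric, OF _ hI]) (simp add: h_def)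
        also have "ennreal (\<bar>\<xi>\<bar> powr k) * \<dots> = (\<integral>\<^sup>+s. H \<xi> s \<partial>lborel)"
          using True mh by (subst nn_integral_cmult[symmetric]) (simp_all add: H_def[abs_def])
        finally show ?thesis using True by (simp add: mult_ac flip: ennreal_mult)
      qed simp
      define c where "c = \<theta>\<^sup>2 * p powr - (k + 1) * ((z + 2) * w t)"
      have c0: "0 \<le> c" using z0 w_pos[of t] by (simp add: c_def)
      have c_le: "c \<le> 1 / 2 * ((z + 2) * w t)" unfolding c_def using small z0 w_pos[of t] by (intro mult_right_mono) auto
      have inner: "(\<integral>\<^sup>+\<xi>. H \<xi> s \<partial>lborel) \<le> ennreal (c * exp s) * indicator {0..t} s" for s
      proof (cases "s \<in> {0..t}")
        case True
        then have s: "0 \<le> s" "s \<le> t" by auto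
        note [measurable] = measF[OF s(1)]
        define f where "f y = indicator {y. p * (R * dil t) \<le> \<bar>y\<bar> \<and> \<bar>y\<bar> \<le> p * \<Lambda>} y * (ennreal (p powr - k) * ennreal (\<bar>y\<bar> powr k * (cmod (F s y))\<^sup>2))" for y
        have [measurable]: "f \<in> borel_measurable borel" unfolding f_def by measurable
        have f: "f (0 + p * \<xi>) = indicator (J t) \<xi> * ennreal (\<bar>\<xi>\<bar> powr k * (cmod (F s (p * \<xi>)))\<^sup>2)" for \<xi>
        proof -
          have e: "p powr - k * (\<bar>p * \<xi>\<bar> powr k * (cmod (F s (p * \<xi>)))\<^sup>2) = \<bar>\<xi>\<bar> powr k * (cmod (F s (p * \<xi>)))\<^sup>2"
            using p_pos by (simp add: abs_mult powr_mult powr_minus)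
          have "indicator {y. p * (R * dil t) \<le> \<bar>y\<bar> \<and> \<bar>y\<bar> \<le> p * \<Lambda>} (p * \<xi>) = (indicator (J t) \<xi> :: ennreal)"
            using p_pos by (simp add: indicator_def J_def abs_mult)
          then show ?thesis unfolding f_def add_0_left by (simp add: e del: mult_cancel_left mult_cancel_right flip: ennreal_mult)
        qed
        have "(\<integral>\<^sup>+y. f y \<partial>lborel) \<le> (\<integral>\<^sup>+y. ennreal (p powr - k) * (indicator (J s) y * ennreal (\<bar>y\<bar> powr k * (cmod (F s y))\<^sup>2) + indicator {- (R * dil s)..R * dil s} y * ennreal ((R * dil s) powr k)) \<partial>lborel)"
        proof (rule nn_integral_mono)
          fix y :: real
          show "f y \<le> ennreal (p powr - k) * (indicator (J s) y * ennreal (\<bar>y\<bar> powr k * (cmod (F s y))\<^sup>2) + indicator {- (R * dil s)..R * dil s} y * ennreal ((R * dil s) powr k))"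
          proof (cases "\<bar>y\<bar> \<le> p * \<Lambda>")
            case y: True
            show ?thesis
            proof (cases "R * dil s \<le> \<bar>y\<bar>")
              case True
              moreover have "\<bar>y\<bar> \<le> \<Lambda>" using y p_less_1 \<Lambda> by (meson less_imp_le mult_left_le_one_le order_trans p_pos)
              ultimately have "indicator (J s) y = (1 :: ennreal)" by (simp add: J_def)
              then show ?thesis unfolding f_def by (simp add: distrib_left indicator_def)
            next
              case False
              have "\<bar>y\<bar> powr k * (cmod (F s y))\<^sup>2 \<le> (R * dil s) powr k * 1"
                using False k norm_le_1[OF s(1)] by (intro mult_mono powr_mono2 power_le_one) auto
              moreover have "indicator {- (R * dil s)..R * dil s} y = (1 :: ennreal)" using False by (simp add: indicator_def) linarith
              ultimately show ?thesis unfolding f_def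
                by (auto simp: indicator_def intro!: mult_left_mono ennreal_leI add_increasing)
            qed
          qed (simp add: f_def)
        qed
        also have "\<dots> = ennreal (p powr - k) * (a s + ennreal (2 * (R * dil s) powr (k + 1)))"
          unfolding a_def using R by (subst nn_integral_cmult, measurable, subst nn_integral_add, measurable, subst ball) auto
        also have "\<dots> \<le> ennreal (p powr - k) * (ennreal (z * w s) + ennreal (2 * w s))"
          using z(2) s unfolding P_def w_def by (intro mult_left_mono add_mono) auto
        also have "\<dots> = ennreal (p powr - k * ((z + 2) * w s))"
          using z0 w_pos[of s] by (subst ennreal_plus[symmetric]) (auto simp: distrib_right simp del: ennreal_plus simp flip: ennreal_mult)
        also have "\<dots> \<le> ennreal (p powr - k * ((z + 2) * w t))"
          using z0 w_mono[OF s(2)] by (intro ennreal_leI mult_left_mono) auto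
        finally have fI: "(\<integral>\<^sup>+y. f y \<partial>lborel) \<le> ennreal (p powr - k * ((z + 2) * w t))" .
        have "(\<integral>\<^sup>+\<xi>. H \<xi> s \<partial>lborel) = (\<integral>\<^sup>+\<xi>. ennreal (\<theta>\<^sup>2 * exp s) * f (0 + p * \<xi>) \<partial>lborel)"
        proof (rule nn_integral_cong)
          fix \<xi>
          show "H \<xi> s = ennreal (\<theta>\<^sup>2 * exp s) * f (0 + p * \<xi>)"
            unfolding f H_def h_def using True s by (simp add: ennreal_mult max_absorb2 mult_ac)
        qed
        also have "\<dots> = ennreal (\<theta>\<^sup>2 * exp s) * (\<integral>\<^sup>+\<xi>. f (0 + p * \<xi>) \<partial>lborel)"
          by (rule nn_integral_cmult) measurable
        also have "(\<integral>\<^sup>+\<xi>. f (0 + p * \<xi>) \<partial>lborel) = ennreal (1 / p) * (\<integral>\<^sup>+y. f y \<partial>lborel)"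
        proof -
          have "ennreal (1 / p) * (\<integral>\<^sup>+y. f y \<partial>lborel) = (ennreal (1 / p) * ennreal p) * (\<integral>\<^sup>+\<xi>. f (0 + p * \<xi>) \<partial>lborel)"
            using p_pos by (subst nn_integral_real_affine[of f p 0]) (auto simp: mult.assoc)
          then show ?thesis using p_pos by (simp flip: ennreal_mult)
        qed
        finally have eqf: "(\<integral>\<^sup>+\<xi>. H \<xi> s \<partial>lborel) = ennreal (\<theta>\<^sup>2 * exp s) * (ennreal (1 / p) * (\<integral>\<^sup>+y. f y \<partial>lborel))" .
        have "(\<integral>\<^sup>+\<xi>. H \<xi> s \<partial>lborel) \<le> ennreal (\<theta>\<^sup>2 * exp s) * (ennreal (1 / p) * ennreal (p powr - k * ((z + 2) * w t)))"
          unfolding eqf by (intro mult_left_mono fI) auto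
        also have "\<dots> = ennreal (\<theta>\<^sup>2 * exp s * (1 / p * (p powr - k * ((z + 2) * w t))))"
          using p_pos z0 w_pos[of t] by (simp flip: ennreal_mult)
        also have "\<theta>\<^sup>2 * exp s * (1 / p * (p powr - k * ((z + 2) * w t))) = c * exp s"
        proof -
          have "p powr - (k + 1) = 1 / p * p powr - k" using p_pos by (simp add: powr_diff)
          then show ?thesis by (simp add: c_def mult_ac)
        qed
        finally show ?thesis using True by simp
      qed (simp add: H_def)
      have "ennreal (exp t) * a t = (\<integral>\<^sup>+\<xi>. indicator (J t) \<xi> * (ennreal (exp t) * ennreal (\<bar>\<xi>\<bar> powr k * (cmod (F t \<xi>))\<^sup>2)) \<partial>lborel)"
        unfolding a_def using measF[OF t] by (subst nn_integral_cmult[symmetric]) (auto simp: mult_ac)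
      also have "\<dots> \<le> (\<integral>\<^sup>+\<xi>. ennreal (\<bar>\<xi>\<bar> powr k * (cmod (F 0 \<xi>))\<^sup>2) + (\<integral>\<^sup>+s. H \<xi> s \<partial>lborel) \<partial>lborel)"
        by (intro nn_integral_mono duh)
      also have "\<dots> = (\<integral>\<^sup>+\<xi>. ennreal (\<bar>\<xi>\<bar> powr k * (cmod (F 0 \<xi>))\<^sup>2) \<partial>lborel) + (\<integral>\<^sup>+\<xi>. (\<integral>\<^sup>+s. H \<xi> s \<partial>lborel) \<partial>lborel)"
        using measH by (intro nn_integral_add) (measurable, simp)
      also have "(\<integral>\<^sup>+\<xi>. (\<integral>\<^sup>+s. H \<xi> s \<partial>lborel) \<partial>lborel) = (\<integral>\<^sup>+s. (\<integral>\<^sup>+\<xi>. H \<xi> s \<partial>lborel) \<partial>lborel)"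
        by (rule lborel_pair.Fubini'[OF measH, symmetric])
      also have "\<dots> \<le> (\<integral>\<^sup>+s. ennreal (c * exp s) * indicator {0..t} s \<partial>lborel)"
        by (intro nn_integral_mono inner)
      also have "\<dots> = ennreal (c * exp t - c * exp 0)"
      proof (rule nn_integral_has_integral_lebesgue')
        show "((\<lambda>s. c * exp s) has_integral c * exp t - c * exp 0) {0..t}"
          using t by (intro fundamental_theorem_of_calculus) (auto intro!: derivative_eq_intros simp flip: has_real_derivative_iff_has_vector_derivative)
      qed (use c0 in auto)
      also have "(\<integral>\<^sup>+\<xi>. ennreal (\<bar>\<xi>\<bar> powr k * (cmod (F 0 \<xi>))\<^sup>2) \<partial>lborel) + ennreal (c * exp t - c * exp 0) \<le> ennreal A + ennreal (c * exp t)"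
        using c0 by (intro add_mono A ennreal_leI) auto
      also have "\<dots> \<le> ennreal (exp t * ((K + 1 / 2 * (z - K)) * w t))"
      proof -
        have "A = A / w 0 * w 0" using w_pos[of 0] by simp
        also have "\<dots> \<le> A / w 0 * w t" using A w_mono[OF t] w_pos[of 0] by (intro mult_left_mono) auto
        also have "\<dots> = 1 * (A / w 0 * w t)" by simp
        also have "\<dots> \<le> exp t * (A / w 0 * w t)"
          using A(2) w_pos[of 0] w_pos[of t] t by (intro mult_right_mono) auto
        finally have "A + c * exp t \<le> exp t * (A / w 0 * w t) + 1 / 2 * ((z + 2) * w t) * exp t"
          using c_le by (intro add_mono mult_right_mono) auto
        also have "\<dots> = exp t * ((K + 1 / 2 * (z - K)) * w t)" by (simp add: K_def w0 field_simps)
        finally show ?thesis using A(2) c0 by (simp add: ennreal_leI flip: ennreal_plus)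
      qed
      finally have "ennreal (exp t) * a t \<le> ennreal (exp t) * ennreal ((K + 1 / 2 * (z - K)) * w t)"
        by (simp add: ennreal_mult')
      then show "a t \<le> ennreal ((K + 1 / 2 * (z - K)) * w t)"
        by (subst (asm) ennreal_mult_le_mult_iff) auto
    qed
  qed auto
  then show ?thesis using T unfolding P_def a_def J_def K_def w_def by blast
qed

text \<open>Fatou's lemma removes the truncation; the power of \<open>dil T\<close> in the truncated bound is exactly the
Jacobian and weight factor of the change of variables.\<close>

lemma weighted_L2_scaled:
  assumes b: "bounded_beyond (q * R) \<theta>" and R: "0 < R" and k: "0 \<le> k"
    and small: "\<theta>\<^sup>2 * p powr - (k + 1) \<le> 1 / 2"
    and A: "(\<integral>\<^sup>+\<xi>. ennreal (\<bar>\<xi>\<bar> powr k * (cmod (F 0 \<xi>))\<^sup>2) \<partial>lborel) \<le> ennreal A" "0 \<le> A"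
    and T: "0 \<le> T"
  shows "(\<integral>\<^sup>+y. indicator {y. R \<le> \<bar>y\<bar>} y * ennreal (\<bar>y\<bar> powr k * (cmod (F T (dil T * y)))\<^sup>2) \<partial>lborel)
    \<le> ennreal (2 * A + 2 * R powr (k + 1))"
proof -
  define f where "f \<xi> = ennreal (\<bar>\<xi>\<bar> powr k * (cmod (F T \<xi>))\<^sup>2)" for \<xi>
  define K where "K = (2 * A / R powr (k + 1) + 2) * (R * dil T) powr (k + 1)"
  have [measurable]: "F T \<in> borel_measurable borel"
    using continuous_F[OF T] by (rule borel_measurable_continuous_onI)
  have [measurable]: "f \<in> borel_measurable borel" unfolding f_def by measurable
  let ?J = "\<lambda>\<Lambda>. {\<xi>. R * dil T \<le> \<bar>\<xi>\<bar> \<and> \<bar>\<xi>\<bar> \<le> \<Lambda>}"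
  have "(\<integral>\<^sup>+\<xi>. indicator {\<xi>. R * dil T \<le> \<bar>\<xi>\<bar>} \<xi> * f \<xi> \<partial>lborel) = (\<integral>\<^sup>+\<xi>. liminf (\<lambda>n. indicator (?J (real n)) \<xi> * f \<xi>) \<partial>lborel)"
  proof (intro nn_integral_cong lim_imp_Liminf[symmetric] tendsto_eventually)
    fix \<xi> :: real
    obtain N where N: "\<bar>\<xi>\<bar> \<le> real N" using real_arch_simple by blast
    show "eventually (\<lambda>n. indicator (?J (real n)) \<xi> * f \<xi> = indicator {\<xi>. R * dil T \<le> \<bar>\<xi>\<bar>} \<xi> * f \<xi>) sequentially"
      using eventually_ge_at_top[of N]
    proof eventually_elim
      case (elim n)
      then have "\<bar>\<xi>\<bar> \<le> real n" using N by linarith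
      then show ?case by (simp add: indicator_def)
    qed
  qed simp
  also have "\<dots> \<le> liminf (\<lambda>n. \<integral>\<^sup>+\<xi>. indicator (?J (real n)) \<xi> * f \<xi> \<partial>lborel)"
    by (rule nn_integral_liminf) measurable
  also have "\<dots> \<le> liminf (\<lambda>n::nat. ennreal K)"
    unfolding f_def K_def by (intro Liminf_mono always_eventually allI weighted_L2_truncated[OF b R k small A T]) simp
  also have "\<dots> = ennreal K" by (simp add: Liminf_const)
  finally have le: "(\<integral>\<^sup>+\<xi>. indicator {\<xi>. R * dil T \<le> \<bar>\<xi>\<bar>} \<xi> * f \<xi> \<partial>lborel) \<le> ennreal K" .
  have g: "indicator {\<xi>. R * dil T \<le> \<bar>\<xi>\<bar>} (0 + dil T * y) * f (0 + dil T * y) = ennreal (dil T powr k) * (indicator {y. R \<le> \<bar>y\<bar>} y * ennreal (\<bar>y\<bar> powr k * (cmod (F T (dil T * y)))\<^sup>2))" for y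
    by (auto simp: f_def indicator_def abs_mult powr_mult mult_ac simp flip: ennreal_mult)
  let ?I = "\<integral>\<^sup>+y. indicator {y. R \<le> \<bar>y\<bar>} y * ennreal (\<bar>y\<bar> powr k * (cmod (F T (dil T * y)))\<^sup>2) \<partial>lborel"
  have "ennreal (dil T powr (k + 1)) * ?I = ennreal (dil T) * (ennreal (dil T powr k) * ?I)"
    by (simp add: powr_add ennreal_mult mult_ac)
  also have "\<dots> = (\<integral>\<^sup>+\<xi>. indicator {\<xi>. R * dil T \<le> \<bar>\<xi>\<bar>} \<xi> * f \<xi> \<partial>lborel)"
    by (subst nn_integral_real_affine[where c="dil T" and t=0]) (simp_all only: g, simp_all add: nn_integral_cmult)
  also have "\<dots> \<le> ennreal K" by (rule le)
  also have "K = dil T powr (k + 1) * (2 * A + 2 * R powr (k + 1))"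
    using R by (simp add: K_def powr_mult field_simps)
  finally have "ennreal (dil T powr (k + 1)) * ?I \<le> ennreal (dil T powr (k + 1)) * ennreal (2 * A + 2 * R powr (k + 1))"
    by (simp add: ennreal_mult')
  then show ?thesis by (subst (asm) ennreal_mult_le_mult_iff) auto
qed

end

section \<open>A local Plancherel inequality\<close>

abbreviation "gauss \<equiv> std_normal_distribution"

lemma sets_gauss_lborel: "sets (gauss \<Otimes>\<^sub>M lborel) = sets (borel \<Otimes>\<^sub>M borel)"
  by (intro sets_pair_measure_cong) simp_all

lemma borel_measurable_cnj [measurable]: "cnj \<in> borel_measurable borel"
  by (intro borel_measurable_continuous_onI continuous_intros)

lemma fourier_gauss_fubini:
  fixes \<phi> :: "real \<Rightarrow> complex"
  assumes [measurable]: "\<phi> \<in> borel_measurable borel" and C: "\<And>z. cmod (\<phi> z) \<le> C" and a: "integrable lborel a"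
  shows "(LINT z|gauss. \<phi> z * fourier a (s * z)) = (LINT x|lborel. complex_of_real (a x) * (LINT z|gauss. \<phi> z * exp (- (\<i> * complex_of_real (s * z * x)))))"
proof -
  interpret N: real_distribution gauss by (rule real_dist_normal_dist)
  interpret P: pair_sigma_finite gauss lborel by unfold_locales
  have [measurable]: "a \<in> borel_measurable borel" using borel_measurable_integrable[OF a] by simp
  define f where "f z x = \<phi> z * (complex_of_real (a x) * exp (- (\<i> * complex_of_real (s * z * x))))" for z x
  have nf: "norm (f z x) = cmod (\<phi> z) * \<bar>a x\<bar>" for z x by (simp add: f_def norm_mult)
  have "integrable (gauss \<Otimes>\<^sub>M lborel) (case_prod f)"
  proof (rule P.Fubini_integrable)
    show "case_prod f \<in> borel_measurable (gauss \<Otimes>\<^sub>M lborel)"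
      unfolding measurable_cong_sets[OF sets_gauss_lborel refl] f_def by measurable
    show "integrable gauss (\<lambda>z. LINT x|lborel. norm (case (z, x) of (z, x) \<Rightarrow> f z x))"
      unfolding case_prod_conv nf integral_mult_right_zero
      by (rule N.integrable_const_bound[of _ "C * L1_norm a"])
        (auto simp: L1_norm_def abs_mult C intro!: mult_mono order_trans[OF norm_ge_zero C])
    have "integrable lborel (f z)" for z
      unfolding f_def by (intro integrable_mult_right integrable_fourier_kernel a)
    then show "AE z in gauss. integrable lborel (\<lambda>x. case (z, x) of (z, x) \<Rightarrow> f z x)" by simp
  qed
  from P.Fubini_integral[OF this]
  have "(LINT x|lborel. LINT z|gauss. f z x) = (LINT z|gauss. LINT x|lborel. f z x)" .
  moreover have "(LINT x|lborel. f z x) = \<phi> z * fourier a (s * z)" for z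
    by (simp add: f_def fourier_def)
  moreover have "(LINT z|gauss. f z x) = complex_of_real (a x) * (LINT z|gauss. \<phi> z * exp (- (\<i> * complex_of_real (s * z * x))))" for x
    by (simp add: f_def mult.left_commute[of "\<phi> _"])
  ultimately show ?thesis by simp
qed

text \<open>Parseval's identity with a Gaussian weight in frequency, which becomes a Gaussian kernel in velocity.
For merely integrable functions the weight is what makes both sides converge.\<close>

lemma gaussian_pairing:
  assumes a: "integrable lborel a" and b: "integrable lborel b"
  shows "(LINT z|gauss. cnj (fourier b (s * z)) * fourier a (s * z))
    = complex_of_real (LINT x|lborel. a x * (LINT y|lborel. b y * exp (- (s * (x - y))\<^sup>2 / 2)))"
proof -
  have [measurable]: "fourier b \<in> borel_measurable borel" by (intro fourier_measurable b)
  have inner: "(LINT z|gauss. cnj (fourier b (s * z)) * exp (- (\<i> * complex_of_real (s * z * x))))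
    = complex_of_real (LINT y|lborel. b y * exp (- (s * (x - y))\<^sup>2 / 2))" for x
  proof -
    have ch: "(LINT z|gauss. exp (\<i> * complex_of_real (s * z * x)) * exp (- (\<i> * complex_of_real (s * z * y)))) = char gauss (s * (x - y))" for y
      unfolding char_def by (intro Bochner_Integration.integral_cong refl) (simp add: algebra_simps flip: exp_add)
    have "(LINT z|gauss. exp (\<i> * complex_of_real (s * z * x)) * fourier b (s * z))
      = (LINT y|lborel. complex_of_real (b y) * (LINT z|gauss. exp (\<i> * complex_of_real (s * z * x)) * exp (- (\<i> * complex_of_real (s * z * y)))))"
      by (rule fourier_gauss_fubini[OF _ _ b, where C=1]) (auto simp del: of_real_mult)
    also have "\<dots> = complex_of_real (LINT y|lborel. b y * exp (- (s * (x - y))\<^sup>2 / 2))"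
      unfolding ch char_std_normal_distribution of_real_mult[symmetric] by (rule integral_complex_of_real)
    finally have cnj_eq: "cnj (LINT z|gauss. exp (\<i> * complex_of_real (s * z * x)) * fourier b (s * z)) = complex_of_real (LINT y|lborel. b y * exp (- (s * (x - y))\<^sup>2 / 2))"
      by simp
    have k: "cnj (exp (\<i> * complex_of_real (s * z * x)) * fourier b (s * z)) = cnj (fourier b (s * z)) * exp (- (\<i> * complex_of_real (s * z * x)))" for z
      by (simp add: exp_cnj)
    have "(LINT z|gauss. cnj (fourier b (s * z)) * exp (- (\<i> * complex_of_real (s * z * x)))) = (LINT z|gauss. cnj (exp (\<i> * complex_of_real (s * z * x)) * fourier b (s * z)))"
      by (simp only: k)
    also have "\<dots> = cnj (LINT z|gauss. exp (\<i> * complex_of_real (s * z * x)) * fourier b (s * z))"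
      by (rule Bochner_Integration.integral_cnj)
    finally show ?thesis using cnj_eq by (rule trans)
  qed
  have "(LINT z|gauss. cnj (fourier b (s * z)) * fourier a (s * z)) = (LINT x|lborel. complex_of_real (a x) * (LINT z|gauss. cnj (fourier b (s * z)) * exp (- (\<i> * complex_of_real (s * z * x)))))"
    by (rule fourier_gauss_fubini[OF _ _ a, where C="L1_norm b"]) (auto simp: norm_fourier_le)
  also have "\<dots> = complex_of_real (LINT x|lborel. a x * (LINT y|lborel. b y * exp (- (s * (x - y))\<^sup>2 / 2)))"
    unfolding inner of_real_mult[symmetric] by (rule integral_complex_of_real)
  finally show ?thesis .
qed

text \<open>Convolution with the centred Gaussian density of standard deviation \<open>1 / s\<close>.\<close>

definition mollify :: "real \<Rightarrow> (real \<Rightarrow> real) \<Rightarrow> real \<Rightarrow> real" where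
  "mollify s h x = s / sqrt (2 * pi) * (LINT y|lborel. h y * exp (- (s * (x - y))\<^sup>2 / 2))"

lemma mollify_eq:
  assumes "0 < s" and [measurable]: "h \<in> borel_measurable borel"
  shows "mollify s h x = (LINT z|gauss. h (x + z / s))"
proof -
  have "(LINT y|lborel. h y * exp (- (s * (x - y))\<^sup>2 / 2)) = \<bar>1 / s\<bar> *\<^sub>R (LINT z|lborel. h (x + 1 / s * z) * exp (- (s * (x - (x + 1 / s * z)))\<^sup>2 / 2))"
    by (rule lborel_integral_real_affine) (use assms in auto)
  also have "\<dots> = 1 / s * (LINT z|lborel. h (x + z / s) * exp (- z\<^sup>2 / 2))" using assms by simp
  finally have "mollify s h x = 1 / sqrt (2 * pi) * (LINT z|lborel. h (x + z / s) * exp (- z\<^sup>2 / 2))"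
    using assms by (simp add: mollify_def)
  also have "\<dots> = (LINT z|lborel. std_normal_density z *\<^sub>R h (x + z / s))"
    by (simp add: std_normal_density_def mult_ac flip: integral_mult_right_zero)
  also have "\<dots> = (LINT z|gauss. h (x + z / s))" by (rule integral_density[symmetric]) auto
  finally show ?thesis .
qed

lemma abs_mollify_le_1:
  assumes "0 < s" and [measurable]: "h \<in> borel_measurable borel" and h: "\<And>x. \<bar>h x\<bar> \<le> 1"
  shows "\<bar>mollify s h x\<bar> \<le> 1"
proof -
  interpret N: real_distribution gauss by (rule real_dist_normal_dist)
  have "norm (LINT z|gauss. h (x + z / s)) \<le> (LINT z|gauss. 1)"
    by (rule norm_integral_le_AE) (auto simp: h intro!: N.integrable_const_bound[of _ 1])
  then show ?thesis using assms N.prob_space by (simp add: mollify_eq)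
qed

lemma mollify_tendsto:
  assumes [measurable]: "h \<in> borel_measurable borel" and h: "\<And>x. \<bar>h x\<bar> \<le> 1" and "isCont h x"
  shows "(\<lambda>n. mollify (real (Suc n)) h x) \<longlonglongrightarrow> h x"
proof -
  interpret N: real_distribution gauss by (rule real_dist_normal_dist)
  have "(\<lambda>n. LINT z|gauss. h (x + z / real (Suc n))) \<longlonglongrightarrow> (LINT z|gauss. h x)"
  proof (rule integral_dominated_convergence[where w="\<lambda>_. 1"])
    show "AE z in gauss. (\<lambda>n. h (x + z / real (Suc n))) \<longlonglongrightarrow> h x"
    proof (rule AE_I2)
      fix z :: real
      have "(\<lambda>n. x + z * inverse (real (Suc n))) \<longlonglongrightarrow> x + z * 0"
        by (intro tendsto_intros LIMSEQ_inverse_real_of_nat)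
      then have "(\<lambda>n. x + z / real (Suc n)) \<longlonglongrightarrow> x" by (simp add: divide_inverse)
      from isCont_tendsto_compose[OF assms(3) this] show "(\<lambda>n. h (x + z / real (Suc n))) \<longlonglongrightarrow> h x" .
    qed
  qed (auto simp: h)
  then show ?thesis using N.prob_space by (simp add: mollify_eq del: of_nat_Suc)
qed

lemma mollify_measurable:
  assumes "integrable lborel h"
  shows "mollify s h \<in> borel_measurable borel"
proof -
  have [measurable]: "h \<in> borel_measurable borel" using borel_measurable_integrable[OF assms] by simp
  show ?thesis unfolding mollify_def by measurable
qed

text \<open>By the pairing identity, the left-hand side is an integral of the transforms of \<open>w\<close> and \<open>h\<close> against a
Gaussian. The inequality \<open>X * Y \<le> \<mu> / 2 * X\<^sup>2 + Y\<^sup>2 / (2 * \<mu>)\<close> separates them: the first part is at most a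
multiple of \<open>A\<close>, and the second, read backwards through the pairing identity for \<open>h\<close> with itself, is at most
the integral of \<open>\<bar>h\<bar>\<close>.\<close>

lemma integral_mollify_le:
  assumes w: "integrable lborel w" and A: "(\<integral>\<^sup>+\<xi>. ennreal ((cmod (fourier w \<xi>))\<^sup>2) \<partial>lborel) \<le> ennreal A" "0 \<le> A"
    and [measurable]: "h \<in> borel_measurable borel" and h: "\<And>x. \<bar>h x\<bar> \<le> indicator {-R..R} x" and R: "0 \<le> R"
    and s: "0 < s" and \<mu>: "0 < \<mu>"
  shows "(LINT x|lborel. w x * mollify s h x) \<le> \<mu> * A / (4 * pi) + R / \<mu>"
proof -
  interpret N: real_distribution gauss by (rule real_dist_normal_dist)
  have h1: "\<bar>h x\<bar> \<le> 1" for x using h[of x] by (auto simp: indicator_def of_bool_def split: if_splits)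
  have iR: "integrable lborel (\<lambda>x. indicator {-R..R} x :: real)" using R by (simp add: integrable_indicator_iff)
  have ih: "integrable lborel h"
    by (rule Bochner_Integration.integrable_bound[OF iR]) (use h in auto)
  have [measurable]: "fourier w \<in> borel_measurable borel" "fourier h \<in> borel_measurable borel"
    by (intro fourier_measurable w ih)+
  define c where "c = s / sqrt (2 * pi)"
  have c: "0 < c" using s by (simp add: c_def)
  have pair: "c * (LINT x|lborel. a x * (LINT y|lborel. h y * exp (- (s * (x - y))\<^sup>2 / 2))) = (LINT x|lborel. a x * mollify s h x)" for a
    by (simp add: mollify_def c_def mult_ac flip: integral_mult_right_zero)
  have pw: "complex_of_real (LINT x|lborel. w x * mollify s h x) = c * (LINT z|gauss. cnj (fourier h (s * z)) * fourier w (s * z))"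
    unfolding gaussian_pairing[OF w ih] pair[symmetric] by simp
  have ph: "complex_of_real (LINT x|lborel. h x * mollify s h x) = c * (LINT z|gauss. cnj (fourier h (s * z)) * fourier h (s * z))"
    unfolding gaussian_pairing[OF ih ih] pair[symmetric] by simp
  have i: "integrable gauss (\<lambda>z. (cmod (fourier a (s * z)))\<^sup>2)" if [measurable]: "fourier a \<in> borel_measurable borel" for a
    by (rule N.integrable_const_bound[of _ "(L1_norm a)\<^sup>2"]) (auto intro!: power_mono norm_fourier_le)
  have "\<bar>LINT x|lborel. w x * mollify s h x\<bar> = cmod (complex_of_real (LINT x|lborel. w x * mollify s h x))"
    by (simp only: norm_of_real)
  also have "\<dots> = c * cmod (LINT z|gauss. cnj (fourier h (s * z)) * fourier w (s * z))"
    unfolding pw using c by (simp add: norm_mult)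
  finally have 0: "\<bar>LINT x|lborel. w x * mollify s h x\<bar> = c * cmod (LINT z|gauss. cnj (fourier h (s * z)) * fourier w (s * z))" .
  have "cmod (LINT z|gauss. cnj (fourier h (s * z)) * fourier w (s * z)) \<le> (LINT z|gauss. \<mu> / 2 * (cmod (fourier w (s * z)))\<^sup>2 + 1 / (2 * \<mu>) * (cmod (fourier h (s * z)))\<^sup>2)"
  proof (rule norm_integral_le_AE)
    show "integrable gauss (\<lambda>z. cnj (fourier h (s * z)) * fourier w (s * z))"
      by (rule N.integrable_const_bound[of _ "L1_norm h * L1_norm w"])
        (auto simp: norm_mult norm_fourier_le intro!: mult_mono order_trans[OF norm_ge_zero norm_fourier_le])
    show "AE z in gauss. cmod (cnj (fourier h (s * z)) * fourier w (s * z)) \<le> \<mu> / 2 * (cmod (fourier w (s * z)))\<^sup>2 + 1 / (2 * \<mu>) * (cmod (fourier h (s * z)))\<^sup>2"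
    proof (rule AE_I2)
      fix z
      define X Y where "X = cmod (fourier w (s * z))" and "Y = cmod (fourier h (s * z))"
      have "0 \<le> (\<mu> * X - Y)\<^sup>2 / (2 * \<mu>)" using \<mu> by simp
      also have "\<dots> = \<mu> / 2 * X\<^sup>2 + 1 / (2 * \<mu>) * Y\<^sup>2 - Y * X"
        using \<mu> by (simp add: power2_eq_square field_simps)
      finally show "cmod (cnj (fourier h (s * z)) * fourier w (s * z)) \<le> \<mu> / 2 * (cmod (fourier w (s * z)))\<^sup>2 + 1 / (2 * \<mu>) * (cmod (fourier h (s * z)))\<^sup>2"
        by (simp add: norm_mult X_def Y_def)
    qed
  qed (intro Bochner_Integration.integrable_add integrable_mult_right i; measurable)
  also have "\<dots> = \<mu> / 2 * (LINT z|gauss. (cmod (fourier w (s * z)))\<^sup>2) + 1 / (2 * \<mu>) * (LINT z|gauss. (cmod (fourier h (s * z)))\<^sup>2)"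
    by (subst Bochner_Integration.integral_add; (intro integrable_mult_right i, measurable)?) simp
  finally have "cmod (LINT z|gauss. cnj (fourier h (s * z)) * fourier w (s * z)) \<le> \<mu> / 2 * (LINT z|gauss. (cmod (fourier w (s * z)))\<^sup>2) + 1 / (2 * \<mu>) * (LINT z|gauss. (cmod (fourier h (s * z)))\<^sup>2)" .
  from mult_left_mono[OF this, of c]
  have 1: "\<bar>LINT x|lborel. w x * mollify s h x\<bar> \<le> c * (\<mu> / 2 * (LINT z|gauss. (cmod (fourier w (s * z)))\<^sup>2) + 1 / (2 * \<mu>) * (LINT z|gauss. (cmod (fourier h (s * z)))\<^sup>2))"
    unfolding 0 using c by simp
  have 2: "c * (LINT z|gauss. (cmod (fourier h (s * z)))\<^sup>2) \<le> 2 * R"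
  proof -
    have "complex_of_real (LINT z|gauss. (cmod (fourier h (s * z)))\<^sup>2) = (LINT z|gauss. cnj (fourier h (s * z)) * fourier h (s * z))"
      unfolding integral_complex_of_real[symmetric] complex_norm_square by (simp only: mult.commute)
    with ph have "complex_of_real (LINT x|lborel. h x * mollify s h x) = complex_of_real (c * (LINT z|gauss. (cmod (fourier h (s * z)))\<^sup>2))" by simp
    then have "c * (LINT z|gauss. (cmod (fourier h (s * z)))\<^sup>2) = (LINT x|lborel. h x * mollify s h x)" by (simp only: of_real_eq_iff)
    also have "\<dots> \<le> (LINT x|lborel. indicator {-R..R} x)"
    proof (rule order_trans[OF abs_ge_self], unfold real_norm_def[symmetric], rule norm_integral_le_AE)
      have hm: "\<bar>h x * mollify s h x\<bar> \<le> indicator {-R..R} x * 1" for x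
        unfolding abs_mult by (intro mult_mono h abs_mollify_le_1 s h1) auto
      then show "AE x in lborel. norm (h x * mollify s h x) \<le> indicator {-R..R} x" by simp
      have [measurable]: "mollify s h \<in> borel_measurable borel" by (intro mollify_measurable ih)
      show "integrable lborel (\<lambda>x. h x * mollify s h x)"
        by (rule Bochner_Integration.integrable_bound[OF iR]) (use hm in auto)
    qed (rule iR)
    also have "\<dots> = 2 * R" using R by simp
    finally show ?thesis .
  qed
  have 3: "c * (LINT z|gauss. (cmod (fourier w (s * z)))\<^sup>2) \<le> A / (2 * pi)"
  proof -
    have "ennreal (LINT z|gauss. (cmod (fourier w (s * z)))\<^sup>2) = (\<integral>\<^sup>+z. ennreal ((cmod (fourier w (s * z)))\<^sup>2) \<partial>gauss)"
      by (rule nn_integral_eq_integral[symmetric]) (auto intro!: i)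
    also have "\<dots> = (\<integral>\<^sup>+z. ennreal (std_normal_density z) * ennreal ((cmod (fourier w (s * z)))\<^sup>2) \<partial>lborel)"
      by (rule nn_integral_density) auto
    also have "\<dots> \<le> (\<integral>\<^sup>+z. ennreal (1 / sqrt (2 * pi)) * ennreal ((cmod (fourier w (0 + s * z)))\<^sup>2) \<partial>lborel)"
    proof (rule nn_integral_mono)
      fix z
      have "std_normal_density z \<le> 1 / sqrt (2 * pi)" by (simp add: std_normal_density_def divide_right_mono)
      then show "ennreal (std_normal_density z) * ennreal ((cmod (fourier w (s * z)))\<^sup>2) \<le> ennreal (1 / sqrt (2 * pi)) * ennreal ((cmod (fourier w (0 + s * z)))\<^sup>2)"
        unfolding add_0 by (rule mult_right_mono[OF ennreal_leI]) simp
    qed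
    also have "\<dots> = ennreal (1 / sqrt (2 * pi)) * (\<integral>\<^sup>+z. ennreal ((cmod (fourier w (0 + s * z)))\<^sup>2) \<partial>lborel)"
      by (rule nn_integral_cmult) measurable
    finally have *: "ennreal (LINT z|gauss. (cmod (fourier w (s * z)))\<^sup>2) \<le> ennreal (1 / sqrt (2 * pi)) * (\<integral>\<^sup>+z. ennreal ((cmod (fourier w (0 + s * z)))\<^sup>2) \<partial>lborel)" .
    have "ennreal (s * (LINT z|gauss. (cmod (fourier w (s * z)))\<^sup>2)) = ennreal s * ennreal (LINT z|gauss. (cmod (fourier w (s * z)))\<^sup>2)"
      using s by (simp add: ennreal_mult')
    also have "\<dots> \<le> ennreal s * (ennreal (1 / sqrt (2 * pi)) * (\<integral>\<^sup>+z. ennreal ((cmod (fourier w (0 + s * z)))\<^sup>2) \<partial>lborel))"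
      by (intro mult_left_mono *) auto
    also have "\<dots> = ennreal (1 / sqrt (2 * pi)) * (\<integral>\<^sup>+\<xi>. ennreal ((cmod (fourier w \<xi>))\<^sup>2) \<partial>lborel)"
      using s by (subst nn_integral_real_affine[of "\<lambda>\<xi>. ennreal ((cmod (fourier w \<xi>))\<^sup>2)" s 0]) (auto simp: mult.left_commute)
    also have "\<dots> \<le> ennreal (1 / sqrt (2 * pi)) * ennreal A" by (intro mult_left_mono A) auto
    also have "\<dots> = ennreal (1 / sqrt (2 * pi) * A)" using A by (simp flip: ennreal_mult)
    finally have "s * (LINT z|gauss. (cmod (fourier w (s * z)))\<^sup>2) \<le> 1 / sqrt (2 * pi) * A"
      using A by (subst (asm) ennreal_le_iff) auto
    then have "1 / sqrt (2 * pi) * (s * (LINT z|gauss. (cmod (fourier w (s * z)))\<^sup>2)) \<le> 1 / sqrt (2 * pi) * (1 / sqrt (2 * pi) * A)"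
      by (intro mult_left_mono) auto
    also have "\<dots> = A / (2 * pi)" by (simp add: field_simps)
    finally show ?thesis by (simp add: c_def)
  qed
  have "c * (\<mu> / 2 * (LINT z|gauss. (cmod (fourier w (s * z)))\<^sup>2) + 1 / (2 * \<mu>) * (LINT z|gauss. (cmod (fourier h (s * z)))\<^sup>2))
    = \<mu> / 2 * (c * (LINT z|gauss. (cmod (fourier w (s * z)))\<^sup>2)) + 1 / (2 * \<mu>) * (c * (LINT z|gauss. (cmod (fourier h (s * z)))\<^sup>2))"
    by (simp add: algebra_simps)
  also have "\<dots> \<le> \<mu> / 2 * (A / (2 * pi)) + 1 / (2 * \<mu>) * (2 * R)"
    using \<mu> by (intro add_mono mult_left_mono 2 3) auto
  finally show ?thesis using 1 by (simp add: mult.commute)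
qed

text \<open>The mollifications of the truncated \<open>g\<close> converge to it at each of its points of continuity, hence
everywhere except possibly at \<open>R\<close> and \<open>- R\<close>.\<close>

lemma integral_test_function_le:
  assumes w: "integrable lborel w" and A: "(\<integral>\<^sup>+\<xi>. ennreal ((cmod (fourier w \<xi>))\<^sup>2) \<partial>lborel) \<le> ennreal A" "0 \<le> A"
    and g: "continuous_on UNIV g" "\<And>x. \<bar>g x\<bar> \<le> 1" and R: "0 \<le> R" and \<mu>: "0 < \<mu>"
  shows "(LINT x|lborel. w x * (indicator {-R..R} x * g x)) \<le> \<mu> * A / (4 * pi) + R / \<mu>"
proof -
  have [measurable]: "w \<in> borel_measurable borel" using borel_measurable_integrable[OF w] by simp
  have [measurable]: "g \<in> borel_measurable borel" using g(1) by (rule borel_measurable_continuous_onI)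
  define h where "h x = indicator {-R..R} x * g x" for x
  have [measurable]: "h \<in> borel_measurable borel" unfolding h_def by measurable
  have hR: "\<bar>h x\<bar> \<le> indicator {-R..R} x" for x using g(2) by (simp add: h_def indicator_def)
  have h1: "\<bar>h x\<bar> \<le> 1" for x using hR[of x] by (auto simp: indicator_def of_bool_def split: if_splits)
  have "integrable lborel (\<lambda>x. indicator {-R..R} x :: real)" using R by (simp add: integrable_indicator_iff)
  then have ih: "integrable lborel h"
    by (rule Bochner_Integration.integrable_bound) (use hR in auto)
  have [measurable]: "mollify s h \<in> borel_measurable borel" for s by (intro mollify_measurable ih)
  have cont: "isCont h x" if "x \<noteq> R" "x \<noteq> - R" for x
  proof -
    have gx: "isCont g x" using g(1) by (simp add: continuous_on_eq_continuous_at)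
    have "x \<in> {-R<..<R} \<or> x \<in> - {-R..R}" using that by auto
    then show ?thesis
    proof
      assume "x \<in> {-R<..<R}"
      then have "eventually (\<lambda>y. y \<in> {-R<..<R}) (nhds x)" by (intro eventually_nhds_in_open) auto
      then have "eventually (\<lambda>y. h y = g y) (nhds x)" by eventually_elim (auto simp: h_def)
      then show ?thesis using gx by (simp add: isCont_cong)
    next
      assume "x \<in> - {-R..R}"
      then have "eventually (\<lambda>y. y \<in> - {-R..R}) (nhds x)" by (intro eventually_nhds_in_open) auto
      then have "eventually (\<lambda>y. h y = 0) (nhds x)" by eventually_elim (auto simp: h_def)
      then show ?thesis by (simp add: isCont_cong)
    qed
  qed
  have ae: "AE x in lborel. x \<noteq> R \<and> x \<noteq> - R"
    using AE_lborel_singleton[of R] AE_lborel_singleton[of "-R"] by eventually_elim auto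
  have "(\<lambda>n. LINT x|lborel. w x * mollify (real (Suc n)) h x) \<longlonglongrightarrow> (LINT x|lborel. w x * h x)"
  proof (rule integral_dominated_convergence[where w="\<lambda>x. \<bar>w x\<bar>"])
    show "AE x in lborel. (\<lambda>n. w x * mollify (real (Suc n)) h x) \<longlonglongrightarrow> w x * h x"
      using ae by eventually_elim (intro tendsto_mult_left mollify_tendsto cont h1, auto)
    show "AE x in lborel. norm (w x * mollify (real (Suc n)) h x) \<le> \<bar>w x\<bar>" for n
      using abs_mollify_le_1[OF _ _ h1] by (auto simp: abs_mult intro!: mult_left_le simp del: of_nat_Suc)
  qed (use w in auto)
  then have "(LINT x|lborel. w x * h x) \<le> \<mu> * A / (4 * pi) + R / \<mu>"
    by (rule LIMSEQ_le_const2) (use integral_mollify_le[OF w A _ hR R _ \<mu>] in \<open>auto simp del: of_nat_Suc\<close>)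
  then show ?thesis by (simp add: h_def)
qed

text \<open>The local form of Plancherel's inequality combined with the Cauchy--Schwarz inequality, where the
parameter \<open>\<mu>\<close> replaces the product of the two norms. It follows by testing against continuous
approximations of the sign of \<open>w\<close>.\<close>

lemma local_L1_le:
  assumes w: "integrable lborel w" and A: "(\<integral>\<^sup>+\<xi>. ennreal ((cmod (fourier w \<xi>))\<^sup>2) \<partial>lborel) \<le> ennreal A" "0 \<le> A"
    and R: "0 \<le> R" and \<mu>: "0 < \<mu>"
  shows "(LINT x|lborel. indicator {-R..R} x * \<bar>w x\<bar>) \<le> \<mu> * A / (4 * pi) + R / \<mu>"
proof -
  have [measurable]: "w \<in> borel_measurable borel" using borel_measurable_integrable[OF w] by simp
  have "(\<lambda>x. sgn (w x)) \<in> borel_measurable lebesgue" by (intro measurable_completion) simp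
  then have "(\<lambda>x. sgn (w x)) measurable_on UNIV" by (intro lebesgue_measurable_imp_measurable_on) auto
  then obtain N g where N: "negligible N" and g: "\<And>n. continuous_on UNIV (g n)"
    and lim: "\<And>x. x \<notin> N \<Longrightarrow> (\<lambda>n. g n x) \<longlonglongrightarrow> sgn (w x)"
    unfolding measurable_on_def by auto
  define h where "h n x = max (-1) (min 1 (g n x))" for n x
  have hc: "continuous_on UNIV (h n)" for n unfolding h_def by (intro continuous_intros g)
  have [measurable]: "h n \<in> borel_measurable borel" for n using hc by (rule borel_measurable_continuous_onI)
  have h1: "\<bar>h n x\<bar> \<le> 1" for n x by (auto simp: h_def)
  have ae: "AE x in lborel. x \<notin> N"
    using N AE_not_in[of N lebesgue] by (simp add: negligible_iff_null_sets AE_completion_iff)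
  have "(\<lambda>n. LINT x|lborel. w x * (indicator {-R..R} x * h n x)) \<longlonglongrightarrow> (LINT x|lborel. indicator {-R..R} x * \<bar>w x\<bar>)"
  proof (rule integral_dominated_convergence[where w="\<lambda>x. \<bar>w x\<bar>"])
    show "AE x in lborel. (\<lambda>n. w x * (indicator {-R..R} x * h n x)) \<longlonglongrightarrow> indicator {-R..R} x * \<bar>w x\<bar>"
      using ae
    proof eventually_elim
      case (elim x)
      have "(\<lambda>n. h n x) \<longlonglongrightarrow> max (-1) (min 1 (sgn (w x)))"
        unfolding h_def by (intro tendsto_intros lim elim)
      moreover have "max (-1) (min 1 (sgn (w x))) = sgn (w x)" by (auto simp: sgn_if)
      ultimately have "(\<lambda>n. w x * (indicator {-R..R} x * h n x)) \<longlonglongrightarrow> w x * (indicator {-R..R} x * sgn (w x))"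
        by (intro tendsto_mult_left) simp
      then show ?case by (simp add: mult.left_commute[of "w x"] abs_sgn)
    qed
    show "AE x in lborel. norm (w x * (indicator {-R..R} x * h n x)) \<le> \<bar>w x\<bar>" for n
      using h1 by (auto simp: abs_mult indicator_def intro!: mult_left_le)
  qed (use w in auto)
  then show ?thesis
    by (rule LIMSEQ_le_const2) (use integral_test_function_le[OF w A hc h1 R \<mu>] in auto)
qed

section \<open>The solution and the profile as flows\<close>

text \<open>At frequency 0 the equation reads \<open>m' = m\<^sup>2 - m\<close> for the mass \<open>m\<close>; since \<open>m\<close> is locally bounded, the
constant solution 1 is the only one that starts at 1.\<close>

lemma solution_mass:
  assumes sol: "is_solution p q f0 f" and f0: "has_bochner_integral lborel f0 1" and t: "0 \<le> t"
  shows "has_bochner_integral lborel (f t) 1"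
proof -
  have int_f: "integrable lborel (f s)" if "0 \<le> s" for s using sol that by (auto simp: is_solution_def C1_L1_def)
  define m where "m s = integral\<^sup>L lborel (f s)" for s
  have four0: "fourier h 0 = complex_of_real (integral\<^sup>L lborel h)" for h
    by (simp add: fourier_def)
  have "fourier (f 0) 0 = fourier f0 0" using sol by (simp add: is_solution_def)
  then have m0: "m 0 = 1" using f0 by (simp add: four0 m_def has_bochner_integral_iff)
  have dm: "(m has_vector_derivative m s * m s - m s) (at s within {0..})" if s: "0 \<le> s" for s
  proof -
    have "((\<lambda>s. complex_of_real (m s)) has_vector_derivative complex_of_real (m s * m s - m s)) (at s within {0..})"
    proof -
      have "((\<lambda>s. fourier (f s) 0) has_vector_derivative fourier (f s) (p * 0) * fourier (f s) (q * 0) - fourier (f s) 0) (at s within {0..})"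
        using sol s unfolding is_solution_def by blast
      then show ?thesis by (simp add: four0 m_def)
    qed
    from bounded_linear.has_vector_derivative[OF bounded_linear_Re this] show ?thesis by simp
  qed
  have cm: "continuous_on {0..t} m"
    by (rule continuous_on_subset[OF continuous_on_vector_derivative[of "{0..}"]]) (use dm in auto)
  obtain K where "\<forall>s\<in>{0..t}. \<bar>m s\<bar> \<le> K"
    using compact_imp_bounded[OF compact_continuous_image[OF cm compact_Icc]] by (auto simp: bounded_iff)
  then have K: "m s \<le> K" if "s \<in> {0..t}" for s using that by (auto simp: abs_le_iff)
  define \<psi> where "\<psi> s = (m s - 1)\<^sup>2 * exp (- (2 * K * s))" for s
  have "\<psi> t \<le> \<psi> 0"
  proof (rule DERIV_nonpos_imp_decreasing_open[where f=\<psi> and a=0 and b=t])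
    show "continuous_on {0..t} \<psi>" unfolding \<psi>_def by (intro continuous_intros cm)
    fix s assume s: "0 < s" "s < t"
    have d: "(m has_real_derivative m s * m s - m s) (at s)"
      using has_vector_derivative_within_ge_0[OF s(1) dm] s by (simp add: has_real_derivative_iff_has_vector_derivative)
    have "(\<psi> has_real_derivative 2 * (m s - 1)\<^sup>2 * (m s - K) * exp (- (2 * K * s))) (at s)"
      unfolding \<psi>_def by (auto intro!: derivative_eq_intros d simp: power2_eq_square algebra_simps)
    moreover have "2 * (m s - 1)\<^sup>2 * (m s - K) * exp (- (2 * K * s)) \<le> 0"
      using K[of s] s by (intro mult_nonpos_nonneg mult_nonneg_nonpos) auto
    ultimately show "\<exists>y. (\<psi> has_real_derivative y) (at s) \<and> y \<le> 0" by blast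
  qed (use t in auto)
  then have "(m t - 1)\<^sup>2 * exp (- (2 * K * t)) \<le> 0" by (simp add: \<psi>_def m0)
  then have "m t = 1" by (simp add: mult_le_0_iff)
  then show ?thesis using int_f[OF t] by (simp add: m_def has_bochner_integral_iff)
qed

lemma norm_fourier_density_le_1:
  assumes "AE v in lborel. h v \<ge> 0" "has_bochner_integral lborel h 1"
  shows "cmod (fourier h \<xi>) \<le> 1"
proof -
  have [measurable]: "h \<in> borel_measurable borel" using assms(2) by (auto simp: has_bochner_integral_iff dest: borel_measurable_integrable)
  have "L1_norm h = integral\<^sup>L lborel h" unfolding L1_norm_def
    by (intro integral_cong_AE) (use assms(1) in auto)
  then show ?thesis using norm_fourier_le[of h \<xi>] assms(2) by (simp add: has_bochner_integral_iff)
qed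

lemma wild_flow_solution:
  assumes pq: "0 < q" "q \<le> p" "p\<^sup>2 + q\<^sup>2 < 1" 
    and sol: "is_solution p q f0 f" and f0: "has_bochner_integral lborel f0 1"
  shows "wild_flow p q (\<lambda>t. fourier (f t))"
proof
  show "cmod (fourier (f t) \<xi>) \<le> 1" if "0 \<le> t" for t \<xi>
    using that sol by (intro norm_fourier_density_le_1 solution_mass[OF sol f0]) (auto simp: is_solution_def)
  show "continuous_on UNIV (fourier (f t))" if "0 \<le> t" for t
    using that sol by (intro continuous_on_fourier) (auto simp: is_solution_def C1_L1_def)
qed (use pq sol in \<open>auto simp: is_solution_def\<close>)

text \<open>In unscaled variables the profile equation is the evolution equation along the curve
\<open>exp (- c * t) * \<xi>\<close>.\<close>

lemma wild_flow_profile: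
  assumes pq: "0 < q" "q \<le> p" "p\<^sup>2 + q\<^sup>2 < 1" and prof: "is_stationary_profile p q d g"
  shows "wild_flow p q (\<lambda>t \<xi>. fourier g (exp (- (cooling_rate p q * t)) * \<xi>))"
proof
  have g: "AE v in lborel. g v \<ge> 0" "has_bochner_integral lborel g 1"
    using prof by (auto simp: is_stationary_profile_def)
  show "cmod (fourier g (exp (- (cooling_rate p q * t)) * \<xi>)) \<le> 1" for t \<xi>
    by (intro norm_fourier_density_le_1 g)
  have "continuous_on UNIV (fourier g)"
    using g(2) by (intro continuous_on_fourier) (auto simp: has_bochner_integral_iff)
  then show "continuous_on UNIV (\<lambda>\<xi>. fourier g (exp (- (cooling_rate p q * t)) * \<xi>))" for t
    by (rule continuous_on_compose2) (auto intro!: continuous_intros)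
  fix t \<xi> :: real
  let ?c = "cooling_rate p q"
  define y where "y = exp (- (?c * t)) * \<xi>"
  have 1: "((\<lambda>s. exp (- (?c * s)) * \<xi>) has_vector_derivative - ?c * y) (at t within {0..})"
    unfolding has_real_derivative_iff_has_vector_derivative[symmetric] y_def
    by (auto intro!: derivative_eq_intros)
  have 2: "(fourier g has_vector_derivative vector_derivative (fourier g) (at y)) (at y)"
    using prof by (simp add: is_stationary_profile_def vector_derivative_works[symmetric])
  have "(fourier g \<circ> (\<lambda>s. exp (- (?c * s)) * \<xi>) has_vector_derivative (- ?c * y) *\<^sub>R vector_derivative (fourier g) (at y)) (at t within {0..})"
    using 1 has_vector_derivative_at_within[OF 2] unfolding y_def by (rule vector_diff_chain_within)
  also have "(- ?c * y) *\<^sub>R vector_derivative (fourier g) (at y) = complex_of_real ((p\<^sup>2 + q\<^sup>2 - 1) / 2 * y) * vector_derivative (fourier g) (at y)"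
    by (simp add: cooling_rate_def scaleR_conv_of_real field_simps)
  also have "\<dots> = fourier g (p * y) * fourier g (q * y) - fourier g y"
    using prof unfolding is_stationary_profile_def by blast
  finally show "((\<lambda>s. fourier g (exp (- (?c * s)) * \<xi>)) has_vector_derivative
     fourier g (exp (- (?c * t)) * (p * \<xi>)) * fourier g (exp (- (?c * t)) * (q * \<xi>)) - fourier g (exp (- (?c * t)) * \<xi>)) (at t within {0..})"
    by (simp only: o_def y_def mult.left_commute[of p] mult.left_commute[of q])
qed (use pq in auto)

section \<open>Decay of the transform of the initial datum\<close>

text \<open>A Lipschitz function of modulus at least \<open>\<epsilon>\<close> at \<open>\<xi>\<close> stays above \<open>\<epsilon> / 2\<close> on an interval whose length does
not depend on \<open>\<xi>\<close>; far out, the weight makes the integral over this interval exceed \<open>A\<close>.\<close>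

lemma lipschitz_weighted_L2_vanishes_at_infinity:
  fixes h :: "real \<Rightarrow> complex"
  assumes lip: "\<And>x y. cmod (h x - h y) \<le> L * \<bar>x - y\<bar>" and k: "0 < k"
    and A: "(\<integral>\<^sup>+\<xi>. ennreal (\<bar>\<xi>\<bar> powr k * (cmod (h \<xi>))\<^sup>2) \<partial>lborel) \<le> ennreal A" "0 \<le> A"
  shows "(h \<longlongrightarrow> 0) at_infinity"
proof (rule tendstoI)
  fix \<epsilon> :: real assume \<epsilon>: "0 < \<epsilon>"
  have L: "0 \<le> L" using order_trans[OF norm_ge_zero lip[of 1 0]] by simp
  define d where "d = min 1 (\<epsilon> / (2 * (L + 1)))"
  have d: "0 < d" "d \<le> 1" "L * d \<le> \<epsilon> / 2"
  proof -
    have "L * d \<le> L * (\<epsilon> / (2 * (L + 1)))" using L by (intro mult_left_mono) (auto simp: d_def)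
    also have "\<dots> \<le> \<epsilon> / 2" using L \<epsilon> by (simp add: field_simps)
    finally show "L * d \<le> \<epsilon> / 2" .
  qed (use L \<epsilon> in \<open>auto simp: d_def\<close>)
  \<comment> \<open>With weight \<open>Q\<close>, an interval of length \<open>2 * d\<close> on which \<open>\<epsilon> / 2 \<le> cmod (h y)\<close> contributes more than \<open>A\<close>.\<close>
  define Q where "Q = A / (2 * d * (\<epsilon> / 2)\<^sup>2) + 1"
  have Q: "0 < Q" "A < Q * (2 * d * (\<epsilon> / 2)\<^sup>2)" using A(2) d \<epsilon> by (auto simp: Q_def field_simps add_nonneg_pos)
  define R where "R = Q powr (1 / k)"
  have R: "0 < R" "R powr k = Q" using Q(1) k by (auto simp: R_def powr_powr)
  have "cmod (h \<xi>) < \<epsilon>" if \<xi>: "R + 1 \<le> \<bar>\<xi>\<bar>" for \<xi>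
  proof (rule ccontr)
    assume "\<not> cmod (h \<xi>) < \<epsilon>"
    then have big: "\<epsilon> \<le> cmod (h \<xi>)" by simp
    have "ennreal (Q * (2 * d * (\<epsilon> / 2)\<^sup>2)) = ennreal (Q * (\<epsilon> / 2)\<^sup>2) * emeasure lborel {\<xi> - d..\<xi> + d}"
      using d Q(1) by (simp add: mult_ac flip: ennreal_mult)
    also have "\<dots> = (\<integral>\<^sup>+y. ennreal (Q * (\<epsilon> / 2)\<^sup>2) * indicator {\<xi> - d..\<xi> + d} y \<partial>lborel)"
      by (subst nn_integral_cmult_indicator) auto
    also have "\<dots> \<le> (\<integral>\<^sup>+\<xi>. ennreal (\<bar>\<xi>\<bar> powr k * (cmod (h \<xi>))\<^sup>2) \<partial>lborel)"
    proof (rule nn_integral_mono)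
      fix y :: real
      have "Q * (\<epsilon> / 2)\<^sup>2 \<le> \<bar>y\<bar> powr k * (cmod (h y))\<^sup>2" if "y \<in> {\<xi> - d..\<xi> + d}"
      proof (rule mult_mono)
        have yx: "\<bar>\<xi> - y\<bar> \<le> d" using that by auto
        then have "R \<le> \<bar>y\<bar>" using \<xi> d(2) by linarith
        then show "Q \<le> \<bar>y\<bar> powr k" using R k unfolding R(2)[symmetric] by (intro powr_mono2) auto
        have "cmod (h \<xi> - h y) \<le> L * d" using lip[of \<xi> y] mult_left_mono[OF yx L] by linarith
        then have "\<epsilon> / 2 \<le> cmod (h y)" using big d(3) norm_triangle_sub[of "h \<xi>" "h y"] by linarith
        then show "(\<epsilon> / 2)\<^sup>2 \<le> (cmod (h y))\<^sup>2" using \<epsilon> by (intro power_mono) auto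
      qed auto
      then show "ennreal (Q * (\<epsilon> / 2)\<^sup>2) * indicator {\<xi> - d..\<xi> + d} y \<le> ennreal (\<bar>y\<bar> powr k * (cmod (h y))\<^sup>2)"
        by (auto simp: indicator_def intro!: ennreal_leI)
    qed
    also have "\<dots> \<le> ennreal A" by (rule A)
    finally show False using A(2) Q by (simp add: ennreal_le_iff)
  qed
  then show "eventually (\<lambda>\<xi>. dist (h \<xi>) 0 < \<epsilon>) at_infinity"
    unfolding eventually_at_infinity by (intro exI[of _ "R + 1"]) auto
qed

text \<open>Doubling any frequency of modulus at least \<open>\<rho>\<close> a fixed number \<open>n\<close> of times leads to the region where the
transform is at most 1/2; going back costs the factor \<open>4 ^ n\<close>.\<close>

lemma density_fourier_bounded_away_from_1:
  assumes h: "AE v in lborel. h v \<ge> 0" "has_bochner_integral lborel h 1"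
    and lim: "(fourier h \<longlongrightarrow> 0) at_infinity" and \<rho>: "0 < \<rho>"
  obtains \<theta> where "0 \<le> \<theta>" "\<theta> < 1" "\<And>\<xi>. \<rho> \<le> \<bar>\<xi>\<bar> \<Longrightarrow> cmod (fourier h \<xi>) \<le> \<theta>"
proof -
  have "eventually (\<lambda>\<xi>. dist (fourier h \<xi>) 0 < 1 / 2) at_infinity" using tendstoD[OF lim, of "1 / 2"] by simp
  then obtain R where R: "\<And>\<xi>. R \<le> \<bar>\<xi>\<bar> \<Longrightarrow> cmod (fourier h \<xi>) < 1 / 2" by (auto simp: eventually_at_infinity)
  have iter: "1 - cmod (fourier h (2 ^ n * \<xi>)) \<le> 4 ^ n * (1 - cmod (fourier h \<xi>))" for n \<xi>
  proof (induction n)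
    case (Suc n)
    have "1 - cmod (fourier h (2 * (2 ^ n * \<xi>))) \<le> 4 * (1 - cmod (fourier h (2 ^ n * \<xi>)))" by (rule fourier_doubling[OF h])
    also have "\<dots> \<le> 4 * (4 ^ n * (1 - cmod (fourier h \<xi>)))" using Suc by simp
    finally show ?case by (simp add: mult.assoc)
  qed simp
  obtain n :: nat where n: "R / \<rho> < 2 ^ n" using real_arch_pow[of 2 "R / \<rho>"] by auto
  define \<theta> :: real where "\<theta> = 1 - 1 / (2 * 4 ^ n)"
  have p4: "(1::real) \<le> 4 ^ n" by simp
  have "cmod (fourier h \<xi>) \<le> \<theta>" if "\<rho> \<le> \<bar>\<xi>\<bar>" for \<xi>
  proof -
    have "R \<le> 2 ^ n * \<rho>" using n \<rho> by (simp add: field_simps)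
    also have "\<dots> \<le> \<bar>2 ^ n * \<xi>\<bar>" using that by (simp add: abs_mult)
    finally have "1 / 2 \<le> 4 ^ n * (1 - cmod (fourier h \<xi>))" using R[of "2 ^ n * \<xi>"] iter[of n \<xi>] by simp
    then show ?thesis by (simp add: \<theta>_def field_simps)
  qed
  moreover have "0 \<le> \<theta>" "\<theta> < 1"
  proof -
    have "1 \<le> 2 * (4::real) ^ n" using p4 by linarith
    then show "0 \<le> \<theta>" by (simp add: \<theta>_def divide_le_eq_1)
  qed (simp add: \<theta>_def)
  ultimately show thesis using that by blast
qed

lemma sobolev_weighted_L2:
  assumes "h \<in> sobolev_space \<eta>" and ih: "integrable lborel h" and \<eta>: "0 < \<eta>"
  obtains A where "0 \<le> A" "(\<integral>\<^sup>+\<xi>. ennreal (\<bar>\<xi>\<bar> powr (2 * \<eta>) * (cmod (fourier h \<xi>))\<^sup>2) \<partial>lborel) \<le> ennreal A"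
proof -
  obtain H where H: "is_L2_fourier h H" and fin: "(\<integral>\<^sup>+\<xi>. ennreal ((1 + \<xi>\<^sup>2) powr \<eta> * (cmod (H \<xi>))\<^sup>2) \<partial>lborel) < \<infinity>"
    using assms(1) by (auto simp: sobolev_space_def)
  have "(\<integral>\<^sup>+\<xi>. ennreal (\<bar>\<xi>\<bar> powr (2 * \<eta>) * (cmod (fourier h \<xi>))\<^sup>2) \<partial>lborel) \<le> (\<integral>\<^sup>+\<xi>. ennreal ((1 + \<xi>\<^sup>2) powr \<eta> * (cmod (H \<xi>))\<^sup>2) \<partial>lborel)"
  proof (rule nn_integral_mono_AE)
    show "AE \<xi> in lborel. ennreal (\<bar>\<xi>\<bar> powr (2 * \<eta>) * (cmod (fourier h \<xi>))\<^sup>2) \<le> ennreal ((1 + \<xi>\<^sup>2) powr \<eta> * (cmod (H \<xi>))\<^sup>2)"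
      using L2_fourier_eq_fourier[OF H ih]
    proof eventually_elim
      case (elim \<xi>)
      have "\<bar>\<xi>\<bar> powr (2 * \<eta>) = (\<bar>\<xi>\<bar> powr 2) powr \<eta>" by (simp only: powr_powr)
      also have "\<bar>\<xi>\<bar> powr 2 = \<xi>\<^sup>2" by (simp add: powr_realpow')
      also have "(\<xi>\<^sup>2) powr \<eta> \<le> (1 + \<xi>\<^sup>2) powr \<eta>" using \<eta> by (intro powr_mono2) auto
      finally show ?case unfolding elim by (intro ennreal_leI mult_right_mono) auto
    qed
  qed
  with fin have "(\<integral>\<^sup>+\<xi>. ennreal (\<bar>\<xi>\<bar> powr (2 * \<eta>) * (cmod (fourier h \<xi>))\<^sup>2) \<partial>lborel) < \<infinity>" by (rule le_less_trans[rotated])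
  then show thesis using that[of "enn2real (\<integral>\<^sup>+\<xi>. ennreal (\<bar>\<xi>\<bar> powr (2 * \<eta>) * (cmod (fourier h \<xi>))\<^sup>2) \<partial>lborel)"]
    by (simp add: ennreal_enn2real_if less_top[symmetric])
qed

section \<open>From transforms to the \<open>L\<^sup>1\<close> distance\<close>

text \<open>Frequencies up to \<open>M\<close> are estimated pointwise, the others by the weighted norms.\<close>

lemma L2_norm_fourier_diff_le:
  assumes [measurable]: "\<phi> \<in> borel_measurable borel" "\<psi> \<in> borel_measurable borel"
    and low: "\<And>y. cmod (\<phi> y - \<psi> y) \<le> D * \<bar>y\<bar> powr a * \<epsilon>" and "0 \<le> D" "0 \<le> \<epsilon>" "0 \<le> a" "0 \<le> k" "0 \<le> B"
    and high: "(\<integral>\<^sup>+y. indicator {y. R \<le> \<bar>y\<bar>} y * ennreal (\<bar>y\<bar> powr k * (cmod (\<phi> y))\<^sup>2) \<partial>lborel) \<le> ennreal B"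
      "(\<integral>\<^sup>+y. indicator {y. R \<le> \<bar>y\<bar>} y * ennreal (\<bar>y\<bar> powr k * (cmod (\<psi> y))\<^sup>2) \<partial>lborel) \<le> ennreal B"
    and M: "R \<le> M" "0 < M"
  shows "(\<integral>\<^sup>+y. ennreal ((cmod (\<phi> y - \<psi> y))\<^sup>2) \<partial>lborel) \<le> ennreal (2 * M * (D * M powr a * \<epsilon>)\<^sup>2 + 4 * B * M powr - k)"
proof -
  let ?h = "\<lambda>(u :: real \<Rightarrow> complex) y. (indicator {y. R \<le> \<bar>y\<bar>} y :: ennreal) * ennreal (\<bar>y\<bar> powr k * (cmod (u y))\<^sup>2)"
  let ?c = "ennreal ((D * M powr a * \<epsilon>)\<^sup>2)" and ?d = "ennreal (2 * M powr - k)"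
  have "(\<integral>\<^sup>+y. ennreal ((cmod (\<phi> y - \<psi> y))\<^sup>2) \<partial>lborel) \<le> (\<integral>\<^sup>+y. ?c * indicator {-M..M} y + ?d * (?h \<phi> y + ?h \<psi> y) \<partial>lborel)"
  proof (rule nn_integral_mono)
    fix y :: real
    show "ennreal ((cmod (\<phi> y - \<psi> y))\<^sup>2) \<le> ?c * indicator {-M..M} y + ?d * (?h \<phi> y + ?h \<psi> y)"
    proof (cases "\<bar>y\<bar> \<le> M")
      case True
      have "cmod (\<phi> y - \<psi> y) \<le> D * M powr a * \<epsilon>"
        using assms True by (intro order_trans[OF low] mult_right_mono mult_left_mono powr_mono2) auto
      then have "(cmod (\<phi> y - \<psi> y))\<^sup>2 \<le> (D * M powr a * \<epsilon>)\<^sup>2" by (intro power_mono) auto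
      moreover have "indicator {-M..M} y = (1::ennreal)" using True by (simp add: indicator_def) linarith
      ultimately show ?thesis by (auto intro!: add_increasing2 ennreal_leI)
    next
      case False
      define X Y where "X = cmod (\<phi> y)" and "Y = cmod (\<psi> y)"
      have "(cmod (\<phi> y - \<psi> y))\<^sup>2 \<le> (X + Y)\<^sup>2" unfolding X_def Y_def by (intro power_mono norm_triangle_ineq4) auto
      also have "\<dots> \<le> 2 * (X\<^sup>2 + Y\<^sup>2)" using zero_le_power2[of "X - Y"] by (simp add: power2_eq_square algebra_simps)
      also have "\<dots> \<le> 2 * (M powr - k * \<bar>y\<bar> powr k) * (X\<^sup>2 + Y\<^sup>2)"
      proof (rule mult_right_mono)
        have "1 = M powr - k * M powr k" using M by (simp flip: powr_add)
        also have "\<dots> \<le> M powr - k * \<bar>y\<bar> powr k" using False assms by (intro mult_left_mono powr_mono2) auto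
        finally show "2 \<le> 2 * (M powr - k * \<bar>y\<bar> powr k)" by simp
      qed auto
      also have "\<dots> = 2 * M powr - k * (\<bar>y\<bar> powr k * X\<^sup>2 + \<bar>y\<bar> powr k * Y\<^sup>2)" by (simp add: algebra_simps)
      finally have "ennreal ((cmod (\<phi> y - \<psi> y))\<^sup>2) \<le> ennreal (2 * M powr - k * (\<bar>y\<bar> powr k * X\<^sup>2 + \<bar>y\<bar> powr k * Y\<^sup>2))" by (rule ennreal_leI)
      also have "\<dots> = ?d * (ennreal (\<bar>y\<bar> powr k * X\<^sup>2) + ennreal (\<bar>y\<bar> powr k * Y\<^sup>2))"
        by (subst ennreal_plus[symmetric]) (auto simp del: ennreal_plus simp flip: ennreal_mult)
      also have "\<dots> = ?d * (?h \<phi> y + ?h \<psi> y)" using False M by (simp add: X_def Y_def)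
      finally show ?thesis by (rule order_trans) (simp add: add_increasing)
    qed
  qed
  also have "\<dots> = ?c * (2 * M) + ?d * ((\<integral>\<^sup>+y. ?h \<phi> y \<partial>lborel) + (\<integral>\<^sup>+y. ?h \<psi> y \<partial>lborel))"
    using M by (simp add: nn_integral_add nn_integral_cmult nn_integral_cmult_indicator)
  also have "\<dots> \<le> ?c * (2 * M) + ?d * (ennreal B + ennreal B)"
    by (intro add_mono mult_left_mono high) auto
  also have "\<dots> = ennreal (2 * M * (D * M powr a * \<epsilon>)\<^sup>2 + 4 * B * M powr - k)"
  proof -
    have "ennreal B + ennreal B = ennreal (2 * B)"
      using \<open>0 \<le> B\<close> by (subst ennreal_plus[symmetric]) (auto simp del: ennreal_plus)
    moreover have "?c * ennreal (2 * M) = ennreal (2 * M * (D * M powr a * \<epsilon>)\<^sup>2)"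
      using M by (subst ennreal_mult[symmetric]) (auto simp: mult_ac)
    moreover have "?d * ennreal (2 * B) = ennreal (4 * B * M powr - k)"
      using \<open>0 \<le> B\<close> by (subst ennreal_mult[symmetric]) (auto simp: mult_ac)
    ultimately show ?thesis using M \<open>0 \<le> B\<close> by (simp only:) (subst ennreal_plus[symmetric], auto)
  qed
  finally show ?thesis .
qed

text \<open>The interval \<open>{-r..r}\<close> is treated by the Plancherel inequality, its complement by the second moments.\<close>

lemma L1_norm_diff_le:
  assumes g: "integrable lborel g" "AE v in lborel. g v \<ge> 0" "(\<integral>\<^sup>+v. ennreal (v\<^sup>2 * g v) \<partial>lborel) \<le> ennreal m"
    and h: "integrable lborel h" "AE v in lborel. h v \<ge> 0" "(\<integral>\<^sup>+v. ennreal (v\<^sup>2 * h v) \<partial>lborel) \<le> ennreal m"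
    and m: "0 \<le> m"
    and A: "(\<integral>\<^sup>+\<xi>. ennreal ((cmod (fourier g \<xi> - fourier h \<xi>))\<^sup>2) \<partial>lborel) \<le> ennreal A" "0 \<le> A"
    and r: "0 < r" and \<mu>: "0 < \<mu>"
  shows "L1_norm (\<lambda>v. g v - h v) \<le> \<mu> * A / (4 * pi) + r / \<mu> + 2 * m / r\<^sup>2"
proof -
  have [measurable]: "g \<in> borel_measurable borel" "h \<in> borel_measurable borel"
    using g(1) h(1) by (auto dest: borel_measurable_integrable)
  define w where "w v = g v - h v" for v
  have w: "integrable lborel w" unfolding w_def using g(1) h(1) by (rule Bochner_Integration.integrable_diff)
  have [measurable]: "w \<in> borel_measurable borel" using w by (auto dest: borel_measurable_integrable)
  have "(LINT v|lborel. indicator {-r..r} v * \<bar>w v\<bar>) \<le> \<mu> * A / (4 * pi) + r / \<mu>"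
    by (rule local_L1_le[OF w]) (use A r \<mu> fourier_diff[OF g(1) h(1)] in \<open>auto simp: w_def[abs_def]\<close>)
  moreover have "(LINT v|lborel. indicator (- {-r..r}) v * \<bar>w v\<bar>) \<le> 2 * m / r\<^sup>2"
  proof (rule integral_real_bounded)
    have "(\<integral>\<^sup>+v. ennreal (indicator (- {-r..r}) v * \<bar>w v\<bar>) \<partial>lborel) \<le> (\<integral>\<^sup>+v. ennreal (1 / r\<^sup>2) * (ennreal (v\<^sup>2 * g v) + ennreal (v\<^sup>2 * h v)) \<partial>lborel)"
    proof (rule nn_integral_mono_AE)
      show "AE v in lborel. ennreal (indicator (- {-r..r}) v * \<bar>w v\<bar>) \<le> ennreal (1 / r\<^sup>2) * (ennreal (v\<^sup>2 * g v) + ennreal (v\<^sup>2 * h v))"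
        using g(2) h(2)
      proof eventually_elim
        case (elim v)
        have "indicator (- {-r..r}) v * \<bar>w v\<bar> \<le> 1 / r\<^sup>2 * (v\<^sup>2 * g v + v\<^sup>2 * h v)"
        proof (cases "v \<in> {-r..r}")
          case False
          then have "r \<le> \<bar>v\<bar>" by auto
          then have "r\<^sup>2 \<le> v\<^sup>2" using r by (metis abs_of_pos abs_le_square_iff)
          then have "1 \<le> v\<^sup>2 / r\<^sup>2" using r by simp
          moreover have "\<bar>w v\<bar> \<le> g v + h v" using elim by (auto simp: w_def)
          ultimately have "1 * \<bar>w v\<bar> \<le> v\<^sup>2 / r\<^sup>2 * (g v + h v)" by (intro mult_mono) auto
          then show ?thesis using False by (simp add: algebra_simps add_divide_distrib)
        qed (use elim in auto)
        then have "ennreal (indicator (- {-r..r}) v * \<bar>w v\<bar>) \<le> ennreal (1 / r\<^sup>2 * (v\<^sup>2 * g v + v\<^sup>2 * h v))" by (rule ennreal_leI)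
        also have "\<dots> = ennreal (1 / r\<^sup>2) * (ennreal (v\<^sup>2 * g v) + ennreal (v\<^sup>2 * h v))"
          using elim by (subst ennreal_plus[symmetric]) (auto simp del: ennreal_plus simp flip: ennreal_mult)
        finally show ?case .
      qed
    qed
    also have "\<dots> = ennreal (1 / r\<^sup>2) * ((\<integral>\<^sup>+v. ennreal (v\<^sup>2 * g v) \<partial>lborel) + (\<integral>\<^sup>+v. ennreal (v\<^sup>2 * h v) \<partial>lborel))"
      by (simp add: nn_integral_add nn_integral_cmult)
    also have "\<dots> \<le> ennreal (1 / r\<^sup>2) * (ennreal m + ennreal m)" by (intro mult_left_mono add_mono g h) auto
    also have "\<dots> = ennreal (2 * m / r\<^sup>2)" 
      using m by (subst ennreal_plus[symmetric]) (auto simp: simp del: ennreal_plus simp flip: ennreal_mult)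
    finally show "(\<integral>\<^sup>+v. ennreal (indicator (- {-r..r}) v * \<bar>w v\<bar>) \<partial>lborel) \<le> ennreal (2 * m / r\<^sup>2)" .
  qed (use m in auto)
  moreover have "L1_norm w = (LINT v|lborel. indicator {-r..r} v * \<bar>w v\<bar> + indicator (- {-r..r}) v * \<bar>w v\<bar>)"
    unfolding L1_norm_def by (intro Bochner_Integration.integral_cong) (auto simp: indicator_def)
  moreover have "(LINT v|lborel. indicator {-r..r} v * \<bar>w v\<bar> + indicator (- {-r..r}) v * \<bar>w v\<bar>) = (LINT v|lborel. indicator {-r..r} v * \<bar>w v\<bar>) + (LINT v|lborel. indicator (- {-r..r}) v * \<bar>w v\<bar>)"
  proof (rule Bochner_Integration.integral_add)
    show "integrable lborel (\<lambda>v. indicator {-r..r} v * \<bar>w v\<bar>)" "integrable lborel (\<lambda>v. indicator (- {-r..r}) v * \<bar>w v\<bar>)"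
      using integrable_mult_indicator[OF _ integrable_abs[OF w], of "{-r..r}"] integrable_mult_indicator[OF _ integrable_abs[OF w], of "- {-r..r}"] by simp_all
  qed
  ultimately show ?thesis unfolding w_def[abs_def] by simp
qed

lemma integrable_lower_moment:
  fixes h :: "real \<Rightarrow> real"
  assumes h: "h \<in> borel_measurable borel" "integrable lborel (\<lambda>v. v\<^sup>2 * h v)"
    "integrable lborel (\<lambda>v. \<bar>v\<bar> powr (2 + b) * h v)" and d: "0 \<le> d" "d \<le> b"
  shows "integrable lborel (\<lambda>v. \<bar>v\<bar> powr (2 + d) * h v)"
proof (rule Bochner_Integration.integrable_bound[OF Bochner_Integration.integrable_add[OF integrable_abs[OF h(2)] integrable_abs[OF h(3)]]])
  note h(1)[measurable]
  show "(\<lambda>v. \<bar>v\<bar> powr (2 + d) * h v) \<in> borel_measurable lborel" by measurable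
  have *: "\<bar>v\<bar> powr (2 + d) \<le> v\<^sup>2 + \<bar>v\<bar> powr (2 + b)" for v :: real
  proof (cases "\<bar>v\<bar> \<le> 1")
    case True
    have "\<bar>v\<bar> powr (2 + d) \<le> \<bar>v\<bar> powr 2" using True d by (intro powr_mono') auto
    also have "\<dots> = v\<^sup>2" by (simp add: powr_realpow')
    finally show ?thesis by (simp add: add_increasing2)
  next
    case False
    then have "\<bar>v\<bar> powr (2 + d) \<le> \<bar>v\<bar> powr (2 + b)" using d by (intro powr_mono) auto
    then show ?thesis by (simp add: add_increasing)
  qed
  have "\<bar>\<bar>v\<bar> powr (2 + d) * h v\<bar> \<le> \<bar>v\<^sup>2 * h v\<bar> + \<bar>\<bar>v\<bar> powr (2 + b) * h v\<bar>" for v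
    using mult_right_mono[OF *[of v], of "\<bar>h v\<bar>"] by (simp add: abs_mult distrib_right)
  then show "AE v in lborel. norm (\<bar>v\<bar> powr (2 + d) * h v) \<le> norm (\<bar>v\<^sup>2 * h v\<bar> + \<bar>\<bar>v\<bar> powr (2 + b) * h v\<bar>)"
    by (intro AE_I2) simp
qed

lemma L1_norm_rescale:
  assumes s: "0 < s" 
  shows "L1_norm (\<lambda>v. f v - 1 / s * g (v / s)) = L1_norm (\<lambda>v. s * f (s * v) - g v)"
proof -
  have "L1_norm (\<lambda>v. f v - 1 / s * g (v / s)) = \<bar>s\<bar> *\<^sub>R (LINT v|lborel. \<bar>f (0 + s * v) - 1 / s * g ((0 + s * v) / s)\<bar>)"
    unfolding L1_norm_def by (rule lborel_integral_real_affine) (use s in auto)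
  also have "\<dots> = (LINT v|lborel. s * \<bar>f (s * v) - 1 / s * g v\<bar>)" using s by simp
  also have "\<dots> = L1_norm (\<lambda>v. s * f (s * v) - g v)" unfolding L1_norm_def
  proof (rule Bochner_Integration.integral_cong[OF refl])
    fix v
    have "s * f (s * v) - g v = s * (f (s * v) - 1 / s * g v)" using s by (simp add: right_diff_distrib)
    then show "s * \<bar>f (s * v) - 1 / s * g v\<bar> = \<bar>s * f (s * v) - g v\<bar>" using s by (simp add: abs_mult)
  qed
  finally show ?thesis .
qed

section \<open>Convergence to self-similarity\<close>

theorem mainTheorem5:
  fixes p q \<delta>max \<eta> \<nu> :: real
    and f0 ginf :: "real \<Rightarrow> real"
    and f :: "real \<Rightarrow> real \<Rightarrow> real"
  assumes "0 < q" and "q \<le> p" and "p\<^sup>2 + q\<^sup>2 < 1"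
    and "0 < \<delta>max" and "\<delta>max < 1"
    and "\<And>\<delta>. 0 < \<delta> \<Longrightarrow> \<delta> < \<delta>max \<Longrightarrow> S_pq p q \<delta> < 0"
    and "AE v in lborel. f0 v \<ge> 0"
    and "has_bochner_integral lborel f0 1"
    and "has_bochner_integral lborel (\<lambda>v. v * f0 v) 0"
    and "has_bochner_integral lborel (\<lambda>v. v\<^sup>2 * f0 v) 1"
    and "integrable lborel (\<lambda>v. \<bar>v\<bar> powr (2 + \<delta>max) * f0 v)"
    and "\<eta> > 0" and "f0 \<in> sobolev_space \<eta>"
    and "\<nu> > 0" and "(\<lambda>v. sqrt (f0 v)) \<in> hom_sobolev_space \<nu>"
    and "is_solution p q f0 f"
    and "is_stationary_profile p q \<delta>max ginf"
  shows "\<exists>C>0. \<exists>\<gamma>>0. \<forall>t\<ge>0.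
    L1_norm (\<lambda>v. f t v - self_similar_state p q ginf t v) \<le> C * exp (- \<gamma> * t)"
proof -
  note f0 = assms(7-10) and sol = assms(16) and prof = assms(17)
  have ginf: "AE v in lborel. ginf v \<ge> 0" "has_bochner_integral lborel ginf 1"
    "has_bochner_integral lborel (\<lambda>v. v * ginf v) 0" "has_bochner_integral lborel (\<lambda>v. v\<^sup>2 * ginf v) 1"
    using prof by (auto simp: is_stationary_profile_def)
  have if0: "integrable lborel f0" and ig: "integrable lborel ginf" 
    using f0(2) ginf(2) by (auto simp: has_bochner_integral_iff)
  have [measurable]: "f0 \<in> borel_measurable borel" "ginf \<in> borel_measurable borel"
    using if0 ig by (auto dest: borel_measurable_integrable)
  interpret F: wild_flow p q "\<lambda>t. fourier (f t)"
    by (rule wild_flow_solution[OF assms(1-3) sol f0(2)])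
  let ?c = "cooling_rate p q"
  define G where "G t \<xi> = fourier ginf (exp (- (?c * t)) * \<xi>)" for t \<xi>
  have flowG: "wild_flow p q G"
    unfolding G_def by (rule wild_flow_profile[OF assms(1-3) prof])
  have init: "fourier (f 0) \<xi> = fourier f0 \<xi>" for \<xi> using sol by (simp add: is_solution_def)
  define \<delta> where "\<delta> = \<delta>max / 2"
  have \<delta>: "0 < \<delta>" "\<delta> < \<delta>max" "\<delta> < 1" using assms(4,5) by (auto simp: \<delta>_def)
  define a where "a = 2 + \<delta>"
  define \<kappa> where "\<kappa> = - S_pq p q \<delta>"
  have \<kappa>: "0 < \<kappa>" using assms(6)[OF \<delta>(1,2)] by (simp add: \<kappa>_def)

  define m0 where "m0 = (LINT v|lborel. \<bar>v\<bar> powr (2 + \<delta>) * f0 v)"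
  define m1 where "m1 = (LINT v|lborel. \<bar>v\<bar> powr (2 + \<delta>) * ginf v)"
  have T0: "cmod (fourier f0 \<xi> - complex_of_real (1 - \<xi>\<^sup>2 / 2)) \<le> m0 * \<bar>\<xi>\<bar> powr a" for \<xi>
    unfolding m0_def a_def
  proof (rule fourier_taylor2[OF f0])
    show "integrable lborel (\<lambda>v. \<bar>v\<bar> powr (2 + \<delta>) * f0 v)"
      by (rule integrable_lower_moment[OF _ _ assms(11)]) (use f0(4) \<delta> in \<open>auto simp: has_bochner_integral_iff\<close>)
  qed (use \<delta> in auto)
  have T1: "cmod (fourier ginf \<xi> - complex_of_real (1 - \<xi>\<^sup>2 / 2)) \<le> m1 * \<bar>\<xi>\<bar> powr a" for \<xi>
    unfolding m1_def a_def
    by (rule fourier_taylor2[OF ginf]) (use prof \<delta> in \<open>auto simp: is_stationary_profile_def\<close>)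
  have "0 \<le> m0" using order_trans[OF norm_ge_zero T0[of 1]] by simp
  moreover have "0 \<le> m1" using order_trans[OF norm_ge_zero T1[of 1]] by simp
  moreover define D where "D = m0 + m1"
  ultimately have D: "0 \<le> D" "0 \<le> m1" by auto
  have D_init: "cmod (fourier (f 0) \<xi> - G 0 \<xi>) \<le> D * \<bar>\<xi>\<bar> powr a" for \<xi>
  proof -
    have "cmod (fourier f0 \<xi> - fourier ginf \<xi>) \<le> cmod (fourier f0 \<xi> - complex_of_real (1 - \<xi>\<^sup>2 / 2)) + cmod (fourier ginf \<xi> - complex_of_real (1 - \<xi>\<^sup>2 / 2))"
      using norm_triangle_ineq4[of "fourier f0 \<xi> - complex_of_real (1 - \<xi>\<^sup>2 / 2)" "fourier ginf \<xi> - complex_of_real (1 - \<xi>\<^sup>2 / 2)"] by simp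
    then show ?thesis using T0[of \<xi>] T1[of \<xi>] by (simp add: G_def init D_def distrib_right)
  qed
  have close: "cmod (fourier (f t) (F.dil t * y) - fourier ginf y) \<le> D * \<bar>y\<bar> powr a * exp (- \<kappa> * t)" if t: "0 \<le> t" for t y
  proof -
    have "G t (F.dil t * y) = fourier ginf y" by (simp add: G_def mult.assoc[symmetric] flip: exp_add)
    then have "cmod (fourier (f t) (F.dil t * y) - fourier ginf y) \<le> D * \<bar>F.dil t * y\<bar> powr a * exp ((p powr a + q powr a - 1) * t)"
      using flow_contraction[OF F.wild_flow_axioms flowG _ D(1) D_init t, of "F.dil t * y"] \<delta> by (simp add: a_def)
    also have "\<bar>F.dil t * y\<bar> powr a = exp (a * (?c * t)) * \<bar>y\<bar> powr a"
      by (simp add: abs_mult powr_mult exp_powr_real mult.commute)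
    also have "D * (exp (a * (?c * t)) * \<bar>y\<bar> powr a) * exp ((p powr a + q powr a - 1) * t) = D * \<bar>y\<bar> powr a * exp (a * (?c * t) + (p powr a + q powr a - 1) * t)"
      by (simp add: exp_add)
    also have "a * (?c * t) + (p powr a + q powr a - 1) * t = - \<kappa> * t"
      by (simp add: \<kappa>_def S_pq_def a_def cooling_rate_def field_simps)
    finally show ?thesis .
  qed

  define K where "K = D + m1 + 1"
  have K: "0 < K" using D by (simp add: K_def)
  have taylor: "cmod (fourier (f t) (F.dil t * y) - complex_of_real (1 - y\<^sup>2 / 2)) \<le> K * \<bar>y\<bar> powr a" if t: "0 \<le> t" for t y
  proof -
    have "D * \<bar>y\<bar> powr a * exp (- \<kappa> * t) \<le> D * \<bar>y\<bar> powr a * 1" using D \<kappa> t by (intro mult_left_mono) auto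
    then have "cmod (fourier (f t) (F.dil t * y) - fourier ginf y) \<le> D * \<bar>y\<bar> powr a" using close[OF t, of y] by linarith
    then have "cmod (fourier (f t) (F.dil t * y) - complex_of_real (1 - y\<^sup>2 / 2)) \<le> D * \<bar>y\<bar> powr a + m1 * \<bar>y\<bar> powr a"
      by (rule norm_diff_triangle_le[OF _ T1])
    also have "\<dots> \<le> K * \<bar>y\<bar> powr a" by (simp add: K_def distrib_right)
    finally show ?thesis .
  qed
  \<comment> \<open>Chosen so that the Taylor remainder \<open>K * \<bar>y\<bar> powr a\<close> is at most \<open>y\<^sup>2 / 4\<close> on the ball of radius \<open>\<rho>\<close>.\<close>
  define \<rho> where "\<rho> = min 1 ((1 / (4 * K)) powr (1 / \<delta>))"
  have \<rho>: "0 < \<rho>" "\<rho> \<le> 1" using K by (auto simp: \<rho>_def)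
  have small: "K * \<bar>y\<bar> powr a \<le> y\<^sup>2 / 4" if "\<bar>y\<bar> \<le> \<rho>" for y
  proof -
    have "\<bar>y\<bar> powr \<delta> \<le> ((1 / (4 * K)) powr (1 / \<delta>)) powr \<delta>" using that \<delta> by (intro powr_mono2) (auto simp: \<rho>_def)
    also have "\<dots> = 1 / (4 * K)" using \<delta> K by (simp add: powr_powr)
    finally have "K * \<bar>y\<bar> powr \<delta> \<le> 1 / 4" using K by (simp add: field_simps)
    from mult_right_mono[OF this, of "y\<^sup>2"] have "K * \<bar>y\<bar> powr \<delta> * y\<^sup>2 \<le> y\<^sup>2 / 4" by simp
    moreover have "\<bar>y\<bar> powr a = y\<^sup>2 * \<bar>y\<bar> powr \<delta>" by (simp add: a_def powr_add powr_realpow')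
    ultimately show ?thesis by (simp add: mult_ac)
  qed
  have near: "cmod (fourier (f t) (F.dil t * y)) \<le> 1 - y\<^sup>2 / 4" "cmod (1 - fourier (f t) (F.dil t * y)) \<le> 1 * y\<^sup>2"
    if t: "0 \<le> t" and y: "\<bar>y\<bar> \<le> \<rho>" for t y
  proof -
    define z where "z = fourier (f t) (F.dil t * y)"
    have z: "cmod (z - complex_of_real (1 - y\<^sup>2 / 2)) \<le> y\<^sup>2 / 4" using taylor[OF t, of y] small[OF y] unfolding z_def by linarith
    have "\<bar>y\<bar> \<le> 1" using y \<rho> by simp
    then have y1: "y\<^sup>2 \<le> 1" by (simp add: abs_square_le_1)
    have "cmod z \<le> cmod (complex_of_real (1 - y\<^sup>2 / 2)) + cmod (z - complex_of_real (1 - y\<^sup>2 / 2))"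
      using norm_triangle_sub[of z "complex_of_real (1 - y\<^sup>2 / 2)"] by simp
    also have "cmod (complex_of_real (1 - y\<^sup>2 / 2)) = 1 - y\<^sup>2 / 2" unfolding norm_of_real using y1 by simp
    finally show "cmod (fourier (f t) (F.dil t * y)) \<le> 1 - y\<^sup>2 / 4" using z unfolding z_def by simp
    have "cmod (1 - z) \<le> cmod (complex_of_real (y\<^sup>2 / 2)) + cmod (z - complex_of_real (1 - y\<^sup>2 / 2))"
      using norm_triangle_ineq4[of "complex_of_real (y\<^sup>2 / 2)" "z - complex_of_real (1 - y\<^sup>2 / 2)"] by simp
    also have "cmod (complex_of_real (y\<^sup>2 / 2)) = y\<^sup>2 / 2" unfolding norm_of_real by simp
    finally show "cmod (1 - fourier (f t) (F.dil t * y)) \<le> 1 * y\<^sup>2" using z zero_le_power2[of y] unfolding z_def by linarith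
  qed

  obtain A where A: "0 \<le> A" "(\<integral>\<^sup>+\<xi>. ennreal (\<bar>\<xi>\<bar> powr (2 * \<eta>) * (cmod (fourier f0 \<xi>))\<^sup>2) \<partial>lborel) \<le> ennreal A"
    using sobolev_weighted_L2[OF assms(13) if0 assms(12)] by blast
  define k where "k = 2 * \<eta>"
  have k: "0 < k" using assms(12) by (simp add: k_def)
  have lim0: "(fourier f0 \<longlongrightarrow> 0) at_infinity"
  proof (rule lipschitz_weighted_L2_vanishes_at_infinity[OF _ k])
    show "cmod (fourier f0 x - fourier f0 y) \<le> L1_norm (\<lambda>v. v * f0 v) * \<bar>x - y\<bar>" for x y
      using f0(3) by (intro fourier_lipschitz if0) (auto simp: has_bochner_integral_iff)
  qed (use A in \<open>auto simp: k_def\<close>)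
  obtain \<theta>0 where \<theta>0: "0 \<le> \<theta>0" "\<theta>0 < 1" "\<And>\<xi>. \<rho> \<le> \<bar>\<xi>\<bar> \<Longrightarrow> cmod (fourier f0 \<xi>) \<le> \<theta>0"
    using density_fourier_bounded_away_from_1[OF f0(1,2) lim0 \<rho>(1)] by blast
  define \<theta> where "\<theta> = max \<theta>0 (1 - (q * \<rho>)\<^sup>2 / 4)"
  have q\<rho>: "0 < q * \<rho>" using assms(1) \<rho> by simp
  have \<theta>: "0 \<le> \<theta>" "\<theta> < 1" using \<theta>0 q\<rho> by (auto simp: \<theta>_def le_max_iff_disj)
  have "F.bounded_beyond (q * \<rho>) \<theta>"
    unfolding F.bounded_beyond_def
  proof (intro allI impI)
    fix t \<xi> assume t: "0 \<le> t" "q * \<rho> * F.dil t \<le> \<bar>\<xi>\<bar>"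
    show "cmod (fourier (f t) \<xi>) \<le> \<theta>"
    proof (rule F.bound_propagates_from_annulus[OF \<rho>(1) _ _ _ t])
      show "\<theta> \<le> 1" using \<theta> by simp
      show "cmod (fourier (f 0) \<xi>) \<le> \<theta>" if "\<rho> \<le> \<bar>\<xi>\<bar>" for \<xi>
        using \<theta>0(3)[OF that] by (simp add: init \<theta>_def)
      fix t \<xi> :: real
      assume t: "0 \<le> t" and lo: "q * \<rho> * F.dil t \<le> \<bar>\<xi>\<bar>" and hi: "\<bar>\<xi>\<bar> \<le> \<rho> * F.dil t"
      define y where "y = \<xi> / F.dil t"
      have y: "q * \<rho> \<le> \<bar>y\<bar>" "\<bar>y\<bar> \<le> \<rho>" "F.dil t * y = \<xi>"
        using lo hi by (auto simp: y_def field_simps)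
      have "(q * \<rho>)\<^sup>2 \<le> y\<^sup>2" using y(1) q\<rho> by (metis abs_le_square_iff abs_of_pos)
      then show "cmod (fourier (f t) \<xi>) \<le> \<theta>"
        using near(1)[OF t y(2)] unfolding y(3) \<theta>_def by (simp add: le_max_iff_disj)
    qed
  qed
  \<comment> \<open>The decay level that makes the gain term absorbable in the norm with weight \<open>\<bar>\<xi>\<bar> powr k\<close>.\<close>
  moreover have "0 < sqrt (p powr (k + 1) / 2)" using F.p_pos by simp
  moreover have "(fourier (f 0) \<longlongrightarrow> 0) at_infinity" using lim0 by (simp add: init[abs_def])
  ultimately obtain R' where R': "0 < R'" "F.bounded_beyond R' (sqrt (p powr (k + 1) / 2))"
    using F.uniform_decay[OF _ _ q\<rho> \<theta>] by metis
  define R where "R = R' / q"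
  have R: "0 < R" "q * R = R'" using R'(1) assms(1) by (auto simp: R_def)
  define B where "B = 2 * A + 2 * R powr (k + 1)"
  have B: "0 \<le> B" using A by (simp add: B_def)
  have high: "(\<integral>\<^sup>+y. indicator {y. R \<le> \<bar>y\<bar>} y * ennreal (\<bar>y\<bar> powr k * (cmod (fourier (f t) (F.dil t * y)))\<^sup>2) \<partial>lborel) \<le> ennreal B" if "0 \<le> t" for t
    unfolding B_def
  proof (rule F.weighted_L2_scaled[where \<theta>="sqrt (p powr (k + 1) / 2)"])
    have "p powr (k + 1) * p powr - (k + 1) = 1" using F.p_pos by (simp flip: powr_add)
    then show "(sqrt (p powr (k + 1) / 2))\<^sup>2 * p powr - (k + 1) \<le> 1 / 2" by simp
  qed (use R R' A k that in \<open>auto simp: init k_def\<close>)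
  have meas_f: "(\<lambda>y. fourier (f t) (F.dil t * y)) \<in> borel_measurable borel" if "0 \<le> t" for t
    using measurable_compose[OF _ borel_measurable_continuous_onI[OF F.continuous_F[OF that]], of "\<lambda>y. F.dil t * y" borel] by simp
  have [measurable]: "fourier ginf \<in> borel_measurable borel" by (intro fourier_measurable ig)
  have highg: "(\<integral>\<^sup>+y. indicator {y. R \<le> \<bar>y\<bar>} y * ennreal (\<bar>y\<bar> powr k * (cmod (fourier ginf y))\<^sup>2) \<partial>lborel) \<le> ennreal B"
  proof -
    let ?u = "\<lambda>n y. indicator {y. R \<le> \<bar>y\<bar>} y * ennreal (\<bar>y\<bar> powr k * (cmod (fourier (f (real n)) (F.dil (real n) * y)))\<^sup>2)"
    have lim: "(\<lambda>n. fourier (f (real n)) (F.dil (real n) * y)) \<longlonglongrightarrow> fourier ginf y" for y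
    proof (rule LIM_zero_cancel, rule Lim_null_comparison)
      show "eventually (\<lambda>n. cmod (fourier (f (real n)) (F.dil (real n) * y) - fourier ginf y) \<le> D * \<bar>y\<bar> powr a * exp (- \<kappa> * real n)) sequentially"
        by (intro always_eventually allI close) simp
      have "(\<lambda>n. exp (- \<kappa> * real n)) \<longlonglongrightarrow> 0" using \<kappa> by real_asymp
      from tendsto_mult_right_zero[OF this] show "(\<lambda>n. D * \<bar>y\<bar> powr a * exp (- \<kappa> * real n)) \<longlonglongrightarrow> 0" .
    qed
    have "(\<integral>\<^sup>+y. indicator {y. R \<le> \<bar>y\<bar>} y * ennreal (\<bar>y\<bar> powr k * (cmod (fourier ginf y))\<^sup>2) \<partial>lborel) = (\<integral>\<^sup>+y. liminf (\<lambda>n. ?u n y) \<partial>lborel)"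
    proof (intro nn_integral_cong lim_imp_Liminf[symmetric])
      fix y
      have "(\<lambda>n. ennreal (\<bar>y\<bar> powr k * (cmod (fourier (f (real n)) (F.dil (real n) * y)))\<^sup>2)) \<longlonglongrightarrow> ennreal (\<bar>y\<bar> powr k * (cmod (fourier ginf y))\<^sup>2)"
        by (intro tendsto_ennrealI tendsto_intros lim)
      then show "(\<lambda>n. ?u n y) \<longlonglongrightarrow> indicator {y. R \<le> \<bar>y\<bar>} y * ennreal (\<bar>y\<bar> powr k * (cmod (fourier ginf y))\<^sup>2)"
        by (cases "R \<le> \<bar>y\<bar>") auto
    qed simp
    also have "\<dots> \<le> liminf (\<lambda>n. \<integral>\<^sup>+y. ?u n y \<partial>lborel)"
    proof (rule nn_integral_liminf)
      fix n :: nat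
      note meas_f[of "real n", simplified, measurable]
      show "?u n \<in> borel_measurable lborel" by measurable
    qed
    also have "\<dots> \<le> liminf (\<lambda>n::nat. ennreal B)" by (intro Liminf_mono always_eventually allI high) simp
    also have "\<dots> = ennreal B" by (simp add: Liminf_const)
    finally show ?thesis .
  qed

  \<comment> \<open>With \<open>M = R * exp (\<mu> * t)\<close>, the low frequencies contribute \<open>M powr (2 * a + 1) * exp (- 2 * \<kappa> * t)\<close>, of order\<close>
  \<comment> \<open>\<open>exp (- \<kappa> * t)\<close>, and the high ones \<open>M powr - k\<close>, of order \<open>exp (- \<mu> * k * t)\<close>.\<close>
  define \<mu> where "\<mu> = \<kappa> / (2 * a + 1)"
  have a0: "0 < a" using \<delta> by (simp add: a_def)
  have \<mu>: "0 < \<mu>" "\<mu> * (2 * a + 1) = \<kappa>" using \<kappa> a0 by (auto simp: \<mu>_def)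
  define \<alpha> where "\<alpha> = min \<kappa> (\<mu> * k)"
  have \<alpha>: "0 < \<alpha>" using \<kappa> \<mu> k by (simp add: \<alpha>_def)
  define C2 where "C2 = 2 * D\<^sup>2 * R powr (2 * a + 1) + 4 * B * R powr - k"
  have C2: "0 \<le> C2" using B by (simp add: C2_def)
  have L2: "(\<integral>\<^sup>+y. ennreal ((cmod (fourier (f t) (F.dil t * y) - fourier ginf y))\<^sup>2) \<partial>lborel) \<le> ennreal (C2 * exp (- \<alpha> * t))" if t: "0 \<le> t" for t
  proof -
    define M where "M = R * exp (\<mu> * t)"
    have M: "R \<le> M" "0 < M" using R \<mu> t by (auto simp: M_def)
    have Mp: "M powr x = R powr x * exp (x * \<mu> * t)" for x using R by (simp add: M_def powr_mult exp_powr_real mult_ac)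
    have "(\<integral>\<^sup>+y. ennreal ((cmod (fourier (f t) (F.dil t * y) - fourier ginf y))\<^sup>2) \<partial>lborel) \<le> ennreal (2 * M * (D * M powr a * exp (- \<kappa> * t))\<^sup>2 + 4 * B * M powr - k)"
    proof (rule L2_norm_fourier_diff_le[where \<phi>="\<lambda>y. fourier (f t) (F.dil t * y)" and \<psi>="fourier ginf" and R=R])
      show "cmod (fourier (f t) (F.dil t * y) - fourier ginf y) \<le> D * \<bar>y\<bar> powr a * exp (- \<kappa> * t)" for y by (rule close[OF t])
      show "(\<integral>\<^sup>+y. indicator {y. R \<le> \<bar>y\<bar>} y * ennreal (\<bar>y\<bar> powr k * (cmod (fourier (f t) (F.dil t * y)))\<^sup>2) \<partial>lborel) \<le> ennreal B"
        by (rule high[OF t])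
    qed (use meas_f[OF t] D B M a0 k highg in auto)
    also have "2 * M * (D * M powr a * exp (- \<kappa> * t))\<^sup>2 + 4 * B * M powr - k \<le> C2 * exp (- \<alpha> * t)"
    proof -
      have e: "2 * a + 1 = 1 + (a + a)" by simp
      have "M * (M powr a)\<^sup>2 = M powr (2 * a + 1)"
        unfolding e powr_add power2_eq_square using M by (simp only: powr_one less_imp_le)
      then have "2 * M * (D * M powr a * exp (- \<kappa> * t))\<^sup>2 = 2 * D\<^sup>2 * M powr (2 * a + 1) * (exp (- \<kappa> * t))\<^sup>2"
        by (simp add: power_mult_distrib mult_ac)
      also have "\<dots> = 2 * D\<^sup>2 * R powr (2 * a + 1) * (exp ((2 * a + 1) * \<mu> * t) * (exp (- \<kappa> * t))\<^sup>2)"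
        unfolding Mp by simp
      also have "exp ((2 * a + 1) * \<mu> * t) * (exp (- \<kappa> * t))\<^sup>2 = exp (- \<kappa> * t)"
      proof -
        have "(2 * a + 1) * \<mu> * t = \<kappa> * t" using \<mu>(2) by (simp add: mult.commute)
        then show ?thesis by (simp add: power2_eq_square flip: exp_add)
      qed
      also have "2 * D\<^sup>2 * R powr (2 * a + 1) * exp (- \<kappa> * t) \<le> 2 * D\<^sup>2 * R powr (2 * a + 1) * exp (- \<alpha> * t)"
        using t by (intro mult_left_mono) (auto simp: \<alpha>_def intro: mult_right_mono)
      finally have 1: "2 * M * (D * M powr a * exp (- \<kappa> * t))\<^sup>2 \<le> 2 * D\<^sup>2 * R powr (2 * a + 1) * exp (- \<alpha> * t)" .
      have "4 * B * M powr - k = 4 * B * R powr - k * exp (- (\<mu> * k) * t)" unfolding Mp by (simp add: mult_ac)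
      also have "\<dots> \<le> 4 * B * R powr - k * exp (- \<alpha> * t)"
        using t B by (intro mult_left_mono) (auto simp: \<alpha>_def intro: mult_right_mono)
      finally show ?thesis using 1 by (simp add: C2_def distrib_right)
    qed
    finally show ?thesis by (simp add: ennreal_leI)
  qed

  have "L1_norm (\<lambda>v. f t v - self_similar_state p q ginf t v) \<le> (C2 + 5) * exp (- (\<alpha> / 4) * t)" if t: "0 \<le> t" for t
  proof -
    define s where "s = exp (- (?c * t))"
    define g where "g v = s * f t (s * v)" for v
    have s: "0 < s" by (simp add: s_def)
    have ift: "integrable lborel (f t)" and ft0: "AE v in lborel. f t v \<ge> 0" 
      using sol t by (auto simp: is_solution_def C1_L1_def)
    then have [measurable]: "f t \<in> borel_measurable borel" by (auto dest: borel_measurable_integrable)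
    have ig': "integrable lborel g" unfolding g_def by (rule integrable_dilation[OF s ift])
    have g1: "has_bochner_integral lborel g 1"
    proof -
      have "has_bochner_integral lborel (\<lambda>v. f t (0 + s * v)) (1 /\<^sub>R \<bar>s\<bar>)"
        using solution_mass[OF sol f0(2) t] s by (subst lborel_has_bochner_integral_real_affine_iff[symmetric]) auto
      from has_bochner_integral_mult_right[OF this, of s] show ?thesis using s by (simp add: g_def[abs_def])
    qed
    have g0: "AE v in lborel. g v \<ge> 0"
    proof -
      have "AE v in lborel. f t (0 + s * v) \<ge> 0" using s ft0 by (intro AE_borel_affine) auto
      then show ?thesis by eventually_elim (use s in \<open>simp add: g_def\<close>)
    qed
    have fg: "fourier g y = fourier (f t) (F.dil t * y)" for y
      unfolding g_def fourier_dilation[OF s ift] by (simp add: s_def exp_minus field_simps)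
    have g2: "(\<integral>\<^sup>+v. ennreal (v\<^sup>2 * g v) \<partial>lborel) \<le> ennreal (2 * 1)"
      by (rule second_moment_le[OF g0 g1 \<rho>(1)]) (use near(2)[OF t] in \<open>simp add: fg\<close>)
    have h2: "(\<integral>\<^sup>+v. ennreal (v\<^sup>2 * ginf v) \<partial>lborel) \<le> ennreal (2 * 1)"
    proof -
      have "(\<integral>\<^sup>+v. ennreal (v\<^sup>2 * ginf v) \<partial>lborel) = ennreal (LINT v|lborel. v\<^sup>2 * ginf v)"
        using ginf(1,4) by (intro nn_integral_eq_integral) (auto simp: has_bochner_integral_iff)
      also have "\<dots> = 1" using ginf(4) by (simp add: has_bochner_integral_iff)
      finally show ?thesis by simp
    qed
    \<comment> \<open>The three error terms are of orders \<open>\<beta> * exp (- \<alpha> * t)\<close>, \<open>r / \<beta>\<close> and \<open>1 / r\<^sup>2\<close>; all are at most of\<close>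
    \<comment> \<open>order \<open>exp (- (\<alpha> / 4) * t)\<close> for this choice.\<close>
    define r where "r = exp (\<alpha> / 4 * t)"
    define \<beta> where "\<beta> = exp (\<alpha> / 2 * t)"
    have e: "1 / sqrt (E_pq p q t) = 1 / s" "sqrt (E_pq p q t) = s"
    proof -
      have "E_pq p q t = s\<^sup>2" by (simp add: E_pq_def s_def cooling_rate_def power2_eq_square field_simps flip: exp_add)
      then show "sqrt (E_pq p q t) = s" using s by simp
      then show "1 / sqrt (E_pq p q t) = 1 / s" by simp
    qed
    have "L1_norm (\<lambda>v. f t v - self_similar_state p q ginf t v) = L1_norm (\<lambda>v. g v - ginf v)"
      unfolding self_similar_state_def e g_def by (rule L1_norm_rescale[OF s])
    also have "\<dots> \<le> \<beta> * (C2 * exp (- \<alpha> * t)) / (4 * pi) + r / \<beta> + 2 * (2 * 1) / r\<^sup>2"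
      by (rule L1_norm_diff_le[OF ig' g0 g2 ig ginf(1) h2]) (use L2[OF t] C2 in \<open>auto simp: fg r_def \<beta>_def\<close>)
    also have "\<dots> \<le> C2 * exp (- (\<alpha> / 4) * t) + exp (- (\<alpha> / 4) * t) + 4 * exp (- (\<alpha> / 4) * t)"
    proof (intro add_mono)
      have "\<beta> * exp (- \<alpha> * t) = exp (- (\<alpha> / 2) * t)" by (simp add: \<beta>_def algebra_simps flip: exp_add)
      also have "\<dots> \<le> exp (- (\<alpha> / 4) * t)" using \<alpha> t by (simp add: mult_right_mono)
      finally have "C2 * (\<beta> * exp (- \<alpha> * t)) \<le> C2 * exp (- (\<alpha> / 4) * t)" using C2 by (rule mult_left_mono)
      then have "\<beta> * (C2 * exp (- \<alpha> * t)) \<le> C2 * exp (- (\<alpha> / 4) * t)" by (simp only: mult.left_commute)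
      moreover have "1 \<le> 4 * pi" using pi_ge_two by linarith
      then have "\<beta> * (C2 * exp (- \<alpha> * t)) / (4 * pi) \<le> \<beta> * (C2 * exp (- \<alpha> * t)) / 1"
        using C2 by (intro divide_left_mono) (auto simp: \<beta>_def)
      ultimately show "\<beta> * (C2 * exp (- \<alpha> * t)) / (4 * pi) \<le> C2 * exp (- (\<alpha> / 4) * t)" by simp
      show "r / \<beta> \<le> exp (- (\<alpha> / 4) * t)" by (simp add: r_def \<beta>_def flip: exp_diff)
      have "1 / r\<^sup>2 = exp (- (\<alpha> / 2) * t)" by (simp add: r_def power2_eq_square exp_minus inverse_eq_divide flip: exp_add)
      also have "\<dots> \<le> exp (- (\<alpha> / 4) * t)" using \<alpha> t by (simp add: mult_right_mono)
      finally show "2 * (2 * 1) / r\<^sup>2 \<le> 4 * exp (- (\<alpha> / 4) * t)" by simp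
    qed
    also have "\<dots> = (C2 + 5) * exp (- (\<alpha> / 4) * t)" by (simp add: algebra_simps)
    finally show ?thesis .
  qed
  moreover have "0 < C2 + 5" "0 < \<alpha> / 4" using C2 \<alpha> by auto
  ultimately show ?thesis by blast
qed

end
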